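(* Assume the following. (1) Basis functions. There are sets $\Lambda_1,\Lambda_2,\Lambda_3$ of positive integers and real functions $\{\phi_{p,i}: 1\le i\le p,\ p\in\Lambda_1\}$, $\{\psi_{q,j}:1\le j\le q,\ q\in\Lambda_2\}$, $\{\theta_{r,k}:1\le k\le r,\ r\in\Lambda_3\}$ (on the ranges of $X$, $Y$, $Z$ respectively) such that for all $\alpha(X,Z)$, $\beta(Y,Z)$ with finite second moments $$\lim_{p,r\to\infty}\inf_{a(i,k)}E\Big(\alpha(X,Z)-\sum_{1\le i\le p,1\le k\le r}a(i,k)\phi_{p,i}(X)\theta_{r,k}(Z)\Big)^2=0,$$ $$\lim_{q,r\to\infty}\inf_{b(j,k)}E\Big(\beta(Y,Z)-\sum_{1\le j\le q,1\le k\le r}b(j,k)\psi_{q,j}(Y)\theta_{r,k}(Z)\Big)^2=0$$ (infima over real coefficients; $p\in\Lambda_1,q\in\Lambda_2,r\in\Lambda_3$), and for each $(p,q)$ there are real coefficients $a_{p,0,i}$, $b_{q,0,j}$ with $\sum_{i=1}^p a_{p,0,i}\phi_{p,i}(x)=1=\sum_{j=1}^q b_{q,0,j}\psi_{q,j}(y)$ for all $x\in\mathcal X$, $y\in\mathcal Y$. Moreover $|\phi_{p,i}|\le1$ and $|\psi_{q,j}|\le1$ for all indices. (2) Distribution. There is a $\sigma$-finite measure $\mu$ such that for every $z\in\mathcal Z$ the conditional distribution of $(X,Y)$ given $Z=z$ has a density $f(\cdot|z)$ with respect to $\mu$; $Z$ has a Lebesgue density $f_Z$; $f(x,y|z)$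 and $f_Z(z)$ are twice differentiable in $z$. There is a function $\bar h$ on $\mathcal X\times\mathcal Y$ with $\int\bar h\,d\mu<\infty$ and $$\sup_{z\in\mathcal Z}\max\Big(|f(x,y|z)|,\max_{1\le i\le d}\Big|\frac{\partial f(x,y|z)}{\partial z_i}\Big|,\max_{1\le i,j\le d}\Big|\frac{\partial^2 f(x,y|z)}{\partial z_i\partial z_j}\Big|\Big)\le\bar h(x,y).$$ There are constants $c_0,c_1$ with $$\sup_{z\in\mathcal Z}\max\Big(|f_Z(z)|,\max_i\Big|\frac{\partial f_Z(z)}{\partial z_i}\Big|,\max_{i,j}\Big|\frac{\partial^2f_Z(z)}{\partial z_i\partial z_j}\Big|\Big)\le c_0,\qquad \frac1{f_Z(z)}\le c_1\ \ (z\in\mathcal Z).$$ (3) Kernel. $k_0\ge0$ on $R^d$, $\sup_uk_0(u)<\infty$, $\int k_0(u)\,du=1$, $\int uk_0(u)\,du=0$, $\int\|u\|^2k_0(u)\,du<\infty$, and there are positive constants $\gamma_2,\gamma_3$ not depending on $d$ with $k_0(a)\le\gamma_2^de^{-\gamma_3\|a\|^2}$ for all $a\in R^d$. (4) Bandwidth and evaluation points. $\{h_n\}$, $\{\varepsilon_n\}$ are sequences of positive numbers with $c_{3,1}n^{-\alpha}\le h_n\le c_{3,2}n^{-\alpha}$ for some positive constants $c_{3,1},c_{3,2}$ and some $1/(d+4)<\alpha<1/d$, and $h_n/\varepsilon_n=O(n^{-\beta})$ for some $\beta>0$. The points $z_1,\dots,z_{n_Z}$ lie in $\mathcal Z(\varepsilon_n)=\{z\in\mathcal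 Z:\{z'\in R^d:\|z'-z\|<\varepsilon_n\}\subset\mathcal Z\}$, and $\|z_k-z_{k^*}\|\ge h_n$ for $k\ne k^*$ and all large $n$. (5) Eigenvalues and rates. There is a sequence of positive numbers $\delta_n$ such that for $1\le k\le n_Z$ the smallest eigenvalues of $V_{1,1}(z_k)$ and $V_{2,2}(z_k)$ are at least $\delta_n$, and $$n_Z(p_n+q_n)^2\max\{1,\delta_n^{-1}(p_n+q_n)\}=O((\ln n)^{1/16}).$$ (6) There exist a constant $c_3>0$ and a sequence of positive numbers $\eta_{1,n}\to0$ such that $$\frac1{n_Z}\sum_{k=1}^{n_Z}f_Z(z_k)\rho^2_{p_n,q_n}(z_k)-c_3E\rho^2_{p_n,q_n}(Z)=o_P(\eta_{1,n}).$$ Let $a\in(0,1)$, let $\Phi$ be the standard normal distribution function, and let $\mu_{p_n,q_n}$, $\sigma^2_{p_n,q_n}$ be the mean and variance of the largest eigenvalue of $CC^T$, where $C$ is a $(p_n-1)\times(q_n-1)$ matrix with i.i.d. $N(0,1)$ entries. Then the test that rejects the hypothesis of conditional independence of $X$ and $Y$ given $Z$ when $$\frac{nh_n^dc_K\sum_{k=1}^{n_Z}\hat f_Z(z_k)\hat\rho^2(z_k)-n_Z\mu_{p_n,q_n}}{\sqrt{n_Z\sigma^2_{p_n,q_n}}}\ge\Phi^{-1}(1-a)$$ is consistent: if $X$ and $Y$ are not conditionally independent given $Z$, then the probability of this event tends to $1$ as $n\to\infty$.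
   Context: $X,Y,Z$ are random vectors with ranges $\mathcal X,\mathcal Y,\mathcal Z$, $\mathcal Z\subset R^d$, and $(X_1,Y_1,Z_1),(X_2,Y_2,Z_2),\dots$ are i.i.d. copies of $(X,Y,Z)$. $\|\cdot\|$ is the Euclidean norm for vectors and the Frobenius norm for matrices. All asymptotics are as $n\to\infty$. $p_n\in\Lambda_1$, $q_n\in\Lambda_2$ are positive integers with $p_n\to\infty$, $q_n\to\infty$; the number $n_Z$ and the points $z_1,\dots,z_{n_Z}$ may depend on $n$. Pointwise conditional expectations are $E(g(X,Y)|Z=z)=\int g(x,y)f(x,y|z)\,d\mu(x,y)$. $V_{1,1}(z)=(E(\phi_{p_n,i}(X)\phi_{p_n,j}(X)|Z=z))_{p_n\times p_n}$ and $V_{2,2}(z)=(E(\psi_{q_n,i}(Y)\psi_{q_n,j}(Y)|Z=z))_{q_n\times q_n}$. Let $\Sigma_{\phi,p}(z)$ ($p\times p$), $\Sigma_{\psi,q}(z)$ ($q\times q$), $\Sigma_{\phi,\psi,p,q}(z)$ ($p\times q$) be the matrices with entries $E(UV|Z=z)-E(U|Z=z)E(V|Z=z)$, where $(U,V)$ is respectively $(\phi_{p,i}(X),\phi_{p,j}(X))$, $(\psi_{q,i}(Y),\psi_{q,j}(Y))$, $(\phi_{p,i}(X),\psi_{q,j}(Y))$. Then $\rho_{p,q}(z)=\max_{a,b}a^T\Sigma_{\phi,\psi,p,q}(z)b$, the maximum over vectors $a,b$ with $a^T\Sigma_{\phi,p}(z)a=1=b^T\Sigma_{\psi,q}(z)b$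 (and $\rho_{p,q}(z)=0$ if $\Sigma_{\phi,p}(z)$ or $\Sigma_{\psi,q}(z)$ is the zero matrix). Kernel estimators: $\hat f_Z(z)=(nh_n^d)^{-1}\sum_{i=1}^nk_0(h_n^{-1}(z-Z_i))$, $c_K=1/\int k_0^2(s)\,ds$, and $$\hat E(g(X,Y)|Z=z)=\frac{\sum_{i=1}^ng(X_i,Y_i)k_0(h_n^{-1}(z-Z_i))}{\sum_{i=1}^nk_0(h_n^{-1}(z-Z_i))}.$$ $\hat\Sigma_{\phi,p}(z),\hat\Sigma_{\psi,q}(z),\hat\Sigma_{\phi,\psi,p,q}(z)$ are obtained from the matrices $\Sigma_{\phi,p}(z),\Sigma_{\psi,q}(z),\Sigma_{\phi,\psi,p,q}(z)$, respectively, by replacing every conditional expectation by its kernel estimator $\hat E$, and $\hat\rho(z)=\max_{a,b}a^T\hat\Sigma_{\phi,\psi,p_n,q_n}(z)b$ over $a,b$ with $a^T\hat\Sigma_{\phi,p_n}(z)a=1=b^T\hat\Sigma_{\psi,q_n}(z)b$. *)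

theory Defs
  imports
    "HOL-Probability.Probability"
    "HOL-Library.Landau_Symbols"
    "Jordan_Normal_Form.Char_Poly"
begin

text \<open>
  Finite index ranges \<open>1, \<dots>, m\<close> of the mathematics are \<open>0, \<dots>, m - 1\<close> throughout: for the basis
  functions, the matrices, the sample and the evaluation points.  Sequences in \<open>n\<close> are functions on
  \<open>nat\<close> about which nothing is assumed at \<open>n = 0\<close>.  Random vectors take values in the trace
  spaces \<open>borel_on S\<close> of their ranges \<open>S\<close>, and \<open>d\<close> is \<open>DIM('z)\<close>.
\<close>

abbreviation borel_on :: "'a::topological_space set \<Rightarrow> 'a measure" where
  "borel_on S \<equiv> restrict_space borel S"

text \<open>\<open>K\<close> is a regular conditional distribution of \<open>W\<close> (with values in \<open>MW\<close>) given \<open>Z\<close>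
  (with values in \<open>MZ\<close>).\<close>

definition regular_cond_distr ::
  "'m measure \<Rightarrow> 'w measure \<Rightarrow> ('m \<Rightarrow> 'w) \<Rightarrow> 'z measure \<Rightarrow> ('m \<Rightarrow> 'z) \<Rightarrow> ('z \<Rightarrow> 'w measure) \<Rightarrow> bool"
where
  "regular_cond_distr M MW W MZ Z K \<longleftrightarrow>
     K \<in> measurable MZ (prob_algebra MW) \<and>
     (\<forall>A\<in>sets MW. \<forall>B\<in>sets MZ.
        emeasure M {\<omega> \<in> space M. W \<omega> \<in> A \<and> Z \<omega> \<in> B}
          = (\<integral>\<^sup>+\<omega>. indicator B (Z \<omega>) * emeasure (K (Z \<omega>)) A \<partial>M))"

definition cond_indep ::
  "'m measure \<Rightarrow> 'x measure \<Rightarrow> ('m \<Rightarrow> 'x) \<Rightarrow> 'y measure \<Rightarrow> ('m \<Rightarrow> 'y) \<Rightarrow> 'z measure \<Rightarrow> ('m \<Rightarrow> 'z) \<Rightarrow> bool"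
where
  "cond_indep M MX X MY Y MZ Z \<longleftrightarrow>
     (let G = vimage_algebra (space M) Z MZ in
      \<forall>A\<in>sets MX. \<forall>B\<in>sets MY. AE \<omega> in M.
        real_cond_exp M G (\<lambda>\<omega>. indicator A (X \<omega>) * indicator B (Y \<omega>)) \<omega>
          = real_cond_exp M G (\<lambda>\<omega>. indicator A (X \<omega>)) \<omega>
            * real_cond_exp M G (\<lambda>\<omega>. indicator B (Y \<omega>)) \<omega>)"

definition cexp :: "'w measure \<Rightarrow> ('w \<Rightarrow> 'z \<Rightarrow> real) \<Rightarrow> 'z \<Rightarrow> ('w \<Rightarrow> real) \<Rightarrow> real" where
  "cexp \<mu> f z g = (\<integral>w. g w * f w z \<partial>\<mu>)"

text \<open>The expected squared error is a nonnegative integral, so that it is \<open>\<infinity>\<close> rather than \<open>0\<close> when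
  the combination fails to be square integrable.\<close>

definition tensor_complete ::
  "'m measure \<Rightarrow> 'x measure \<Rightarrow> ('m \<Rightarrow> 'x) \<Rightarrow> 'z measure \<Rightarrow> ('m \<Rightarrow> 'z) \<Rightarrow> nat set \<Rightarrow> (nat \<Rightarrow> nat \<Rightarrow> 'x \<Rightarrow> real)
     \<Rightarrow> nat set \<Rightarrow> (nat \<Rightarrow> nat \<Rightarrow> 'z \<Rightarrow> real) \<Rightarrow> bool"
where
  "tensor_complete M MX X MZ Z L \<phi> L' \<theta> \<longleftrightarrow>
     (\<forall>\<alpha> \<in> borel_measurable (MX \<Otimes>\<^sub>M MZ).
        integrable M (\<lambda>\<omega>. (\<alpha> (X \<omega>, Z \<omega>))\<^sup>2) \<longrightarrow>
        ((\<lambda>(p, r). INF a :: nat \<Rightarrow> nat \<Rightarrow> real.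
            \<integral>\<^sup>+\<omega>. ennreal ((\<alpha> (X \<omega>, Z \<omega>) - (\<Sum>i<p. \<Sum>k<r. a i k * \<phi> p i (X \<omega>) * \<theta> r k (Z \<omega>)))\<^sup>2) \<partial>M)
          \<longlongrightarrow> 0)
        (prod_filter (inf at_top (principal L)) (inf at_top (principal L'))))"

text \<open>\<open>G\<close> is the gradient and \<open>H\<close> the Hessian of \<open>g\<close>.  Derivatives are taken within \<open>S\<close>, which is the
  usual notion at interior points and covers ranges that are not open.\<close>

definition twice_diff_bounded :: "'z::euclidean_space set \<Rightarrow> ('z \<Rightarrow> real) \<Rightarrow> real \<Rightarrow> bool" where
  "twice_diff_bounded S g B \<longleftrightarrow>
     (\<exists>(G :: 'z \<Rightarrow> 'z) (H :: 'z \<Rightarrow> 'z \<Rightarrow> 'z). \<forall>z\<in>S.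
        (g has_derivative (\<lambda>v. inner (G z) v)) (at z within S) \<and>
        (G has_derivative H z) (at z within S) \<and>
        \<bar>g z\<bar> \<le> B \<and>
        (\<forall>i\<in>Basis. \<bar>inner (G z) i\<bar> \<le> B) \<and>
        (\<forall>i\<in>Basis. \<forall>j\<in>Basis. \<bar>inner (H z i) j\<bar> \<le> B))"

definition inner_region :: "'z::euclidean_space set \<Rightarrow> real \<Rightarrow> 'z set" where
  "inner_region S e = {z \<in> S. ball z e \<subseteq> S}"

definition min_eigenvalue :: "real mat \<Rightarrow> real" where
  "min_eigenvalue A = Min {k. eigenvalue A k}"

definition max_eigenvalue :: "real mat \<Rightarrow> real" where
  "max_eigenvalue A = Max {k. eigenvalue A k}"

text \<open>Below, \<open>E\<close> is the functional \<open>g \<mapsto> E(g | Z = z)\<close> or its kernel estimator.\<close>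

definition moment_mat :: "(('w \<Rightarrow> real) \<Rightarrow> real) \<Rightarrow> nat \<Rightarrow> (nat \<Rightarrow> 'w \<Rightarrow> real) \<Rightarrow> real mat" where
  "moment_mat E p U = mat p p (\<lambda>(i, j). E (\<lambda>w. U i w * U j w))"

definition cov_mat ::
  "(('w \<Rightarrow> real) \<Rightarrow> real) \<Rightarrow> nat \<Rightarrow> (nat \<Rightarrow> 'w \<Rightarrow> real) \<Rightarrow> nat \<Rightarrow> (nat \<Rightarrow> 'w \<Rightarrow> real) \<Rightarrow> real mat"
where
  "cov_mat E p U q V = mat p q (\<lambda>(i, j). E (\<lambda>w. U i w * V j w) - E (U i) * E (V j))"

text \<open>The supremum is a maximum, since the matrices are covariance matrices.  The value \<open>0\<close> in the
  degenerate case is also used for the estimator; this includes the case in which all kernel weights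
  vanish and \<open>kernel_cexp\<close> below is \<open>0 / 0 = 0\<close>.\<close>

definition max_corr ::
  "(('w \<Rightarrow> real) \<Rightarrow> real) \<Rightarrow> nat \<Rightarrow> (nat \<Rightarrow> 'w \<Rightarrow> real) \<Rightarrow> nat \<Rightarrow> (nat \<Rightarrow> 'w \<Rightarrow> real) \<Rightarrow> real"
where
  "max_corr E p U q V =
     (let SU = cov_mat E p U p U; SV = cov_mat E q V q V; SUV = cov_mat E p U q V in
      if SU = 0\<^sub>m p p \<or> SV = 0\<^sub>m q q then 0
      else Sup {scalar_prod a (SUV *\<^sub>v b) | a b.
                  a \<in> carrier_vec p \<and> b \<in> carrier_vec q \<and>
                  scalar_prod a (SU *\<^sub>v a) = 1 \<and> scalar_prod b (SV *\<^sub>v b) = 1})"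

definition rho ::
  "(nat \<Rightarrow> nat \<Rightarrow> 'x \<Rightarrow> real) \<Rightarrow> (nat \<Rightarrow> nat \<Rightarrow> 'y \<Rightarrow> real) \<Rightarrow> nat \<Rightarrow> nat \<Rightarrow> (('x \<times> 'y \<Rightarrow> real) \<Rightarrow> real) \<Rightarrow> real"
where
  "rho \<phi> \<psi> p q E = max_corr E p (\<lambda>i w. \<phi> p i (fst w)) q (\<lambda>j w. \<psi> q j (snd w))"

definition kernel_density ::
  "('z::euclidean_space \<Rightarrow> real) \<Rightarrow> real \<Rightarrow> nat \<Rightarrow> (nat \<Rightarrow> 'z) \<Rightarrow> 'z \<Rightarrow> real"
where
  "kernel_density k0 h n zs z =
     (\<Sum>i<n. k0 ((1 / h) *\<^sub>R (z - zs i))) / (real n * h ^ DIM('z))"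

definition kernel_cexp ::
  "('z::euclidean_space \<Rightarrow> real) \<Rightarrow> real \<Rightarrow> nat \<Rightarrow> (nat \<Rightarrow> 'w) \<Rightarrow> (nat \<Rightarrow> 'z) \<Rightarrow> 'z \<Rightarrow> ('w \<Rightarrow> real) \<Rightarrow> real"
where
  "kernel_cexp k0 h n ws zs z g =
     (\<Sum>i<n. g (ws i) * k0 ((1 / h) *\<^sub>R (z - zs i))) / (\<Sum>i<n. k0 ((1 / h) *\<^sub>R (z - zs i)))"

definition kernel_const :: "('z::euclidean_space \<Rightarrow> real) \<Rightarrow> real" where
  "kernel_const k0 = 1 / (\<integral>s. (k0 s)\<^sup>2 \<partial>lborel)"

definition gauss_mat :: "nat \<Rightarrow> nat \<Rightarrow> (nat \<times> nat \<Rightarrow> real) measure" where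
  "gauss_mat m k = (\<Pi>\<^sub>M ij \<in> {..<m} \<times> {..<k}. density lborel (\<lambda>x. ennreal (std_normal_density x)))"

definition top_eig :: "nat \<Rightarrow> nat \<Rightarrow> (nat \<times> nat \<Rightarrow> real) \<Rightarrow> real" where
  "top_eig m k c = max_eigenvalue (mat m k c * transpose_mat (mat m k c))"

definition wishart_mean :: "nat \<Rightarrow> nat \<Rightarrow> real" where
  "wishart_mean p q = (\<integral>c. top_eig (p - 1) (q - 1) c \<partial>gauss_mat (p - 1) (q - 1))"

definition wishart_var :: "nat \<Rightarrow> nat \<Rightarrow> real" where
  "wishart_var p q =
     (\<integral>c. (top_eig (p - 1) (q - 1) c - wishart_mean p q)\<^sup>2 \<partial>gauss_mat (p - 1) (q - 1))"

definition std_normal_quantile :: "real \<Rightarrow> real" where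
  "std_normal_quantile u = inv_into UNIV (cdf (density lborel (\<lambda>x. ennreal (std_normal_density x)))) u"

definition oP :: "'m measure \<Rightarrow> (nat \<Rightarrow> 'm \<Rightarrow> real) \<Rightarrow> (nat \<Rightarrow> real) \<Rightarrow> bool" where
  "oP M W r \<longleftrightarrow> (\<forall>e>0. (\<lambda>n. measure M {\<omega> \<in> space M. \<bar>W n \<omega>\<bar> > e * r n}) \<longlonglongrightarrow> 0)"

definition test_stat ::
  "(nat \<Rightarrow> nat \<Rightarrow> 'x \<Rightarrow> real) \<Rightarrow> (nat \<Rightarrow> nat \<Rightarrow> 'y \<Rightarrow> real) \<Rightarrow> ('z::euclidean_space \<Rightarrow> real) \<Rightarrow> real
     \<Rightarrow> nat \<Rightarrow> nat \<Rightarrow> nat \<Rightarrow> (nat \<Rightarrow> 'z) \<Rightarrow> nat \<Rightarrow> (nat \<Rightarrow> 'x \<times> 'y) \<Rightarrow> (nat \<Rightarrow> 'z) \<Rightarrow> real"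
where
  "test_stat \<phi> \<psi> k0 h p q N z n ws zs =
     (real n * h ^ DIM('z) * kernel_const k0
        * (\<Sum>k<N. kernel_density k0 h n zs (z k) * (rho \<phi> \<psi> p q (kernel_cexp k0 h n ws zs (z k)))\<^sup>2)
      - real N * wishart_mean p q) / sqrt (real N * wishart_var p q)"

end

theory Submission
  imports Defs "HOL-Real_Asymp.Real_Asymp"
begin

text \<open>
  Under the alternative the numerator of the statistic is of the order of \<open>n h\<^sup>d\<close>, a positive power of
  \<open>n\<close>, times the sum of \<open>f\<^sub>Z(z\<^sub>k) \<rho>\<^sup>2(z\<^sub>k)\<close> over the evaluation points, whereas the mean and the
  standard deviation by which it is centred and scaled are at most of order \<open>n\<^sub>Z p q\<close>, which is
  polylogarithmic.  The statistic therefore exceeds every constant as soon as its signal is known up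
  to a constant factor, and only a lower bound for the estimated correlations has to be proved.
  Three facts carry the argument.

  The signal does not vanish (\<open>rho_bounded_below\<close>).  If \<open>X\<close> and \<open>Y\<close> are conditionally dependent, two
  indicators \<open>1\<^sub>A(X)\<close>, \<open>1\<^sub>B(Y)\<close> have a conditional covariance that is nonzero with positive
  probability.  Completeness approximates both in mean square by tensor combinations, and for fixed
  \<open>z\<close> such a combination lies in the span of the basis functions of \<open>X\<close> or of \<open>Y\<close>; so its
  conditional covariances are controlled by \<open>\<rho>(z)\<close>.  This bounds \<open>E \<rho>\<^sup>2(Z)\<close> away from \<open>0\<close>.

  Estimation does not lose the signal (\<open>max_corr_perturb\<close>, \<open>uniform_deviation\<close>, \<open>point_bound\<close>).  A pair
  of directions \<open>a, b\<close> that is good for the true covariance matrices is used as a trial pair for the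
  estimated ones.  Since constants belong to the span, \<open>a\<close> may be chosen such that its combination is
  centred; then its variance is a second moment and the eigenvalue bound gives \<open>\<parallel>a\<parallel>\<^sup>2 \<le> 1 / \<delta>\<close>.  Each
  matrix entry is a ratio of kernel averages, whose bias is small since \<open>E(g | Z = z) f\<^sub>Z(z)\<close> is
  Lipschitz in \<open>z\<close> and whose fluctuation is bounded by Chebyshev's inequality.  A union bound over all
  entries and evaluation points makes the errors smaller than a fixed negative power of \<open>n\<close>, which
  beats the polylogarithmic factor \<open>(p + q) / \<delta>\<close>.

  The normalisation is harmless (\<open>wishart_bounds\<close>).  The largest eigenvalue of \<open>C C\<^sup>T\<close> lies between the
  square of an entry and the squared Frobenius norm of \<open>C\<close>; this bounds its first two moments and
  shows that its variance is not \<open>0\<close>.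

  All probabilities and expectations above refer to suprema over uncountably many vectors.  These are
  measurable because, after removing the normalisation of the vectors, exceeding a level means that
  some vector satisfies a strict inequality between continuous functions, and then a vector from a
  countable dense set does so as well (\<open>sets_Collect_ex_open\<close>).
\<close>

section \<open>Extremal eigenvalues of symmetric matrices\<close>

text \<open>
  A maximiser \<open>x\<close> of the form on the unit sphere exists by compactness.  The form
  \<open>lam \<parallel>y\<parallel>\<^sup>2 - y\<^sup>T B y\<close> is then nonnegative and vanishes at \<open>x\<close>, so its derivative at \<open>x\<close> vanishes in every
  coordinate direction, which is the eigenvalue equation.
\<close>

lemma symmetric_form_attains_max:
  fixes B :: "nat \<Rightarrow> nat \<Rightarrow> real"
  assumes "0 < n" and sym: "\<And>i j. i < n \<Longrightarrow> j < n \<Longrightarrow> B i j = B j i"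
  shows "\<exists>lam x. (\<Sum>i<n. (x i)\<^sup>2) = 1 \<and> (\<forall>i<n. (\<Sum>j<n. B i j * x j) = lam * x i) \<and>
           (\<forall>y. (\<Sum>i<n. \<Sum>j<n. y i * B i j * y j) \<le> lam * (\<Sum>i<n. (y i)\<^sup>2))"
proof -
  let ?Q = "\<lambda>y::nat \<Rightarrow> real. \<Sum>i<n. \<Sum>j<n. y i * B i j * y j"
  let ?N = "\<lambda>y::nat \<Rightarrow> real. \<Sum>i<n. (y i)\<^sup>2"
  define S where "S = PiE UNIV (\<lambda>i. if i < n then {-1..1::real} else {0}) \<inter> {x. ?N x = 1}"
  have cN: "continuous_on UNIV ?N" and cQ: "continuous_on UNIV ?Q"
    by (intro continuous_intros continuous_on_product_coordinates)+
  have "compact (PiE UNIV (\<lambda>i. if i < n then {-1..1::real} else {0}))"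
    using compactin_PiE[of "\<lambda>_::nat. euclidean::real topology" UNIV "\<lambda>i. if i < n then {-1..1} else {0}"]
    by (simp add: euclidean_product_topology)
  moreover have "closed {x. ?N x = 1}"
    using continuous_closed_vimage[of "{1::real}" ?N] cN
    by (simp add: continuous_on_eq_continuous_at vimage_def)
  ultimately have cS: "compact S" unfolding S_def by (rule compact_Int_closed)
  have "(\<lambda>i. if i = 0 then 1 else 0) \<in> S"
    using \<open>0 < n\<close> by (auto simp: S_def if_distrib[of "\<lambda>x. x\<^sup>2"] cong: if_cong)
  then have "S \<noteq> {}" by blast
  then obtain x where x: "x \<in> S" and max: "\<And>y. y \<in> S \<Longrightarrow> ?Q y \<le> ?Q x"
    using continuous_attains_sup[OF cS, of ?Q] cQ continuous_on_subset by blast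
  have Nx: "?N x = 1" using x by (simp add: S_def)
  define lam where "lam = ?Q x"
  have hom: "?Q (\<lambda>i. c * y i) = c\<^sup>2 * ?Q y" "?N (\<lambda>i. c * y i) = c\<^sup>2 * ?N y" for c y
    by (simp_all add: sum_distrib_left power2_eq_square algebra_simps)
  have bound: "?Q y \<le> lam * ?N y" for y
  proof (cases "?N y = 0")
    case True
    then have "\<forall>i\<in>{..<n}. (y i)\<^sup>2 = 0" by (subst (asm) sum_nonneg_eq_0_iff) auto
    then show ?thesis by simp
  next
    case False
    then have pos: "?N y > 0" by (metis less_eq_real_def sum_nonneg zero_le_power2)
    define u where "u = (\<lambda>i. if i < n then inverse (sqrt (?N y)) * y i else 0)"
    have Nu: "?N u = 1" and Qu: "?Q u = ?Q y / ?N y"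
      using hom[of "inverse (sqrt (?N y))" y] pos
      by (simp_all add: u_def power_inverse real_sqrt_pow2 field_simps)
    have "(u i)\<^sup>2 \<le> 1" if "i < n" for i
      using member_le_sum[of i "{..<n}" "\<lambda>i. (u i)\<^sup>2"] that Nu by simp
    then have "\<bar>u i\<bar> \<le> 1" if "i < n" for i using that abs_square_le_1 by blast
    then have "u i \<in> (if i < n then {-1..1} else {0})" for i
      by (cases "i < n") (auto simp: abs_le_iff u_def)
    then have "u \<in> S" using Nu by (simp add: S_def PiE_UNIV_domain)
    from max[OF this] have "?Q y / ?N y \<le> lam" unfolding lam_def Qu .
    then show ?thesis using pos by (simp add: pos_divide_le_eq)
  qed
  have "(\<Sum>j<n. B i j * x j) = lam * x i" if i: "i < n" for i
  proof -
    define b where "b = lam * x i - (\<Sum>j<n. B i j * x j)"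
    define e where "e = (\<lambda>j. if j = i then 1 else 0::real)"
    have Ne: "?N (\<lambda>j. x j + t * e j) = 1 + 2 * t * x i + t\<^sup>2" for t
    proof -
      have "?N (\<lambda>j. x j + t * e j) = ?N x + 2 * t * (\<Sum>j<n. x j * e j) + t\<^sup>2 * (\<Sum>j<n. (e j)\<^sup>2)"
        by (simp add: sum.distrib sum_distrib_left power2_eq_square algebra_simps)
      moreover have "(\<Sum>j<n. x j * e j) = x i" "(\<Sum>j<n. (e j)\<^sup>2) = 1"
        using i by (simp_all add: e_def if_distrib[of "(*) _"] if_distrib[of "\<lambda>x. x\<^sup>2"] cong: if_cong)
      ultimately show ?thesis using Nx by simp
    qed
    have Qe: "?Q (\<lambda>j. x j + t * e j) = lam + 2 * t * (\<Sum>j<n. B i j * x j) + t\<^sup>2 * B i i" for t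
    proof -
      have "?Q (\<lambda>j. x j + t * e j) = ?Q x + t * (\<Sum>k<n. \<Sum>j<n. e k * B k j * x j)
          + t * (\<Sum>k<n. \<Sum>j<n. x k * B k j * e j) + t\<^sup>2 * (\<Sum>k<n. \<Sum>j<n. e k * B k j * e j)"
        by (simp add: sum.distrib sum_distrib_left power2_eq_square algebra_simps)
      moreover have "(\<Sum>k<n. \<Sum>j<n. e k * B k j * x j) = (\<Sum>k<n. if k = i then \<Sum>j<n. B k j * x j else 0)"
        by (rule sum.cong) (auto simp: e_def)
      moreover have "(\<Sum>k<n. \<Sum>j<n. x k * B k j * e j) = (\<Sum>k<n. x k * B k i)"
        using i by (intro sum.cong) (auto simp: e_def if_distrib[of "(*) _"] cong: if_cong)
      moreover have "(\<Sum>k<n. \<Sum>j<n. e k * B k j * e j) = B i i"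
      proof -
        have "(\<Sum>k<n. \<Sum>j<n. e k * B k j * e j) = (\<Sum>k<n. if k = i then B i i else 0)"
          using i by (intro sum.cong) (auto simp: e_def if_distrib[of "(*) _"] cong: if_cong)
        then show ?thesis using i by simp
      qed
      moreover have "(\<Sum>k<n. x k * B k i) = (\<Sum>j<n. B i j * x j)"
        using i sym by (intro sum.cong) auto
      ultimately show ?thesis using i by (simp add: lam_def)
    qed
    have nn: "0 \<le> 2 * t * b + t\<^sup>2 * (lam - B i i)" for t
      using bound[of "\<lambda>j. x j + t * e j"] unfolding Ne Qe b_def by (simp add: algebra_simps)
    have "b = 0"
    proof (rule ccontr)
      assume "b \<noteq> 0"
      define c where "c = \<bar>lam - B i i\<bar> + 1"
      have c: "c > 0" "lam - B i i \<le> c" by (auto simp: c_def)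
      have "0 \<le> 2 * (- b / c) * b + (- b / c)\<^sup>2 * (lam - B i i)" by (rule nn)
      also have "\<dots> \<le> 2 * (- b / c) * b + (- b / c)\<^sup>2 * c"
        using c by (intro add_left_mono mult_left_mono) auto
      also have "\<dots> = - (b\<^sup>2 / c)" using c by (simp add: power2_eq_square field_simps)
      also have "\<dots> < 0" using c \<open>b \<noteq> 0\<close> by simp
      finally show False by simp
    qed
    then show ?thesis by (simp add: b_def)
  qed
  then show ?thesis using Nx bound by blast
qed

lemma scalar_prod_mat_form:
  assumes "a \<in> carrier_vec m" "b \<in> carrier_vec n" "S \<in> carrier_mat m n"
  shows "scalar_prod a (S *\<^sub>v b) = (\<Sum>i<m. \<Sum>j<n. a $ i * S $$ (i, j) * b $ j)"
  using assms
  by (auto simp: scalar_prod_def lessThan_atLeast0 sum_distrib_left algebra_simps intro!: sum.cong)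

lemma symmetric_max_eigenvalue:
  fixes A :: "real mat"
  assumes A: "A \<in> carrier_mat n n" and n: "0 < n"
    and sym: "\<And>i j. i < n \<Longrightarrow> j < n \<Longrightarrow> A $$ (i, j) = A $$ (j, i)"
  shows "finite {k. eigenvalue A k}"
    and "\<exists>k x. eigenvalue A k \<and> (\<forall>y. (\<Sum>i<n. \<Sum>j<n. y i * A $$ (i, j) * y j) \<le> k * (\<Sum>i<n. (y i)\<^sup>2))
       \<and> (\<Sum>i<n. (x i)\<^sup>2) = 1 \<and> (\<Sum>i<n. \<Sum>j<n. x i * A $$ (i, j) * x j) = k"
proof -
  show "finite {k. eigenvalue A k}"
  proof -
    have "char_poly A \<noteq> 0" using degree_monic_char_poly[OF A] by auto
    then show ?thesis using eigenvalue_root_char_poly[OF A] poly_roots_finite by simp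
  qed
  obtain lam x where x: "(\<Sum>i<n. (x i)\<^sup>2) = 1" "\<And>i. i < n \<Longrightarrow> (\<Sum>j<n. A $$ (i, j) * x j) = lam * x i"
    "\<And>y. (\<Sum>i<n. \<Sum>j<n. y i * A $$ (i, j) * y j) \<le> lam * (\<Sum>i<n. (y i)\<^sup>2)"
    using symmetric_form_attains_max[OF n, of "\<lambda>i j. A $$ (i, j)", OF sym] by blast
  have "vec n x \<noteq> 0\<^sub>v n"
  proof
    assume z: "vec n x = 0\<^sub>v n"
    have "x i = 0" if "i < n" for i using arg_cong[OF z, of "\<lambda>v. v $ i"] that by simp
    then show False using x(1) by simp
  qed
  moreover have "A *\<^sub>v vec n x = lam \<cdot>\<^sub>v vec n x"
    using A x(2) by (intro eq_vecI) (auto simp: scalar_prod_def lessThan_atLeast0)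
  ultimately have "eigenvalue A lam"
    using A unfolding eigenvalue_def eigenvector_def by (intro exI[of _ "vec n x"]) auto
  moreover have "(\<Sum>i<n. \<Sum>j<n. x i * A $$ (i, j) * x j) = lam"
  proof -
    have "(\<Sum>i<n. \<Sum>j<n. x i * A $$ (i, j) * x j) = (\<Sum>i<n. x i * (\<Sum>j<n. A $$ (i, j) * x j))"
      by (simp add: sum_distrib_left mult.assoc)
    also have "\<dots> = (\<Sum>i<n. x i * (lam * x i))" using x(2) by (intro sum.cong) auto
    also have "\<dots> = lam * (\<Sum>i<n. (x i)\<^sup>2)" by (simp add: sum_distrib_left power2_eq_square algebra_simps)
    finally show ?thesis using x(1) by simp
  qed
  ultimately show "\<exists>k x. eigenvalue A k \<and> (\<forall>y. (\<Sum>i<n. \<Sum>j<n. y i * A $$ (i, j) * y j) \<le> k * (\<Sum>i<n. (y i)\<^sup>2))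
       \<and> (\<Sum>i<n. (x i)\<^sup>2) = 1 \<and> (\<Sum>i<n. \<Sum>j<n. x i * A $$ (i, j) * x j) = k"
    using x by blast
qed

lemma eigenvalue_le_form_bound:
  fixes A :: "real mat"
  assumes A: "A \<in> carrier_mat n n" and ev: "eigenvalue A l"
    and bd: "\<And>y. (\<Sum>i<n. \<Sum>j<n. y i * A $$ (i, j) * y j) \<le> k * (\<Sum>i<n. (y i)\<^sup>2)"
  shows "l \<le> k"
proof -
  obtain v where v: "v \<in> carrier_vec n" "v \<noteq> 0\<^sub>v n" "A *\<^sub>v v = l \<cdot>\<^sub>v v"
    using ev A by (auto simp: eigenvalue_def eigenvector_def)
  let ?N = "\<Sum>i<n. (v $ i)\<^sup>2"
  have "scalar_prod v (A *\<^sub>v v) = l * ?N"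
    using v by (simp add: scalar_prod_def lessThan_atLeast0 sum_distrib_left power2_eq_square algebra_simps)
  then have le: "l * ?N \<le> k * ?N"
    using bd[of "\<lambda>i. v $ i"] scalar_prod_mat_form[OF v(1) v(1) A] by simp
  obtain i where i: "i < n" "v $ i \<noteq> 0"
    using v by (metis eq_vecI index_zero_vec carrier_vecD)
  then have "?N > 0" using sum_pos2[of "{..<n}" i "\<lambda>i. (v $ i)\<^sup>2"] by auto
  then show ?thesis using le by simp
qed

lemma max_eigenvalue_rayleigh:
  fixes A :: "real mat"
  assumes A: "A \<in> carrier_mat n n" and n: "0 < n"
    and sym: "\<And>i j. i < n \<Longrightarrow> j < n \<Longrightarrow> A $$ (i, j) = A $$ (j, i)"
  shows "(\<Sum>i<n. \<Sum>j<n. y i * A $$ (i, j) * y j) \<le> max_eigenvalue A * (\<Sum>i<n. (y i)\<^sup>2)"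
    and "\<exists>x. (\<Sum>i<n. (x i)\<^sup>2) = 1 \<and> (\<Sum>i<n. \<Sum>j<n. x i * A $$ (i, j) * x j) = max_eigenvalue A"
proof -
  obtain k x where k: "eigenvalue A k"
    "\<And>y. (\<Sum>i<n. \<Sum>j<n. y i * A $$ (i, j) * y j) \<le> k * (\<Sum>i<n. (y i)\<^sup>2)"
    "(\<Sum>i<n. (x i)\<^sup>2) = 1" "(\<Sum>i<n. \<Sum>j<n. x i * A $$ (i, j) * x j) = k"
    using symmetric_max_eigenvalue(2)[OF A n sym] by blast
  have "max_eigenvalue A = k"
    unfolding max_eigenvalue_def
    using symmetric_max_eigenvalue(1)[OF A n sym] k(1) eigenvalue_le_form_bound[OF A _ k(2)]
    by (intro Max_eqI) auto
  then show "(\<Sum>i<n. \<Sum>j<n. y i * A $$ (i, j) * y j) \<le> max_eigenvalue A * (\<Sum>i<n. (y i)\<^sup>2)"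
    "\<exists>x. (\<Sum>i<n. (x i)\<^sup>2) = 1 \<and> (\<Sum>i<n. \<Sum>j<n. x i * A $$ (i, j) * x j) = max_eigenvalue A"
    using k by auto
qed

lemma min_eigenvalue_rayleigh:
  fixes A :: "real mat"
  assumes A: "A \<in> carrier_mat n n" and n: "0 < n"
    and sym: "\<And>i j. i < n \<Longrightarrow> j < n \<Longrightarrow> A $$ (i, j) = A $$ (j, i)"
  shows "min_eigenvalue A * (\<Sum>i<n. (y i)\<^sup>2) \<le> (\<Sum>i<n. \<Sum>j<n. y i * A $$ (i, j) * y j)"
proof -
  have mA: "- A \<in> carrier_mat n n" using A by simp
  have msym: "(- A) $$ (i, j) = (- A) $$ (j, i)" if "i < n" "j < n" for i j
    using sym[OF that] carrier_matD[OF A] that by (simp add: index_uminus_mat)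
  obtain k where k: "eigenvalue (- A) k"
    "\<And>y. (\<Sum>i<n. \<Sum>j<n. y i * (- A) $$ (i, j) * y j) \<le> k * (\<Sum>i<n. (y i)\<^sup>2)"
    using symmetric_max_eigenvalue(2)[OF mA n msym] by blast
  have neg: "(\<Sum>i<n. \<Sum>j<n. y i * (- A) $$ (i, j) * y j) = - (\<Sum>i<n. \<Sum>j<n. y i * A $$ (i, j) * y j)"
  proof -
    have "(\<Sum>i<n. \<Sum>j<n. y i * (- A) $$ (i, j) * y j) = (\<Sum>i<n. \<Sum>j<n. - (y i * A $$ (i, j) * y j))"
      using carrier_matD[OF A] by (intro sum.cong refl) (simp add: index_uminus_mat)
    then show ?thesis by (simp add: sum_negf)
  qed
  have "eigenvalue A (- k)"
  proof -
    obtain v where v: "v \<in> carrier_vec n" "v \<noteq> 0\<^sub>v n" "- A *\<^sub>v v = k \<cdot>\<^sub>v v"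
      using k(1) A by (auto simp: eigenvalue_def eigenvector_def)
    have "A *\<^sub>v v = (- k) \<cdot>\<^sub>v v"
    proof (rule eq_vecI)
      fix i assume "i < dim_vec ((- k) \<cdot>\<^sub>v v)"
      then have i: "i < n" using v by simp
      have "(- A *\<^sub>v v) $ i = - ((A *\<^sub>v v) $ i)"
        using i carrier_matD[OF A] carrier_vecD[OF v(1)]
        by (simp add: scalar_prod_def sum_negf[symmetric])
      then show "(A *\<^sub>v v) $ i = ((- k) \<cdot>\<^sub>v v) $ i" using v i by simp
    qed (use A v in auto)
    then show ?thesis using v A by (auto simp: eigenvalue_def eigenvector_def)
  qed
  then have "min_eigenvalue A \<le> - k"
    unfolding min_eigenvalue_def using symmetric_max_eigenvalue(1)[OF A n sym] by (intro Min_le) auto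
  moreover have "0 \<le> (\<Sum>i<n. (y i)\<^sup>2)" by (simp add: sum_nonneg)
  ultimately have "min_eigenvalue A * (\<Sum>i<n. (y i)\<^sup>2) \<le> - k * (\<Sum>i<n. (y i)\<^sup>2)"
    by (rule mult_right_mono)
  then show ?thesis using k(2)[of y] neg by simp
qed

section \<open>The largest eigenvalue of a Gaussian matrix product\<close>

text \<open>
  A nonempty open set meets every dense set, so the union over all \<open>x\<close> may be taken over a countable
  dense set only.  In the product topology on \<open>nat \<Rightarrow> real\<close> this covers vectors of every length at once.
\<close>

lemma sets_Collect_ex_open:
  fixes P :: "'b::second_countable_topology \<Rightarrow> 'a \<Rightarrow> bool"
  assumes meas: "\<And>x. {\<omega> \<in> space M. P x \<omega>} \<in> sets M"
    and op: "\<And>\<omega>. \<omega> \<in> space M \<Longrightarrow> open {x. P x \<omega>}"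
  shows "{\<omega> \<in> space M. \<exists>x. P x \<omega>} \<in> sets M"
proof -
  obtain D :: "'b set" where D: "countable D" "\<And>X. open X \<Longrightarrow> X \<noteq> {} \<Longrightarrow> \<exists>d\<in>D. d \<in> X"
    using countable_dense_exists by blast
  have "{\<omega> \<in> space M. \<exists>x. P x \<omega>} = (\<Union>d\<in>D. {\<omega> \<in> space M. P d \<omega>})"
  proof safe
    fix \<omega> x assume \<omega>: "\<omega> \<in> space M" "P x \<omega>"
    then have "\<exists>d\<in>D. d \<in> {x. P x \<omega>}" using op by (intro D(2)) auto
    then show "\<omega> \<in> (\<Union>d\<in>D. {\<omega> \<in> space M. P d \<omega>})" using \<omega> by blast
  qed auto
  also have "\<dots> \<in> sets M" using D(1) meas by (intro sets.countable_UN'') auto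
  finally show ?thesis .
qed

lemma top_eig_rayleigh:
  assumes "0 < m"
  shows "(\<Sum>j<k. (\<Sum>i<m. y i * c (i, j))\<^sup>2) \<le> top_eig m k c * (\<Sum>i<m. (y i)\<^sup>2)"
    and "\<exists>x. (\<Sum>i<m. (x i)\<^sup>2) = 1 \<and> (\<Sum>j<k. (\<Sum>i<m. x i * c (i, j))\<^sup>2) = top_eig m k c"
proof -
  define A where "A = mat m k c * transpose_mat (mat m k c)"
  have A: "A \<in> carrier_mat m m" unfolding A_def by (intro mult_carrier_mat[of _ _ k]) auto
  have Aij: "A $$ (i, l) = (\<Sum>j<k. c (i, j) * c (l, j))" if "i < m" "l < m" for i l
    using that by (simp add: A_def scalar_prod_def lessThan_atLeast0)
  have form: "(\<Sum>i<m. \<Sum>l<m. y i * A $$ (i, l) * y l) = (\<Sum>j<k. (\<Sum>i<m. y i * c (i, j))\<^sup>2)" for y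
  proof -
    have "(\<Sum>i<m. \<Sum>l<m. y i * A $$ (i, l) * y l)
        = (\<Sum>i<m. \<Sum>l<m. \<Sum>j<k. (y i * c (i, j)) * (y l * c (l, j)))"
      by (intro sum.cong refl) (simp add: Aij sum_distrib_left sum_distrib_right mult_ac)
    also have "\<dots> = (\<Sum>i<m. \<Sum>j<k. \<Sum>l<m. (y i * c (i, j)) * (y l * c (l, j)))"
      by (intro sum.cong refl sum.swap)
    also have "\<dots> = (\<Sum>j<k. \<Sum>i<m. \<Sum>l<m. (y i * c (i, j)) * (y l * c (l, j)))"
      by (rule sum.swap)
    also have "\<dots> = (\<Sum>j<k. (\<Sum>i<m. y i * c (i, j))\<^sup>2)"
      by (simp add: power2_eq_square sum_product)
    finally show ?thesis .
  qed
  have sym: "A $$ (i, l) = A $$ (l, i)" if "i < m" "l < m" for i l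
    using that by (simp add: Aij mult.commute)
  show "(\<Sum>j<k. (\<Sum>i<m. y i * c (i, j))\<^sup>2) \<le> top_eig m k c * (\<Sum>i<m. (y i)\<^sup>2)"
    using max_eigenvalue_rayleigh(1)[OF A assms sym, of y] form by (simp add: top_eig_def A_def)
  show "\<exists>x. (\<Sum>i<m. (x i)\<^sup>2) = 1 \<and> (\<Sum>j<k. (\<Sum>i<m. x i * c (i, j))\<^sup>2) = top_eig m k c"
    using max_eigenvalue_rayleigh(2)[OF A assms sym] form by (simp add: top_eig_def A_def)
qed

lemma top_eig_bounds:
  assumes "0 < m" "0 < k"
  shows "(c (0, 0))\<^sup>2 \<le> top_eig m k c"
    and "top_eig m k c \<le> (\<Sum>ij\<in>{..<m} \<times> {..<k}. (c ij)\<^sup>2)"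
proof -
  let ?e = "\<lambda>i. if i = 0 then 1 else 0 :: real"
  have "(\<Sum>i<m. ?e i * c (i, j)) = (\<Sum>i<m. if i = 0 then c (0, j) else 0)" for j
    by (rule sum.cong) auto
  then have "(\<Sum>j<k. (c (0, j))\<^sup>2) = (\<Sum>j<k. (\<Sum>i<m. ?e i * c (i, j))\<^sup>2)"
    using assms by simp
  also have "\<dots> \<le> top_eig m k c * (\<Sum>i<m. (?e i)\<^sup>2)" by (rule top_eig_rayleigh(1)[OF assms(1)])
  also have "(\<Sum>i<m. (?e i)\<^sup>2) = (\<Sum>i<m. if i = 0 then 1 else 0)"
    by (rule sum.cong) auto
  finally have "(\<Sum>j<k. (c (0, j))\<^sup>2) \<le> top_eig m k c" using assms by simp
  moreover have "(c (0, 0))\<^sup>2 \<le> (\<Sum>j<k. (c (0, j))\<^sup>2)"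
    using assms by (intro member_le_sum[of 0 "{..<k}" "\<lambda>j. (c (0, j))\<^sup>2"]) auto
  ultimately show "(c (0, 0))\<^sup>2 \<le> top_eig m k c" by simp
  obtain x where x: "(\<Sum>i<m. (x i)\<^sup>2) = 1" "(\<Sum>j<k. (\<Sum>i<m. x i * c (i, j))\<^sup>2) = top_eig m k c"
    using top_eig_rayleigh(2)[OF assms(1)] by blast
  have "top_eig m k c \<le> (\<Sum>j<k. (\<Sum>i<m. (x i)\<^sup>2) * (\<Sum>i<m. (c (i, j))\<^sup>2))"
    unfolding x(2)[symmetric] by (intro sum_mono Cauchy_Schwarz_ineq_sum)
  also have "\<dots> = (\<Sum>j<k. \<Sum>i<m. (c (i, j))\<^sup>2)" by (simp add: x)
  also have "\<dots> = (\<Sum>i<m. \<Sum>j<k. (c (i, j))\<^sup>2)" by (rule sum.swap)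
  also have "\<dots> = (\<Sum>ij\<in>{..<m} \<times> {..<k}. (c ij)\<^sup>2)"
    by (simp add: sum.cartesian_product case_prod_unfold)
  finally show "top_eig m k c \<le> (\<Sum>ij\<in>{..<m} \<times> {..<k}. (c ij)\<^sup>2)" .
qed

lemma gauss_mat_entry:
  assumes "i < m" "j < k"
  shows "distr (gauss_mat m k) borel (\<lambda>c. c (i, j)) = density lborel (\<lambda>x. ennreal (std_normal_density x))"
    and "(\<lambda>c. c (i, j)) \<in> borel_measurable (gauss_mat m k)"
    and "has_bochner_integral (gauss_mat m k) (\<lambda>c. (c (i, j))\<^sup>2) 1"
    and "has_bochner_integral (gauss_mat m k) (\<lambda>c. (c (i, j)) ^ 4) 3"
proof -
  let ?N = "density lborel (\<lambda>x. ennreal (std_normal_density x))"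
  have pN: "prob_space ?N" by (rule prob_space_normal_density) simp
  have sN: "sets ?N = sets borel" by simp
  have "distr (gauss_mat m k) ?N (\<lambda>c. c (i, j)) = ?N"
    unfolding gauss_mat_def using assms pN
    by (intro distr_PiM_component) auto
  then show d: "distr (gauss_mat m k) borel (\<lambda>c. c (i, j)) = ?N"
    using distr_cong[OF refl sN, of "gauss_mat m k" "\<lambda>c. c (i, j)"] by simp
  have "(\<lambda>c. c (i, j)) \<in> measurable (gauss_mat m k) ?N"
    using assms unfolding gauss_mat_def by (intro measurable_component_singleton) auto
  then show m: "(\<lambda>c. c (i, j)) \<in> borel_measurable (gauss_mat m k)"
    using measurable_cong_sets[OF refl sN] by blast
  have mom: "has_bochner_integral (gauss_mat m k) (\<lambda>c. (c (i, j)) ^ (2 * l)) (fact (2 * l) / (2 ^ l * fact l))" for l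
  proof -
    have "has_bochner_integral ?N (\<lambda>x. x ^ (2 * l)) (fact (2 * l) / (2 ^ l * fact l))"
      using std_normal_moment_even[of l] by (intro has_bochner_integral_density) auto
    then show ?thesis unfolding d[symmetric]
      using m by (simp add: has_bochner_integral_iff integrable_distr_eq integral_distr)
  qed
  show "has_bochner_integral (gauss_mat m k) (\<lambda>c. (c (i, j))\<^sup>2) 1" using mom[of 1] by simp
  show "has_bochner_integral (gauss_mat m k) (\<lambda>c. (c (i, j)) ^ 4) 3"
    using mom[of 2] by (simp add: fact_numeral)
qed

lemma top_eig_measurable:
  assumes "0 < m" "0 < k"
  shows "top_eig m k \<in> borel_measurable (gauss_mat m k)"
proof (rule borel_measurable_iff_greater[THEN iffD2], rule allI)
  fix t :: real
  let ?P = "\<lambda>y c. (\<Sum>j<k. (\<Sum>i<m. y i * c (i, j))\<^sup>2) > t * (\<Sum>i<m. (y i)\<^sup>2)"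
  have "t < top_eig m k c \<longleftrightarrow> (\<exists>y. ?P y c)" for c
  proof
    assume t: "t < top_eig m k c"
    obtain x where x: "(\<Sum>i<m. (x i)\<^sup>2) = 1" "(\<Sum>j<k. (\<Sum>i<m. x i * c (i, j))\<^sup>2) = top_eig m k c"
      using top_eig_rayleigh(2)[OF assms(1)] by blast
    have "?P x c" unfolding x using t by simp
    then show "\<exists>y. ?P y c" by blast
  next
    assume "\<exists>y. ?P y c"
    then obtain y where "?P y c" by blast
    then have "t * (\<Sum>i<m. (y i)\<^sup>2) < top_eig m k c * (\<Sum>i<m. (y i)\<^sup>2)"
      using top_eig_rayleigh(1)[OF assms(1), where y=y and k=k and c=c] by linarith
    moreover have "0 \<le> (\<Sum>i<m. (y i)\<^sup>2)" by (simp add: sum_nonneg)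
    ultimately show "t < top_eig m k c" by (simp add: mult_less_cancel_right)
  qed
  then have eq: "{c \<in> space (gauss_mat m k). t < top_eig m k c} = {c \<in> space (gauss_mat m k). \<exists>y. ?P y c}"
    by simp
  show "{c \<in> space (gauss_mat m k). t < top_eig m k c} \<in> sets (gauss_mat m k)"
    unfolding eq
  proof (rule sets_Collect_ex_open)
    fix y :: "nat \<Rightarrow> real"
    have comp: "(\<lambda>c. c (i, j)) \<in> borel_measurable (gauss_mat m k)" if "i < m" "j < k" for i j
      using gauss_mat_entry(2)[OF that] .
    have "(\<lambda>c. \<Sum>j<k. (\<Sum>i<m. y i * c (i, j))\<^sup>2) \<in> borel_measurable (gauss_mat m k)"
      using comp by (intro borel_measurable_sum borel_measurable_power borel_measurable_times) auto
    then show "{c \<in> space (gauss_mat m k). ?P y c} \<in> sets (gauss_mat m k)"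
      by (rule borel_measurable_less[rotated]) simp
  next
    fix c
    show "open {y. ?P y c}"
      by (intro open_Collect_less continuous_intros continuous_on_product_coordinates)
  qed
qed

lemma prob_space_gauss_mat: "prob_space (gauss_mat m k)"
  unfolding gauss_mat_def by (intro prob_space_PiM prob_space_normal_density) simp

text \<open>
  The squared Frobenius norm dominates the eigenvalue and has moments that grow polynomially.  The
  variance is positive since the eigenvalue exceeds the square of a Gaussian entry, which no constant
  bounds almost surely.
\<close>

lemma wishart_bounds:
  assumes "2 \<le> p" "2 \<le> q"
  shows "wishart_mean p q \<le> real (p * q)"
    and "0 < wishart_var p q"
    and "wishart_var p q \<le> 3 * (real (p * q))\<^sup>2"
proof -
  define m k where "m = p - 1" and "k = q - 1"
  have mk: "0 < m" "0 < k" using assms by (auto simp: m_def k_def)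
  define G where "G = gauss_mat m k"
  interpret prob_space G unfolding G_def by (rule prob_space_gauss_mat)
  let ?I = "{..<m} \<times> {..<k}"
  define F where "F c = (\<Sum>ij\<in>?I. (c ij)\<^sup>2)" for c :: "nat \<times> nat \<Rightarrow> real"
  define T where "T = top_eig m k"
  have T0: "0 \<le> T c" for c
    using top_eig_bounds(1)[OF mk, of c] zero_le_power2[of "c (0, 0)"] unfolding T_def by linarith
  have TF: "T c \<le> F c" for c using top_eig_bounds(2)[OF mk, of c] by (simp add: T_def F_def)
  have mT[measurable]: "T \<in> borel_measurable G"
    unfolding T_def G_def by (rule top_eig_measurable[OF mk])
  have mc[measurable]: "(\<lambda>c. c ij) \<in> borel_measurable G" if "ij \<in> ?I" for ij
    using gauss_mat_entry(2)[of "fst ij" m "snd ij" k] that by (auto simp: G_def)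
  have mF[measurable]: "F \<in> borel_measurable G" unfolding F_def by measurable
  have i2: "has_bochner_integral G (\<lambda>c. (c ij)\<^sup>2) 1" if "ij \<in> ?I" for ij
    using gauss_mat_entry(3)[of "fst ij" m "snd ij" k] that by (auto simp: G_def)
  have i4: "has_bochner_integral G (\<lambda>c. (c ij) ^ 4) 3" if "ij \<in> ?I" for ij
    using gauss_mat_entry(4)[of "fst ij" m "snd ij" k] that by (auto simp: G_def)
  have iF: "has_bochner_integral G F (\<Sum>ij\<in>?I. 1)"
    unfolding F_def using i2 by (intro has_bochner_integral_sum) auto
  let ?S = "\<lambda>c::nat \<times> nat \<Rightarrow> real. real (m * k) * (\<Sum>ij\<in>?I. (c ij) ^ 4)"
  have iS: "has_bochner_integral G ?S (real (m * k) * (\<Sum>ij\<in>?I. 3))"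
    using i4 by (intro has_bochner_integral_mult_right has_bochner_integral_sum) auto
  have FS: "(F c)\<^sup>2 \<le> ?S c" for c
  proof -
    have "(\<Sum>ij\<in>?I. 1 * (c ij)\<^sup>2)\<^sup>2 \<le> (\<Sum>ij\<in>?I. 1\<^sup>2) * (\<Sum>ij\<in>?I. ((c ij)\<^sup>2)\<^sup>2)"
      by (rule Cauchy_Schwarz_ineq_sum)
    then show ?thesis by (simp add: F_def power4_eq_xxxx power2_eq_square mult.assoc)
  qed
  have T2: "(T c)\<^sup>2 \<le> ?S c" for c
    using power_mono[OF TF T0, of c 2] FS[of c] by linarith
  have iT: "integrable G T"
    by (rule Bochner_Integration.integrable_bound[OF integrable.intros[OF iF]]) (use T0 in \<open>auto intro!: AE_I2 order_trans[OF TF]\<close>)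
  have iT2: "integrable G (\<lambda>c. (T c)\<^sup>2)"
    by (rule Bochner_Integration.integrable_bound[OF integrable.intros[OF iS]]) (auto intro!: AE_I2 order_trans[OF T2])
  have mean: "wishart_mean p q = expectation T"
    by (simp add: wishart_mean_def G_def T_def m_def k_def)
  have var: "wishart_var p q = variance T"
    unfolding wishart_var_def mean by (simp add: G_def T_def m_def k_def)
  have mkpq: "real (m * k) \<le> real (p * q)"
    unfolding m_def k_def by (intro of_nat_mono mult_le_mono) auto
  have "expectation T \<le> expectation F"
    by (rule integral_mono[OF iT integrable.intros[OF iF] TF])
  also have "\<dots> = real (m * k)" using has_bochner_integral_integral_eq[OF iF] by simp
  finally show "wishart_mean p q \<le> real (p * q)" using mean mkpq by simp
  have "variance T \<le> expectation (\<lambda>c. (T c)\<^sup>2)" using variance_eq[OF iT iT2] by simp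
  also have "\<dots> \<le> expectation ?S"
    by (rule integral_mono[OF iT2 integrable.intros[OF iS] T2])
  also have "\<dots> = 3 * (real (m * k))\<^sup>2"
    unfolding has_bochner_integral_integral_eq[OF iS] by (simp add: power2_eq_square)
  also have "\<dots> \<le> 3 * (real (p * q))\<^sup>2" using mkpq by (intro mult_left_mono power_mono) auto
  finally show "wishart_var p q \<le> 3 * (real (p * q))\<^sup>2" using var by simp
  have "variance T \<noteq> 0"
  proof
    assume v: "variance T = 0"
    let ?N = "density lborel (\<lambda>x. ennreal (std_normal_density x))"
    have "integrable G (\<lambda>c. (T c - expectation T)\<^sup>2)"
      using iT iT2 by (simp add: power2_diff)
    then have "AE c in G. (T c - expectation T)\<^sup>2 = 0"
      using v integral_nonneg_eq_0_iff_AE[of G "\<lambda>c. (T c - expectation T)\<^sup>2"] by simp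
    then have "AE c in G. (c (0, 0))\<^sup>2 \<le> expectation T"
      by eventually_elim (metis top_eig_bounds(1)[OF mk] T_def eq_iff_diff_eq_0 power2_eq_iff_nonneg zero_eq_power2)
    then have "AE x in distr G borel (\<lambda>c. c (0, 0)). x\<^sup>2 \<le> expectation T"
      using mc[of "(0, 0)"] mk by (subst AE_distr_iff) auto
    then have "AE x in ?N. x\<^sup>2 \<le> expectation T"
      by (metis gauss_mat_entry(1)[OF mk] G_def)
    then have ae: "AE x in lborel. x\<^sup>2 \<le> expectation T"
      by (subst (asm) AE_density) (auto simp: normal_density_pos less_top)
    define s where "s = \<bar>expectation T\<bar> + 1"
    have "AE x in lborel. x \<notin> {s..s + 1}"
      using ae
    proof eventually_elim
      case (elim x)
      have "expectation T < s" "1 \<le> s" by (auto simp: s_def)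
      moreover have "s \<le> x\<^sup>2" if "s \<le> x"
        using that \<open>1 \<le> s\<close> mult_mono[of 1 x s x] by (simp add: power2_eq_square)
      ultimately show ?case using elim by force
    qed
    then have "emeasure lborel {s..s+1} = 0" 
      using emeasure_eq_0_AE[of "\<lambda>x. x \<in> {s..s + 1}" lborel] by (simp del: atLeastAtMost_iff)
    then show False by simp
  qed
  then show "0 < wishart_var p q" using var variance_positive[of T] by linarith
qed

section \<open>Maximal correlation of a positive functional\<close>

lemma discriminant_nonpos:
  fixes a b c :: real
  assumes "\<And>t. 0 \<le> a + 2 * t * b + t\<^sup>2 * c" "0 \<le> c"
  shows "b\<^sup>2 \<le> a * c"
proof (cases "c = 0")
  case True
  have "b = 0"
  proof (rule ccontr)
    assume "b \<noteq> 0"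
    then show False using assms(1)[of "- (a + 1) / (2 * b)"] True by (simp add: field_simps)
  qed
  then show ?thesis using True by simp
next
  case False
  then have "c > 0" using assms(2) by simp
  have "0 \<le> c * (a + 2 * (- b / c) * b + (- b / c)\<^sup>2 * c)"
    using assms(1)[of "- b / c"] \<open>c > 0\<close> by (intro mult_nonneg_nonneg) auto
  also have "\<dots> = a * c - b\<^sup>2" using \<open>c > 0\<close> by (simp add: field_simps power2_eq_square)
  finally show ?thesis by simp
qed

text \<open>
  \<open>E\<close> stands for a conditional expectation or its kernel estimator, as in \<open>cov_mat\<close>.
\<close>

definition cov_of :: "(('w \<Rightarrow> real) \<Rightarrow> real) \<Rightarrow> ('w \<Rightarrow> real) \<Rightarrow> ('w \<Rightarrow> real) \<Rightarrow> real" where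
  "cov_of E f g = E (\<lambda>w. f w * g w) - E f * E g"

definition lincomb :: "nat \<Rightarrow> (nat \<Rightarrow> real) \<Rightarrow> (nat \<Rightarrow> 'w \<Rightarrow> real) \<Rightarrow> 'w \<Rightarrow> real" where
  "lincomb p a U = (\<lambda>w. \<Sum>i<p. a i * U i w)"

text \<open>
  The common structure of the conditional expectations at a point, for which \<open>D\<close> consists of the bounded
  measurable functions, and of the kernel estimators, for which \<open>D\<close> contains every function.
\<close>

locale positive_functional =
  fixes E :: "('w \<Rightarrow> real) \<Rightarrow> real" and D :: "('w \<Rightarrow> real) set"
  assumes D_const: "(\<lambda>_. c) \<in> D"
    and D_add: "f \<in> D \<Longrightarrow> g \<in> D \<Longrightarrow> (\<lambda>w. f w + g w) \<in> D"
    and D_mult: "f \<in> D \<Longrightarrow> g \<in> D \<Longrightarrow> (\<lambda>w. f w * g w) \<in> D"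
    and E_one: "E (\<lambda>_. 1) = 1"
    and E_add: "f \<in> D \<Longrightarrow> g \<in> D \<Longrightarrow> E (\<lambda>w. f w + g w) = E f + E g"
    and E_scale: "f \<in> D \<Longrightarrow> E (\<lambda>w. c * f w) = c * E f"
    and E_square: "f \<in> D \<Longrightarrow> 0 \<le> E (\<lambda>w. f w * f w)"
begin

lemma D_scale: "f \<in> D \<Longrightarrow> (\<lambda>w. c * f w) \<in> D"
  by (intro D_mult D_const)

lemma D_sum: "(\<And>i. i < p \<Longrightarrow> U i \<in> D) \<Longrightarrow> (\<lambda>w. \<Sum>i<(p::nat). U i w) \<in> D"
  by (induction p) (auto intro: D_const D_add)

lemma D_lincomb: "(\<And>i. i < p \<Longrightarrow> U i \<in> D) \<Longrightarrow> lincomb p a U \<in> D"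
  unfolding lincomb_def by (intro D_sum D_scale) auto

lemma E_const: "E (\<lambda>_. c) = c"
  using E_scale[OF D_const[of 1], of c] E_one by simp

lemma E_sum: "(\<And>i. i < p \<Longrightarrow> U i \<in> D) \<Longrightarrow> E (\<lambda>w. \<Sum>i<(p::nat). U i w) = (\<Sum>i<p. E (U i))"
proof (induction p)
  case 0
  then show ?case by (simp add: E_const)
next
  case (Suc p)
  then show ?case by (simp add: E_add D_sum)
qed

lemma cov_commute: "cov_of E f g = cov_of E g f"
  by (simp add: cov_of_def mult.commute)

lemma cov_add_left:
  "f \<in> D \<Longrightarrow> g \<in> D \<Longrightarrow> k \<in> D \<Longrightarrow> cov_of E (\<lambda>w. f w + g w) k = cov_of E f k + cov_of E g k"
  unfolding cov_of_def by (simp add: distrib_right E_add D_mult)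

lemma cov_scale_left: "f \<in> D \<Longrightarrow> k \<in> D \<Longrightarrow> cov_of E (\<lambda>w. c * f w) k = c * cov_of E f k"
  unfolding cov_of_def using E_scale[of "\<lambda>w. f w * k w" c]
  by (simp add: E_scale D_mult mult.assoc right_diff_distrib)

lemma cov_const_left: "f \<in> D \<Longrightarrow> cov_of E (\<lambda>_. c) f = 0"
  unfolding cov_of_def by (simp add: E_scale E_const)

lemma cov_lincomb_left:
  assumes "\<And>i. i < p \<Longrightarrow> U i \<in> D" "k \<in> D"
  shows "cov_of E (lincomb p a U) k = (\<Sum>i<p. a i * cov_of E (U i) k)"
  using assms(1)
proof (induction p)
  case 0
  then show ?case using cov_const_left[OF assms(2), of 0] by (simp add: lincomb_def)
next
  case (Suc p)
  have "lincomb (Suc p) a U = (\<lambda>w. lincomb p a U w + a p * U p w)" by (simp add: lincomb_def)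
  then show ?case using Suc assms(2) by (simp add: cov_add_left cov_scale_left D_scale D_lincomb)
qed

lemma cov_lincomb:
  assumes "\<And>i. i < p \<Longrightarrow> U i \<in> D" "\<And>j. j < q \<Longrightarrow> V j \<in> D"
  shows "cov_of E (lincomb p a U) (lincomb q b V) = (\<Sum>i<p. \<Sum>j<q. a i * cov_of E (U i) (V j) * b j)"
proof -
  have "cov_of E (U i) (lincomb q b V) = (\<Sum>j<q. cov_of E (U i) (V j) * b j)" if "i < p" for i
    using cov_lincomb_left[OF assms(2) assms(1)[OF that], where a=b] cov_commute
    by (simp add: mult.commute)
  then show ?thesis using assms
    by (simp add: cov_lincomb_left D_lincomb sum_distrib_left mult.assoc)
qed

lemma var_nonneg: assumes "f \<in> D" shows "0 \<le> cov_of E f f"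
proof -
  let ?g = "\<lambda>w. f w + (- E f)"
  have gD: "?g \<in> D" using assms by (intro D_add D_const)
  have "E ?g = 0" using assms by (simp only: E_add D_const E_const)
  then have "0 \<le> cov_of E ?g ?g" using E_square[OF gD] by (simp only: cov_of_def)
  also have "cov_of E ?g ?g = cov_of E f ?g + cov_of E (\<lambda>_. - E f) ?g"
    using assms gD by (intro cov_add_left D_const)
  also have "cov_of E (\<lambda>_. - E f) ?g = 0" using gD by (rule cov_const_left)
  also have "cov_of E f ?g = cov_of E f f + cov_of E (\<lambda>_. - E f) f"
    unfolding cov_commute[of f ?g] using assms by (intro cov_add_left D_const)
  also have "cov_of E (\<lambda>_. - E f) f = 0" using assms by (rule cov_const_left)
  finally show ?thesis by simp
qed

lemma cov_Cauchy_Schwarz: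
  assumes "f \<in> D" "g \<in> D"
  shows "(cov_of E f g)\<^sup>2 \<le> cov_of E f f * cov_of E g g"
    and "\<bar>cov_of E f g\<bar> \<le> sqrt (cov_of E f f) * sqrt (cov_of E g g)"
proof -
  have "0 \<le> cov_of E f f + 2 * t * cov_of E f g + t\<^sup>2 * cov_of E g g" for t
  proof -
    let ?h = "\<lambda>w. f w + t * g w"
    have h: "?h \<in> D" using assms by (intro D_add D_scale)
    have "cov_of E ?h ?h = cov_of E f ?h + t * cov_of E g ?h"
      using assms h by (simp add: cov_add_left cov_scale_left D_scale)
    also have "\<dots> = cov_of E f f + 2 * t * cov_of E f g + t\<^sup>2 * cov_of E g g"
      unfolding cov_commute[of f ?h] cov_commute[of g ?h] using assms
      by (simp add: cov_add_left cov_scale_left D_scale cov_commute[of g f] power2_eq_square algebra_simps)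
    finally show ?thesis using var_nonneg[OF h] by simp
  qed
  then show *: "(cov_of E f g)\<^sup>2 \<le> cov_of E f f * cov_of E g g"
    by (rule discriminant_nonpos) (rule var_nonneg[OF assms(2)])
  show "\<bar>cov_of E f g\<bar> \<le> sqrt (cov_of E f f) * sqrt (cov_of E g g)"
    using real_sqrt_le_mono[OF *] by (simp add: real_sqrt_mult)
qed

lemma sd_triangle:
  assumes "f \<in> D" "g \<in> D"
  shows "sqrt (cov_of E (\<lambda>w. f w + g w) (\<lambda>w. f w + g w)) \<le> sqrt (cov_of E f f) + sqrt (cov_of E g g)"
proof (rule real_le_lsqrt)
  have s: "(\<lambda>w. f w + g w) \<in> D" using assms by (rule D_add)
  have "cov_of E (\<lambda>w. f w + g w) (\<lambda>w. f w + g w) = cov_of E f f + 2 * cov_of E f g + cov_of E g g"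
    using assms s cov_commute[of f "\<lambda>w. f w + g w"] cov_commute[of g "\<lambda>w. f w + g w"]
    by (simp add: cov_add_left cov_commute[of g f])
  also have "\<dots> \<le> cov_of E f f + 2 * (sqrt (cov_of E f f) * sqrt (cov_of E g g)) + cov_of E g g"
    using cov_Cauchy_Schwarz(2)[OF assms] by simp
  also have "\<dots> = (sqrt (cov_of E f f) + sqrt (cov_of E g g))\<^sup>2"
    using var_nonneg assms by (simp add: power2_sum)
  finally show "cov_of E (\<lambda>w. f w + g w) (\<lambda>w. f w + g w) \<le> (sqrt (cov_of E f f) + sqrt (cov_of E g g))\<^sup>2" .
  show "0 \<le> sqrt (cov_of E f f) + sqrt (cov_of E g g)" using var_nonneg assms by simp
qed

lemma var_le_square: "f \<in> D \<Longrightarrow> cov_of E f f \<le> E (\<lambda>w. f w * f w)"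
  by (simp add: cov_of_def)

end

locale functional_families = positive_functional E D for E :: "('w \<Rightarrow> real) \<Rightarrow> real" and D +
  fixes p :: nat and U :: "nat \<Rightarrow> 'w \<Rightarrow> real" and q :: nat and V :: "nat \<Rightarrow> 'w \<Rightarrow> real"
  assumes U_D: "i < p \<Longrightarrow> U i \<in> D" and V_D: "j < q \<Longrightarrow> V j \<in> D"
begin

abbreviation varU where "varU a \<equiv> cov_of E (lincomb p a U) (lincomb p a U)"
abbreviation varV where "varV b \<equiv> cov_of E (lincomb q b V) (lincomb q b V)"
abbreviation covUV where "covUV a b \<equiv> cov_of E (lincomb p a U) (lincomb q b V)"

lemma covUV_le_sd: "\<bar>covUV a b\<bar> \<le> sqrt (varU a) * sqrt (varV b)"
  by (rule cov_Cauchy_Schwarz(2)) (auto intro: D_lincomb U_D V_D)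

lemma varU_nonneg: "0 \<le> varU a" and varV_nonneg: "0 \<le> varV b"
  by (auto intro: var_nonneg D_lincomb U_D V_D)

lemma scale_forms: "varU (\<lambda>i. c * a i) = c\<^sup>2 * varU a" "varV (\<lambda>i. c * b i) = c\<^sup>2 * varV b"
    "covUV (\<lambda>i. c * a i) (\<lambda>j. d * b j) = c * d * covUV a b"
  by (simp_all add: cov_lincomb U_D V_D sum_distrib_left power2_eq_square mult_ac)

text \<open>
  A covariance matrix is zero iff its quadratic form is, because by the Cauchy-Schwarz inequality its
  entries are bounded by its diagonal.
\<close>

lemma max_corr_eq:
  "max_corr E p U q V =
    (if (\<forall>a. varU a = 0) \<or> (\<forall>b. varV b = 0) then 0
     else Sup {covUV a b | a b. varU a = 1 \<and> varV b = 1})"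
proof -
  have deg: "cov_mat E r W r W = 0\<^sub>m r r \<longleftrightarrow> (\<forall>a. cov_of E (lincomb r a W) (lincomb r a W) = 0)"
    if W: "\<And>i. i < r \<Longrightarrow> W i \<in> D" for r W
  proof
    assume z: "cov_mat E r W r W = 0\<^sub>m r r"
    have "cov_of E (W i) (W j) = 0" if "i < r" "j < r" for i j
      using arg_cong[OF z, of "\<lambda>S. S $$ (i, j)"] that by (simp add: cov_mat_def cov_of_def)
    then show "\<forall>a. cov_of E (lincomb r a W) (lincomb r a W) = 0" using W by (simp add: cov_lincomb)
  next
    assume z: "\<forall>a. cov_of E (lincomb r a W) (lincomb r a W) = 0"
    have d: "cov_of E (W i) (W i) = 0" if "i < r" for i
    proof -
      have "lincomb r (\<lambda>l. if l = i then 1 else 0) W = (\<lambda>w. \<Sum>l<r. if l = i then W i w else 0)"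
        unfolding lincomb_def by (intro ext sum.cong) auto
      also have "\<dots> = W i" using that by simp
      finally show ?thesis using z by metis
    qed
    have "cov_of E (W i) (W j) = 0" if "i < r" "j < r" for i j
      using cov_Cauchy_Schwarz(2)[OF W[OF that(1)] W[OF that(2)]] d that by simp
    then show "cov_mat E r W r W = 0\<^sub>m r r"
      by (intro eq_matI) (auto simp: cov_mat_def cov_of_def)
  qed
  have form: "scalar_prod a (cov_mat E r W s W' *\<^sub>v b) =
      cov_of E (lincomb r (\<lambda>i. vec_index a i) W) (lincomb s (\<lambda>i. vec_index b i) W')"
    if "\<And>i. i < r \<Longrightarrow> W i \<in> D" "\<And>i. i < s \<Longrightarrow> W' i \<in> D" "a \<in> carrier_vec r" "b \<in> carrier_vec s"
    for r s W W' a b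
  proof -
    have "scalar_prod a (cov_mat E r W s W' *\<^sub>v b)
      = (\<Sum>i<r. \<Sum>j<s. vec_index a i * cov_mat E r W s W' $$ (i, j) * vec_index b j)"
      using that by (intro scalar_prod_mat_form) (auto simp: cov_mat_def)
    also have "\<dots> = (\<Sum>i<r. \<Sum>j<s. vec_index a i * cov_of E (W i) (W' j) * vec_index b j)"
      by (intro sum.cong refl) (auto simp: cov_mat_def cov_of_def)
    finally show ?thesis using that by (simp add: cov_lincomb)
  qed
  have lv: "lincomb r (\<lambda>i. vec_index (vec r a) i) W = lincomb r a W" for r a and W :: "nat \<Rightarrow> 'w \<Rightarrow> real"
    by (simp add: lincomb_def)
  have "{scalar_prod a (cov_mat E p U q V *\<^sub>v b) | a b.
                  a \<in> carrier_vec p \<and> b \<in> carrier_vec q \<and>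
                  scalar_prod a (cov_mat E p U p U *\<^sub>v a) = 1 \<and> scalar_prod b (cov_mat E q V q V *\<^sub>v b) = 1}
      = {covUV a b | a b. varU a = 1 \<and> varV b = 1}" (is "?A = ?B")
  proof
    show "?A \<subseteq> ?B" using form U_D V_D by fastforce
    show "?B \<subseteq> ?A"
    proof
      fix x assume "x \<in> ?B"
      then obtain a b where ab: "x = covUV a b" "varU a = 1" "varV b = 1" by blast
      have "x = scalar_prod (vec p a) (cov_mat E p U q V *\<^sub>v vec q b)"
        "scalar_prod (vec p a) (cov_mat E p U p U *\<^sub>v vec p a) = 1"
        "scalar_prod (vec q b) (cov_mat E q V q V *\<^sub>v vec q b) = 1"
        using ab U_D V_D by (auto simp: form lv)
      then show "x \<in> ?A" using vec_carrier by blast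
    qed
  qed
  then show ?thesis unfolding max_corr_def Let_def using deg[OF U_D] deg[OF V_D] by simp
qed

lemma corr_set_bounds:
  assumes "x \<in> {covUV a b | a b. varU a = 1 \<and> varV b = 1}" shows "x \<le> 1"
proof -
  obtain a b where "x = covUV a b" "varU a = 1" "varV b = 1" using assms by blast
  then show ?thesis using covUV_le_sd[of a b] by simp
qed

lemma normalized_in_corr_set:
  assumes "0 < varU a" "0 < varV b"
  shows "covUV a b / (sqrt (varU a) * sqrt (varV b)) \<in> {covUV a b | a b. varU a = 1 \<and> varV b = 1}"
proof -
  let ?a = "\<lambda>i. inverse (sqrt (varU a)) * a i" and ?b = "\<lambda>i. inverse (sqrt (varV b)) * b i"
  have "varU ?a = 1" "varV ?b = 1" "covUV ?a ?b = covUV a b / (sqrt (varU a) * sqrt (varV b))"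
    using assms unfolding scale_forms by (simp_all add: power_inverse field_simps)
  then show ?thesis by (intro CollectI exI[of _ ?a] exI[of _ ?b]) simp
qed

lemma cov_le_max_corr: "covUV a b \<le> max_corr E p U q V * sqrt (varU a) * sqrt (varV b)"
proof (cases "varU a = 0 \<or> varV b = 0")
  case True
  then show ?thesis using covUV_le_sd[of a b] by auto
next
  case False
  then have pos: "0 < varU a" "0 < varV b" using varU_nonneg varV_nonneg by (auto simp: less_le)
  have "covUV a b / (sqrt (varU a) * sqrt (varV b)) \<le> max_corr E p U q V"
    unfolding max_corr_eq using False normalized_in_corr_set[OF pos] corr_set_bounds
    by (auto intro!: cSup_upper bdd_aboveI[where M=1])
  then show ?thesis using pos by (simp add: pos_divide_le_eq mult.assoc)
qed

lemma abs_cov_le_max_corr: "\<bar>covUV a b\<bar> \<le> max_corr E p U q V * sqrt (varU a) * sqrt (varV b)"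
proof -
  have "varU (\<lambda>i. (-1) * a i) = varU a" "covUV (\<lambda>i. (-1) * a i) b = - covUV a b"
    unfolding scale_forms(1) using scale_forms(3)[of "-1" a 1 b] by (simp_all only: mult_1 power2_minus power_one mult_minus_left)
  then have "- covUV a b \<le> max_corr E p U q V * sqrt (varU a) * sqrt (varV b)"
    using cov_le_max_corr[of "\<lambda>i. (-1) * a i" b] by metis
  then show ?thesis using cov_le_max_corr[of a b] by linarith
qed

lemma nondegenerate:
  assumes "\<not> ((\<forall>a. varU a = 0) \<or> (\<forall>b. varV b = 0))"
  obtains a b where "0 < varU a" "0 < varV b"
  using assms varU_nonneg varV_nonneg by (metis less_eq_real_def)

lemma max_corr_range: "0 \<le> max_corr E p U q V" "max_corr E p U q V \<le> 1"
proof -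
  have "0 \<le> max_corr E p U q V \<and> max_corr E p U q V \<le> 1"
  proof (cases "(\<forall>a. varU a = 0) \<or> (\<forall>b. varV b = 0)")
    case True
    then show ?thesis unfolding max_corr_eq by simp
  next
    case False
    then obtain a b where pos: "0 < varU a" "0 < varV b" by (rule nondegenerate)
    have "0 \<le> max_corr E p U q V * (sqrt (varU a) * sqrt (varV b))"
      using abs_cov_le_max_corr[of a b] by (simp add: mult.assoc)
    moreover have "0 < sqrt (varU a) * sqrt (varV b)" using pos by simp
    ultimately have "0 \<le> max_corr E p U q V" by (metis zero_le_mult_iff not_le)
    moreover have "max_corr E p U q V \<le> 1"
      unfolding max_corr_eq using False normalized_in_corr_set[OF pos] corr_set_bounds
      by (auto intro!: cSup_least)
    ultimately show ?thesis by simp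
  qed
  then show "0 \<le> max_corr E p U q V" "max_corr E p U q V \<le> 1" by auto
qed

text \<open>
  By homogeneity the constraints of unit variance can be replaced by positive variance.  The right-hand
  side is an open condition on the pair of coefficient vectors, as required for measurability.
\<close>

lemma less_max_corr_iff:
  assumes "0 \<le> t"
  shows "t < max_corr E p U q V \<longleftrightarrow>
    (\<exists>ab. 0 < varU (fst ab) \<and> 0 < varV (snd ab) \<and>
       t * (sqrt (varU (fst ab)) * sqrt (varV (snd ab))) < covUV (fst ab) (snd ab))"
proof
  assume t: "t < max_corr E p U q V"
  then have nd: "\<not> ((\<forall>a. varU a = 0) \<or> (\<forall>b. varV b = 0))"
    using assms unfolding max_corr_eq by (auto split: if_splits)
  then obtain a b where pos: "0 < varU a" "0 < varV b" by (rule nondegenerate)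
  have "t < Sup {covUV a b | a b. varU a = 1 \<and> varV b = 1}"
    using t nd unfolding max_corr_eq by simp
  then obtain x where "x \<in> {covUV a b | a b. varU a = 1 \<and> varV b = 1}" "t < x"
    using normalized_in_corr_set[OF pos] by (elim less_cSupE) blast+
  then obtain a b where "varU a = 1" "varV b = 1" "t < covUV a b" by blast
  then show "\<exists>ab. 0 < varU (fst ab) \<and> 0 < varV (snd ab) \<and>
       t * (sqrt (varU (fst ab)) * sqrt (varV (snd ab))) < covUV (fst ab) (snd ab)"
    by (intro exI[of _ "(a, b)"]) simp
next
  assume "\<exists>ab. 0 < varU (fst ab) \<and> 0 < varV (snd ab) \<and>
       t * (sqrt (varU (fst ab)) * sqrt (varV (snd ab))) < covUV (fst ab) (snd ab)"
  then obtain a b where ab: "0 < varU a" "0 < varV b" "t * (sqrt (varU a) * sqrt (varV b)) < covUV a b"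
    by auto
  then have "t * (sqrt (varU a) * sqrt (varV b)) < max_corr E p U q V * (sqrt (varU a) * sqrt (varV b))"
    using cov_le_max_corr[of a b] unfolding mult.assoc by linarith
  then show "t < max_corr E p U q V" using ab by (intro mult_right_less_imp_less[of t "sqrt (varU a) * sqrt (varV b)"]) auto
qed

end

lemma max_corr_measurable:
  fixes E :: "'m \<Rightarrow> ('w \<Rightarrow> real) \<Rightarrow> real"
  assumes good: "{\<omega> \<in> space M. good \<omega>} \<in> sets M"
    and fam: "\<And>\<omega>. \<omega> \<in> space M \<Longrightarrow> good \<omega> \<Longrightarrow> functional_families (E \<omega>) (D \<omega>) p U q V"
    and bad: "\<And>\<omega>. \<omega> \<in> space M \<Longrightarrow> \<not> good \<omega> \<Longrightarrow> max_corr (E \<omega>) p U q V = 0"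
    and UU: "\<And>i j. i < p \<Longrightarrow> j < p \<Longrightarrow> (\<lambda>\<omega>. cov_of (E \<omega>) (U i) (U j)) \<in> borel_measurable M"
    and VV: "\<And>i j. i < q \<Longrightarrow> j < q \<Longrightarrow> (\<lambda>\<omega>. cov_of (E \<omega>) (V i) (V j)) \<in> borel_measurable M"
    and UV: "\<And>i j. i < p \<Longrightarrow> j < q \<Longrightarrow> (\<lambda>\<omega>. cov_of (E \<omega>) (U i) (V j)) \<in> borel_measurable M"
  shows "(\<lambda>\<omega>. max_corr (E \<omega>) p U q V) \<in> borel_measurable M"
proof (rule borel_measurable_iff_greater[THEN iffD2], rule allI)
  fix t :: real
  let ?u = "\<lambda>\<omega> a. \<Sum>i<p. \<Sum>j<p. a i * cov_of (E \<omega>) (U i) (U j) * a j"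
  let ?v = "\<lambda>\<omega> a. \<Sum>i<q. \<Sum>j<q. a i * cov_of (E \<omega>) (V i) (V j) * a j"
  let ?c = "\<lambda>\<omega> a b. \<Sum>i<p. \<Sum>j<q. a i * cov_of (E \<omega>) (U i) (V j) * b j"
  let ?P = "\<lambda>(ab :: (nat \<Rightarrow> real) \<times> (nat \<Rightarrow> real)) \<omega>. 0 < ?u \<omega> (fst ab) \<and> 0 < ?v \<omega> (snd ab) \<and>
       t * (sqrt (?u \<omega> (fst ab)) * sqrt (?v \<omega> (snd ab))) < ?c \<omega> (fst ab) (snd ab)"
  have range: "0 \<le> max_corr (E \<omega>) p U q V" if "\<omega> \<in> space M" for \<omega>
    using functional_families.max_corr_range(1)[OF fam[OF that]] bad[OF that] by (cases "good \<omega>") auto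
  show "{\<omega> \<in> space M. t < max_corr (E \<omega>) p U q V} \<in> sets M"
  proof (cases "0 \<le> t")
    case False
    then have "{\<omega> \<in> space M. t < max_corr (E \<omega>) p U q V} = space M" using range by force
    then show ?thesis by simp
  next
    case True
    have "t < max_corr (E \<omega>) p U q V \<longleftrightarrow> good \<omega> \<and> (\<exists>ab. ?P ab \<omega>)" if \<omega>: "\<omega> \<in> space M" for \<omega>
    proof (cases "good \<omega>")
      case g: True
      interpret functional_families "E \<omega>" "D \<omega>" p U q V by (rule fam[OF \<omega> g])
      show ?thesis using less_max_corr_iff[OF True] g by (simp add: cov_lincomb U_D V_D)
    next
      case False
      then show ?thesis using bad[OF \<omega>] True by simp
    qed
    then have eq: "{\<omega> \<in> space M. t < max_corr (E \<omega>) p U q V}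
        = {\<omega> \<in> space M. good \<omega>} \<inter> {\<omega> \<in> space M. \<exists>ab. ?P ab \<omega>}" by blast
    have "{\<omega> \<in> space M. \<exists>ab. ?P ab \<omega>} \<in> sets M"
    proof (rule sets_Collect_ex_open)
      fix ab :: "(nat \<Rightarrow> real) \<times> (nat \<Rightarrow> real)"
      have "(\<lambda>\<omega>. ?u \<omega> (fst ab)) \<in> borel_measurable M" "(\<lambda>\<omega>. ?v \<omega> (snd ab)) \<in> borel_measurable M"
        "(\<lambda>\<omega>. ?c \<omega> (fst ab) (snd ab)) \<in> borel_measurable M"
        using UU VV UV by (intro borel_measurable_sum borel_measurable_times borel_measurable_const; simp)+
      note [measurable] = this
      show "{\<omega> \<in> space M. ?P ab \<omega>} \<in> sets M" by measurable
    next
      fix \<omega> assume "\<omega> \<in> space M"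
      have cf: "continuous_on UNIV (\<lambda>ab::(nat \<Rightarrow> real) \<times> (nat \<Rightarrow> real). fst ab i)"
        "continuous_on UNIV (\<lambda>ab::(nat \<Rightarrow> real) \<times> (nat \<Rightarrow> real). snd ab i)" for i
        by (rule continuous_on_compose2[OF continuous_on_product_coordinates[of i] continuous_on_fst[OF continuous_on_id]]
              continuous_on_compose2[OF continuous_on_product_coordinates[of i] continuous_on_snd[OF continuous_on_id]]; simp)+
      show "open {ab. ?P ab \<omega>}"
        by (intro open_Collect_conj open_Collect_less continuous_intros cf)
    qed
    from sets.Int[OF good this] show ?thesis unfolding eq .
  qed
qed

section \<open>Stability of the maximal correlation\<close>

context functional_families
begin

lemma forms:
  "varU a = (\<Sum>i<p. \<Sum>j<p. a i * cov_of E (U i) (U j) * a j)"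
  "varV b = (\<Sum>i<q. \<Sum>j<q. b i * cov_of E (V i) (V j) * b j)"
  "covUV a b = (\<Sum>i<p. \<Sum>j<q. a i * cov_of E (U i) (V j) * b j)"
  by (rule cov_lincomb; fact U_D V_D)+

lemma swap_families: "functional_families E D q V p U"
  by unfold_locales (auto intro: U_D V_D)

text \<open>
  Subtracting a multiple of the constant combination \<open>a0\<close> changes no covariance.  It makes the mean
  zero, so that the variance becomes the second moment, for which the lower bound \<open>low\<close> is available.
  The covariance matrix itself is singular, with \<open>a0\<close> in its kernel.
\<close>

lemma center_left:
  assumes one: "E (lincomb p a0 U) = 1" "E (\<lambda>w. lincomb p a0 U w * lincomb p a0 U w) = 1"
    and low: "\<And>a. \<delta> * (\<Sum>i<p. (a i)\<^sup>2) \<le> E (\<lambda>w. lincomb p a U w * lincomb p a U w)"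
  shows "\<exists>a'. varU a' = varU a \<and> (\<forall>b. covUV a' b = covUV a b) \<and> \<delta> * (\<Sum>i<p. (a' i)\<^sup>2) \<le> varU a"
proof -
  define c where "c = - E (lincomb p a U)"
  define a' where "a' = (\<lambda>i. a i + c * a0 i)"
  have LD: "lincomb p x U \<in> D" for x by (intro D_lincomb U_D)
  have eq: "lincomb p a' U = (\<lambda>w. lincomb p a U w + c * lincomb p a0 U w)"
    by (simp add: a'_def lincomb_def algebra_simps sum.distrib sum_distrib_left)
  have v0: "cov_of E (lincomb p a0 U) (lincomb p a0 U) = 0"
    using one by (simp add: cov_of_def)
  have c0: "cov_of E (lincomb p a0 U) g = 0" if "g \<in> D" for g
    using cov_Cauchy_Schwarz(2)[OF LD that, of a0] v0 by simp
  have ca: "cov_of E (lincomb p a' U) g = cov_of E (lincomb p a U) g" if "g \<in> D" for g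
    unfolding eq using that c0 by (simp add: cov_add_left cov_scale_left LD D_scale)
  have "varU a' = cov_of E (lincomb p a U) (lincomb p a' U)" by (intro ca LD)
  also have "\<dots> = varU a" unfolding cov_commute[of "lincomb p a U" "lincomb p a' U"] by (intro ca LD)
  finally have var: "varU a' = varU a" .
  have "E (lincomb p a' U) = 0"
  proof -
    have "E (lincomb p a' U) = E (lincomb p a U) + c * E (lincomb p a0 U)"
      unfolding eq by (simp add: E_add E_scale LD D_scale)
    then show ?thesis using one by (simp add: c_def)
  qed
  then have "varU a' = E (\<lambda>w. lincomb p a' U w * lincomb p a' U w)" by (simp add: cov_of_def)
  then have "\<delta> * (\<Sum>i<p. (a' i)\<^sup>2) \<le> varU a" using low[of a'] var by simp
  moreover have "covUV a' b = covUV a b" for b by (intro ca D_lincomb V_D)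
  ultimately show ?thesis using var by blast
qed

end

lemma form_perturb:
  fixes C C' :: "nat \<Rightarrow> nat \<Rightarrow> real"
  assumes C: "\<And>i j. i < p \<Longrightarrow> j < q \<Longrightarrow> \<bar>C i j - C' i j\<bar> \<le> t" and t: "0 \<le> t"
    and a: "(\<Sum>i<p. (a i)\<^sup>2) \<le> s" and b: "(\<Sum>i<q. (b i)\<^sup>2) \<le> s"
  shows "\<bar>(\<Sum>i<p. \<Sum>j<q. a i * C i j * b j) - (\<Sum>i<p. \<Sum>j<q. a i * C' i j * b j)\<bar> \<le> t * (real (p + q) * s)"
proof -
  have l1: "(\<Sum>i<r. \<bar>x i\<bar>)\<^sup>2 \<le> real r * s" if "(\<Sum>i<r. (x i)\<^sup>2) \<le> s" for r and x :: "nat \<Rightarrow> real"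
  proof -
    have "(\<Sum>i<r. 1 * \<bar>x i\<bar>)\<^sup>2 \<le> (\<Sum>i<r. 1\<^sup>2) * (\<Sum>i<r. \<bar>x i\<bar>\<^sup>2)"
      by (rule Cauchy_Schwarz_ineq_sum)
    also have "\<dots> \<le> real r * s" using that by (simp add: mult_left_mono)
    finally show ?thesis by simp
  qed
  let ?A = "\<Sum>i<p. \<bar>a i\<bar>" and ?B = "\<Sum>j<q. \<bar>b j\<bar>"
  have s: "0 \<le> s" using a sum_nonneg[of "{..<p}" "\<lambda>i. (a i)\<^sup>2"] by simp
  have "\<bar>(\<Sum>i<p. \<Sum>j<q. a i * C i j * b j) - (\<Sum>i<p. \<Sum>j<q. a i * C' i j * b j)\<bar>
      = \<bar>\<Sum>i<p. \<Sum>j<q. a i * (C i j - C' i j) * b j\<bar>"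
    by (simp add: sum_subtractf[symmetric] algebra_simps)
  also have "\<dots> \<le> (\<Sum>i<p. \<Sum>j<q. \<bar>a i * (C i j - C' i j) * b j\<bar>)"
    by (rule order_trans[OF sum_abs sum_mono[OF sum_abs]])
  also have "\<dots> \<le> (\<Sum>i<p. \<Sum>j<q. t * (\<bar>a i\<bar> * \<bar>b j\<bar>))"
  proof (intro sum_mono)
    fix i j assume "i \<in> {..<p}" "j \<in> {..<q}"
    then have "\<bar>C i j - C' i j\<bar> * (\<bar>a i\<bar> * \<bar>b j\<bar>) \<le> t * (\<bar>a i\<bar> * \<bar>b j\<bar>)"
      using C by (intro mult_right_mono) auto
    then show "\<bar>a i * (C i j - C' i j) * b j\<bar> \<le> t * (\<bar>a i\<bar> * \<bar>b j\<bar>)"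
      by (simp add: abs_mult mult_ac)
  qed
  also have "\<dots> = t * (?A * ?B)" by (subst sum_product) (simp only: sum_distrib_left)
  also have "\<dots> \<le> t * (real (p + q) * s)"
  proof (intro mult_left_mono t)
    have "2 * (?A * ?B) \<le> ?A\<^sup>2 + ?B\<^sup>2" using sum_squares_bound[of ?A ?B] by (simp add: mult.assoc)
    also have "\<dots> \<le> real (p + q) * s" using l1[OF a] l1[OF b] by (simp add: distrib_right)
    also have "\<dots> \<le> 2 * (real (p + q) * s)" using s by simp
    finally show "?A * ?B \<le> real (p + q) * s" by simp
  qed
  finally show ?thesis .
qed

text \<open>
  Any pair of coefficient vectors that is normalised and centred for \<open>E\<close> has norms at
  most \<open>1 / sqrt \<delta>\<close>, and serves as a trial pair for \<open>E'\<close>.  Its three forms under \<open>E'\<close>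
  differ from those under \<open>E\<close> by at most \<open>k\<close>, whence \<open>max_corr E \<le> max_corr E' + 2 k\<close>.
\<close>

lemma max_corr_perturb:
  assumes "functional_families E D p U q V" and "functional_families E' D' p U q V"
    and \<delta>: "0 < \<delta>" and \<tau>: "0 \<le> \<tau>"
    and oneU: "E (lincomb p a0 U) = 1" "E (\<lambda>w. lincomb p a0 U w * lincomb p a0 U w) = 1"
    and oneV: "E (lincomb q b0 V) = 1" "E (\<lambda>w. lincomb q b0 V w * lincomb q b0 V w) = 1"
    and lowU: "\<And>a. \<delta> * (\<Sum>i<p. (a i)\<^sup>2) \<le> E (\<lambda>w. lincomb p a U w * lincomb p a U w)"
    and lowV: "\<And>b. \<delta> * (\<Sum>i<q. (b i)\<^sup>2) \<le> E (\<lambda>w. lincomb q b V w * lincomb q b V w)"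
    and UU: "\<And>i j. i < p \<Longrightarrow> j < p \<Longrightarrow> \<bar>cov_of E (U i) (U j) - cov_of E' (U i) (U j)\<bar> \<le> \<tau>"
    and VV: "\<And>i j. i < q \<Longrightarrow> j < q \<Longrightarrow> \<bar>cov_of E (V i) (V j) - cov_of E' (V i) (V j)\<bar> \<le> \<tau>"
    and UV: "\<And>i j. i < p \<Longrightarrow> j < q \<Longrightarrow> \<bar>cov_of E (U i) (V j) - cov_of E' (U i) (V j)\<bar> \<le> \<tau>"
  shows "(max_corr E p U q V)\<^sup>2 - 8 * (\<tau> * (real (p + q) / \<delta>)) \<le> (max_corr E' p U q V)\<^sup>2"
proof -
  interpret A: functional_families E D p U q V by fact
  interpret A': functional_families E D q V p U by (rule A.swap_families)
  interpret B: functional_families E' D' p U q V by fact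
  define k where "k = 2 * (\<tau> * (real (p + q) / \<delta>))"
  have k0: "0 \<le> k" using \<delta> \<tau> by (simp add: k_def)
  have main: "A.covUV a b \<le> max_corr E' p U q V + 2 * k" if ab: "A.varU a = 1" "A.varV b = 1" for a b
  proof -
    obtain a' where a': "A.varU a' = 1" "\<And>b. A.covUV a' b = A.covUV a b" "\<delta> * (\<Sum>i<p. (a' i)\<^sup>2) \<le> 1"
      using A.center_left[OF oneU lowU, of a] ab by auto
    obtain b' where b': "A.varV b' = 1" "\<And>a. A.covUV a b' = A.covUV a b" "\<delta> * (\<Sum>i<q. (b' i)\<^sup>2) \<le> 1"
      using A'.center_left[OF oneV lowV, of b] ab A.cov_commute by metis
    have sa: "(\<Sum>i<p. (a' i)\<^sup>2) \<le> 1 / \<delta>" and sb: "(\<Sum>i<q. (b' i)\<^sup>2) \<le> 1 / \<delta>"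
      using a'(3) b'(3) \<delta> by (simp_all add: pos_le_divide_eq mult.commute)
    have pp: "\<tau> * (real (p + p) * (1 / \<delta>)) \<le> k" "\<tau> * (real (q + q) * (1 / \<delta>)) \<le> k"
      "\<tau> * (real (p + q) * (1 / \<delta>)) \<le> k"
      using \<tau> \<delta> unfolding k_def by (simp_all add: field_simps)
    have "\<bar>A.varU a' - B.varU a'\<bar> \<le> \<tau> * (real (p + p) * (1 / \<delta>))"
      unfolding A.forms B.forms
      by (rule form_perturb) (use UU \<tau> sa in auto)
    moreover have "\<bar>A.varV b' - B.varV b'\<bar> \<le> \<tau> * (real (q + q) * (1 / \<delta>))"
      unfolding A.forms B.forms
      by (rule form_perturb) (use VV \<tau> sb in auto)
    moreover have "\<bar>A.covUV a' b' - B.covUV a' b'\<bar> \<le> \<tau> * (real (p + q) * (1 / \<delta>))"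
      unfolding A.forms B.forms
      by (rule form_perturb) (use UV \<tau> sa sb in auto)
    ultimately have "\<bar>A.varU a' - B.varU a'\<bar> \<le> k" "\<bar>A.varV b' - B.varV b'\<bar> \<le> k" "\<bar>A.covUV a' b' - B.covUV a' b'\<bar> \<le> k"
      using pp by linarith+
    then have le: "B.varU a' \<le> 1 + k" "B.varV b' \<le> 1 + k" "A.covUV a' b' \<le> B.covUV a' b' + k"
      using a' b' by auto
    have r: "0 \<le> max_corr E' p U q V" "max_corr E' p U q V \<le> 1" by (rule B.max_corr_range)+
    have "B.covUV a' b' \<le> max_corr E' p U q V * (sqrt (B.varU a') * sqrt (B.varV b'))"
      using B.cov_le_max_corr[of a' b'] by (simp add: mult.assoc)
    also have "\<dots> \<le> max_corr E' p U q V * (sqrt (1 + k) * sqrt (1 + k))"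
      using le r k0 B.varU_nonneg B.varV_nonneg
      by (intro mult_left_mono mult_mono real_sqrt_le_mono) auto
    also have "\<dots> = max_corr E' p U q V + max_corr E' p U q V * k" using k0 by (simp add: distrib_left)
    also have "\<dots> \<le> max_corr E' p U q V + k" using r k0 mult_right_mono[of "max_corr E' p U q V" 1 k] by simp
    finally show ?thesis using le(3) a'(2) b'(2) by simp
  qed
  have r: "0 \<le> max_corr E p U q V" "max_corr E p U q V \<le> 1" by (rule A.max_corr_range)+
  have r': "0 \<le> max_corr E' p U q V" by (rule B.max_corr_range)
  have le: "max_corr E p U q V \<le> max_corr E' p U q V + 2 * k"
  proof (cases "(\<forall>a. A.varU a = 0) \<or> (\<forall>b. A.varV b = 0)")
    case True
    then have "max_corr E p U q V = 0" unfolding A.max_corr_eq by simp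
    then show ?thesis using r' k0 by simp
  next
    case False
    then obtain a b where "0 < A.varU a" "0 < A.varV b" by (rule A.nondegenerate)
    then show ?thesis using main A.normalized_in_corr_set[of a b] False
      by (subst A.max_corr_eq) (auto intro!: cSup_least)
  qed
  have "(max_corr E p U q V)\<^sup>2 - 4 * k \<le> (max_corr E' p U q V)\<^sup>2"
  proof (cases "max_corr E p U q V \<le> 2 * k")
    case True
    then have "(max_corr E p U q V)\<^sup>2 \<le> 1 * (2 * k)"
      unfolding power2_eq_square using r k0 by (intro mult_mono) auto
    then show ?thesis using k0 zero_le_power2[of "max_corr E' p U q V"] by linarith
  next
    case False
    then have "(max_corr E p U q V - 2 * k)\<^sup>2 \<le> (max_corr E' p U q V)\<^sup>2"
      using le by (intro power_mono) auto
    moreover have "(max_corr E p U q V - 2 * k)\<^sup>2 = (max_corr E p U q V)\<^sup>2 - 4 * (max_corr E p U q V * k) + 4 * k\<^sup>2"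
      by (simp add: power2_diff algebra_simps)
    moreover have "max_corr E p U q V * k \<le> 1 * k" using r k0 by (intro mult_right_mono) auto
    ultimately show ?thesis using zero_le_power2[of k] by linarith
  qed
  then show ?thesis by (simp add: k_def)
qed

section \<open>Kernel estimators and conditional expectations as positive functionals\<close>

lemma kernel_cexp_positive_functional:
  assumes k0: "\<And>u. 0 \<le> k0 u" and pos: "0 < (\<Sum>i<n. k0 ((1 / h) *\<^sub>R (z - zs i)))"
  shows "positive_functional (kernel_cexp k0 h n ws zs z) UNIV"
proof
  fix f g :: "'b \<Rightarrow> real" and c :: real
  show "kernel_cexp k0 h n ws zs z (\<lambda>_. 1) = 1" using pos by (simp add: kernel_cexp_def)
  show "kernel_cexp k0 h n ws zs z (\<lambda>w. f w + g w) = kernel_cexp k0 h n ws zs z f + kernel_cexp k0 h n ws zs z g"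
    by (simp add: kernel_cexp_def distrib_right sum.distrib add_divide_distrib)
  show "kernel_cexp k0 h n ws zs z (\<lambda>w. c * f w) = c * kernel_cexp k0 h n ws zs z f"
    by (simp add: kernel_cexp_def sum_distrib_left mult.assoc)
  show "0 \<le> kernel_cexp k0 h n ws zs z (\<lambda>w. f w * f w)"
    unfolding kernel_cexp_def using k0 pos by (intro divide_nonneg_pos sum_nonneg mult_nonneg_nonneg[OF zero_le_square]) auto
qed auto

definition bounded_measurable :: "'w measure \<Rightarrow> ('w \<Rightarrow> real) set" where
  "bounded_measurable \<mu> = {g \<in> borel_measurable \<mu>. \<exists>B. \<forall>v\<in>space \<mu>. \<bar>g v\<bar> \<le> B}"

text \<open>
  A conditional distribution at a single point, given by its density.
\<close>

locale density_kernel =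
  fixes \<mu> :: "'w measure" and f :: "'w \<Rightarrow> 'z \<Rightarrow> real" and z :: 'z
  assumes f_meas[measurable]: "(\<lambda>v. f v z) \<in> borel_measurable \<mu>"
    and f_nonneg: "\<And>v. v \<in> space \<mu> \<Longrightarrow> 0 \<le> f v z"
    and f_prob: "prob_space (density \<mu> (\<lambda>v. ennreal (f v z)))"
begin

lemma f_integral: "integrable \<mu> (\<lambda>v. f v z)" "(\<integral>v. f v z \<partial>\<mu>) = 1"
proof -
  have "emeasure (density \<mu> (\<lambda>v. ennreal (f v z))) (space \<mu>) = 1"
    using prob_space.emeasure_space_1[OF f_prob] by simp
  then have "(\<integral>\<^sup>+v. ennreal (f v z) * indicator (space \<mu>) v \<partial>\<mu>) = 1"
    by (subst (asm) emeasure_density) auto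
  moreover have "(\<integral>\<^sup>+v. ennreal (f v z) * indicator (space \<mu>) v \<partial>\<mu>) = (\<integral>\<^sup>+v. ennreal (f v z) \<partial>\<mu>)"
    by (intro nn_integral_cong) auto
  ultimately have "(\<integral>\<^sup>+v. ennreal (f v z) \<partial>\<mu>) = ennreal 1" by simp
  then have "has_bochner_integral \<mu> (\<lambda>v. f v z) 1"
    using f_nonneg by (intro has_bochner_integral_nn_integral) auto
  then show "integrable \<mu> (\<lambda>v. f v z)" "(\<integral>v. f v z \<partial>\<mu>) = 1"
    by (auto simp: has_bochner_integral_iff)
qed

lemma bounded_integrable:
  assumes "g \<in> bounded_measurable \<mu>" shows "integrable \<mu> (\<lambda>v. g v * f v z)"
proof -
  from assms obtain B where B: "\<And>v. v \<in> space \<mu> \<Longrightarrow> \<bar>g v\<bar> \<le> B" and [measurable]: "g \<in> borel_measurable \<mu>"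
    by (auto simp: bounded_measurable_def)
  show ?thesis
  proof (rule Bochner_Integration.integrable_bound[OF integrable_mult_right[OF f_integral(1), of "\<bar>B\<bar>"]])
    show "AE v in \<mu>. norm (g v * f v z) \<le> norm (\<bar>B\<bar> * f v z)"
    proof (rule AE_I2)
      fix v assume "v \<in> space \<mu>"
      then show "norm (g v * f v z) \<le> norm (\<bar>B\<bar> * f v z)"
        using B[of v] f_nonneg[of v] by (auto simp: abs_mult intro!: mult_right_mono)
    qed
  qed simp
qed

lemma cexp_density: "g \<in> bounded_measurable \<mu> \<Longrightarrow> cexp \<mu> f z g = (\<integral>v. g v \<partial>density \<mu> (\<lambda>v. ennreal (f v z)))"
  unfolding cexp_def
  using f_nonneg by (subst integral_density) (auto simp: bounded_measurable_def mult.commute)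

lemma cexp_abs_le:
  assumes "g \<in> borel_measurable \<mu>" "\<And>v. v \<in> space \<mu> \<Longrightarrow> \<bar>g v\<bar> \<le> B"
  shows "\<bar>cexp \<mu> f z g\<bar> \<le> B"
proof -
  have g: "g \<in> bounded_measurable \<mu>" using assms by (auto simp: bounded_measurable_def)
  have "\<bar>cexp \<mu> f z g\<bar> \<le> (\<integral>v. \<bar>g v * f v z\<bar> \<partial>\<mu>)" unfolding cexp_def by (rule integral_abs_bound)
  also have "\<dots> \<le> (\<integral>v. B * f v z \<partial>\<mu>)"
    using assms f_nonneg by (intro integral_mono integrable_abs bounded_integrable g integrable_mult_right f_integral)
      (auto simp: abs_mult intro!: mult_right_mono)
  also have "\<dots> = B" using f_integral by simp
  finally show ?thesis .
qed

lemma cexp_positive_functional: "positive_functional (cexp \<mu> f z) (bounded_measurable \<mu>)"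
proof
  show "(\<lambda>_. c) \<in> bounded_measurable \<mu>" for c by (auto simp: bounded_measurable_def)
  show "cexp \<mu> f z (\<lambda>_. 1) = 1" using f_integral by (simp add: cexp_def)
  fix g k :: "'w \<Rightarrow> real" and c :: real
  assume g: "g \<in> bounded_measurable \<mu>"
  show "cexp \<mu> f z (\<lambda>w. c * g w) = c * cexp \<mu> f z g"
    by (simp add: cexp_def mult.assoc)
  show "0 \<le> cexp \<mu> f z (\<lambda>w. g w * g w)"
    unfolding cexp_def using f_nonneg by (intro integral_nonneg_AE AE_I2) auto
  assume k: "k \<in> bounded_measurable \<mu>"
  from g k obtain B B' where B: "\<And>v. v \<in> space \<mu> \<Longrightarrow> \<bar>g v\<bar> \<le> B" "\<And>v. v \<in> space \<mu> \<Longrightarrow> \<bar>k v\<bar> \<le> B'"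
    and [measurable]: "g \<in> borel_measurable \<mu>" "k \<in> borel_measurable \<mu>"
    by (auto simp: bounded_measurable_def)
  have "\<bar>g v + k v\<bar> \<le> B + B'" if "v \<in> space \<mu>" for v using B that by (meson abs_triangle_ineq add_mono order_trans)
  then show "(\<lambda>w. g w + k w) \<in> bounded_measurable \<mu>" unfolding bounded_measurable_def by auto
  have "\<bar>g v * k v\<bar> \<le> B * B'" if "v \<in> space \<mu>" for v unfolding abs_mult
    using B[OF that] by (intro mult_mono) auto
  then show "(\<lambda>w. g w * k w) \<in> bounded_measurable \<mu>" unfolding bounded_measurable_def by auto
  show "cexp \<mu> f z (\<lambda>w. g w + k w) = cexp \<mu> f z g + cexp \<mu> f z k"
    unfolding cexp_def distrib_right using g k
    by (intro Bochner_Integration.integral_add bounded_integrable)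
qed

lemma cexp_cong: "(\<And>v. v \<in> space \<mu> \<Longrightarrow> g v = k v) \<Longrightarrow> cexp \<mu> f z g = cexp \<mu> f z k"
  unfolding cexp_def by (intro Bochner_Integration.integral_cong) auto

end

section \<open>Disintegration\<close>

locale conditional_model = prob_space M for M :: "'m measure" +
  fixes MX :: "'x measure" and X :: "'m \<Rightarrow> 'x" and MY :: "'y measure" and Y :: "'m \<Rightarrow> 'y"
    and MZ :: "'z measure" and Z :: "'m \<Rightarrow> 'z"
    and \<mu> :: "('x \<times> 'y) measure" and f :: "'x \<times> 'y \<Rightarrow> 'z \<Rightarrow> real"
  assumes X_meas[measurable]: "X \<in> measurable M MX" and Y_meas[measurable]: "Y \<in> measurable M MY"
    and Z_meas[measurable]: "Z \<in> measurable M MZ"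
    and sets_\<mu>: "sets \<mu> = sets (MX \<Otimes>\<^sub>M MY)"
    and f_meas: "\<And>z. z \<in> space MZ \<Longrightarrow> (\<lambda>v. f v z) \<in> borel_measurable \<mu>"
    and f_nonneg: "\<And>v z. v \<in> space \<mu> \<Longrightarrow> z \<in> space MZ \<Longrightarrow> 0 \<le> f v z"
    and rcd: "regular_cond_distr M (MX \<Otimes>\<^sub>M MY) (\<lambda>\<omega>. (X \<omega>, Y \<omega>)) MZ Z (\<lambda>z. density \<mu> (\<lambda>v. ennreal (f v z)))"
begin

abbreviation W where "W \<omega> \<equiv> (X \<omega>, Y \<omega>)"
abbreviation K where "K z \<equiv> density \<mu> (\<lambda>v. ennreal (f v z))"

lemma K_kernel: "K \<in> measurable MZ (prob_algebra (MX \<Otimes>\<^sub>M MY))"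
  using rcd by (simp add: regular_cond_distr_def)

lemma K_subprob[measurable]: "K \<in> measurable MZ (subprob_algebra (MX \<Otimes>\<^sub>M MY))"
  by (rule measurable_prob_algebraD[OF K_kernel])

lemma measurable_\<mu>_iff: "borel_measurable \<mu> = borel_measurable (MX \<Otimes>\<^sub>M MY)"
  by (rule measurable_cong_sets[OF sets_\<mu> refl])

lemma space_\<mu>: "space \<mu> = space MX \<times> space MY"
  using sets_eq_imp_space_eq[OF sets_\<mu>] by (simp add: space_pair_measure)

lemma Z_space: "\<omega> \<in> space M \<Longrightarrow> Z \<omega> \<in> space MZ"
  using measurable_space[OF Z_meas] .

lemma density_kernel_at:
  assumes z: "z \<in> space MZ" shows "density_kernel \<mu> f z"
proof (rule density_kernel.intro)
  have "K z \<in> space (prob_algebra (MX \<Otimes>\<^sub>M MY))" by (rule measurable_space[OF K_kernel z])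
  then show "prob_space (K z)" unfolding space_prob_algebra by blast
qed (use z f_meas f_nonneg in blast)+

text \<open>
  Both sides are integrals of \<open>F\<close>, with respect to the joint distribution of \<open>W\<close> and \<open>Z\<close> and to the
  mixture of the conditional distributions.  These measures agree on rectangles by the definition of a
  regular conditional distribution.
\<close>

lemma disintegration:
  assumes F[measurable]: "F \<in> borel_measurable ((MX \<Otimes>\<^sub>M MY) \<Otimes>\<^sub>M MZ)"
  shows "(\<integral>\<^sup>+\<omega>. F (W \<omega>, Z \<omega>) \<partial>M) = (\<integral>\<^sup>+\<omega>. (\<integral>\<^sup>+v. F (v, Z \<omega>) \<partial>K (Z \<omega>)) \<partial>M)"
proof -
  let ?N = "(MX \<Otimes>\<^sub>M MY) \<Otimes>\<^sub>M MZ"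
  let ?E = "{a \<times> b | a b. a \<in> sets (MX \<Otimes>\<^sub>M MY) \<and> b \<in> sets MZ}"
  define \<nu>1 where "\<nu>1 = distr M ?N (\<lambda>\<omega>. (W \<omega>, Z \<omega>))"
  define \<kappa> where "\<kappa> z = distr (K z) ?N (\<lambda>v. (v, z))" for z
  define \<nu>2 where "\<nu>2 = distr M MZ Z \<bind> \<kappa>"
  have \<kappa>: "\<kappa> \<in> measurable MZ (subprob_algebra ?N)"
    unfolding \<kappa>_def by (rule measurable_distr2[OF _ K_subprob]) simp
  then have \<kappa>'[measurable]: "\<kappa> \<in> measurable (distr M MZ Z) (subprob_algebra ?N)" by simp
  have ne: "space (distr M MZ Z) \<noteq> {}" using not_empty Z_space by auto
  have inner: "(\<integral>\<^sup>+x. G x \<partial>\<kappa> z) = (\<integral>\<^sup>+v. G (v, z) \<partial>K z)" if "z \<in> space MZ" "G \<in> borel_measurable ?N" for G z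
    unfolding \<kappa>_def using that sets_\<mu>
    by (subst nn_integral_distr) (auto intro!: measurable_Pair2' cong: measurable_cong_sets)
  have eq: "\<nu>1 = \<nu>2"
  proof (rule measure_eqI_generator_eq[OF Int_stable_pair_measure_generator pair_measure_closed])
    fix C assume "C \<in> ?E"
    then obtain A B where C: "C = A \<times> B" and [measurable]: "A \<in> sets (MX \<Otimes>\<^sub>M MY)" "B \<in> sets MZ" by auto
    have "emeasure \<nu>1 C = emeasure M {\<omega> \<in> space M. W \<omega> \<in> A \<and> Z \<omega> \<in> B}"
      unfolding \<nu>1_def C by (subst emeasure_distr) (auto intro!: arg_cong[where f="emeasure M"])
    also have "\<dots> = (\<integral>\<^sup>+\<omega>. indicator B (Z \<omega>) * emeasure (K (Z \<omega>)) A \<partial>M)"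
      using rcd by (simp add: regular_cond_distr_def)
    also have "\<dots> = (\<integral>\<^sup>+\<omega>. emeasure (\<kappa> (Z \<omega>)) C \<partial>M)"
    proof (rule nn_integral_cong)
      fix \<omega> assume "\<omega> \<in> space M"
      then have z: "Z \<omega> \<in> space MZ" by (rule Z_space)
      have "emeasure (\<kappa> (Z \<omega>)) C = (\<integral>\<^sup>+x. indicator C x \<partial>\<kappa> (Z \<omega>))"
        by (subst nn_integral_indicator) (auto simp: C \<kappa>_def)
      also have "\<dots> = (\<integral>\<^sup>+v. indicator C (v, Z \<omega>) \<partial>K (Z \<omega>))" by (rule inner[OF z]) (simp add: C)
      also have "\<dots> = (\<integral>\<^sup>+v. indicator B (Z \<omega>) * indicator A v \<partial>K (Z \<omega>))"
        by (intro nn_integral_cong) (auto simp: C split: split_indicator)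
      also have "\<dots> = indicator B (Z \<omega>) * emeasure (K (Z \<omega>)) A"
        using sets_\<mu> by (simp add: nn_integral_cmult_indicator)
      finally show "indicator B (Z \<omega>) * emeasure (K (Z \<omega>)) A = emeasure (\<kappa> (Z \<omega>)) C" by simp
    qed
    also have "\<dots> = (\<integral>\<^sup>+z. emeasure (\<kappa> z) C \<partial>distr M MZ Z)"
      by (rule nn_integral_distr[symmetric, OF Z_meas])
        (rule measurable_emeasure_kernel[OF \<kappa>'], simp add: C)
    also have "\<dots> = emeasure \<nu>2 C"
      unfolding \<nu>2_def by (rule emeasure_bind[OF ne \<kappa>', symmetric]) (simp add: C)
    finally show "emeasure \<nu>1 C = emeasure \<nu>2 C" .
  next
    show "sets \<nu>1 = sigma_sets (space (MX \<Otimes>\<^sub>M MY) \<times> space MZ) ?E"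
      unfolding \<nu>1_def by (simp add: sets_pair_measure)
    have "sets \<nu>2 = sets ?N" unfolding \<nu>2_def
      by (rule sets_bind[OF sets_kernel[OF \<kappa>'] ne])
    then show "sets \<nu>2 = sigma_sets (space (MX \<Otimes>\<^sub>M MY) \<times> space MZ) ?E"
      by (simp add: sets_pair_measure)
    show "range (\<lambda>_::nat. space (MX \<Otimes>\<^sub>M MY) \<times> space MZ) \<subseteq> ?E" by blast
    show "(\<Union>i::nat. space (MX \<Otimes>\<^sub>M MY) \<times> space MZ) = space (MX \<Otimes>\<^sub>M MY) \<times> space MZ" by simp
    show "emeasure \<nu>1 (space (MX \<Otimes>\<^sub>M MY) \<times> space MZ) \<noteq> \<infinity>" for i :: nat
      unfolding \<nu>1_def by (subst emeasure_distr) auto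
  qed
  have "(\<integral>\<^sup>+\<omega>. F (W \<omega>, Z \<omega>) \<partial>M) = (\<integral>\<^sup>+x. F x \<partial>\<nu>1)" unfolding \<nu>1_def by (subst nn_integral_distr) auto
  also have "\<dots> = (\<integral>\<^sup>+z. \<integral>\<^sup>+x. F x \<partial>\<kappa> z \<partial>distr M MZ Z)" unfolding eq \<nu>2_def by (rule nn_integral_bind[OF F \<kappa>'])
  also have "\<dots> = (\<integral>\<^sup>+\<omega>. \<integral>\<^sup>+x. F x \<partial>\<kappa> (Z \<omega>) \<partial>M)"
    by (rule nn_integral_distr[OF Z_meas]) measurable
  also have "\<dots> = (\<integral>\<^sup>+\<omega>. (\<integral>\<^sup>+v. F (v, Z \<omega>) \<partial>K (Z \<omega>)) \<partial>M)"
    by (intro nn_integral_cong inner Z_space F)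
  finally show ?thesis .
qed

lemma nn_integral_K:
  assumes z: "z \<in> space MZ" and g: "g \<in> bounded_measurable \<mu>" and nn: "\<And>v. v \<in> space \<mu> \<Longrightarrow> 0 \<le> g v"
  shows "(\<integral>\<^sup>+v. ennreal (g v) \<partial>K z) = ennreal (cexp \<mu> f z g)"
proof -
  interpret density_kernel \<mu> f z by (rule density_kernel_at[OF z])
  have [measurable]: "g \<in> borel_measurable \<mu>" using g by (simp add: bounded_measurable_def)
  have "(\<integral>\<^sup>+v. ennreal (g v) \<partial>K z) = (\<integral>\<^sup>+v. ennreal (f v z) * ennreal (g v) \<partial>\<mu>)"
    by (rule nn_integral_density) auto
  also have "\<dots> = (\<integral>\<^sup>+v. ennreal (g v * f v z) \<partial>\<mu>)"
    using f_nonneg nn by (intro nn_integral_cong) (simp add: ennreal_mult mult.commute)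
  also have "\<dots> = ennreal (cexp \<mu> f z g)"
    unfolding cexp_def using f_nonneg nn by (intro nn_integral_eq_integral bounded_integrable[OF g] AE_I2) auto
  finally show ?thesis .
qed

lemma cexp_measurable[measurable]:
  assumes g: "g \<in> bounded_measurable \<mu>"
  shows "(\<lambda>z. cexp \<mu> f z g) \<in> borel_measurable MZ"
proof -
  have "g \<in> borel_measurable (MX \<Otimes>\<^sub>M MY)" using g by (simp add: bounded_measurable_def measurable_\<mu>_iff)
  then have "(\<lambda>z. \<integral>v. g v \<partial>K z) \<in> borel_measurable MZ"
    by (intro measurable_compose[OF K_subprob] integral_measurable_subprob_algebra)
  moreover have "cexp \<mu> f z g = (\<integral>v. g v \<partial>K z)" if "z \<in> space MZ" for z
    by (rule density_kernel.cexp_density[OF density_kernel_at[OF that] g])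
  ultimately show ?thesis by (simp cong: measurable_cong)
qed

lemma bounded_measurable_simps:
  "g \<in> bounded_measurable \<mu> \<Longrightarrow> k \<in> bounded_measurable \<mu> \<Longrightarrow> (\<lambda>v. g v * k v) \<in> bounded_measurable \<mu>"
  "g \<in> bounded_measurable \<mu> \<Longrightarrow> k \<in> bounded_measurable \<mu> \<Longrightarrow> (\<lambda>v. g v + k v) \<in> bounded_measurable \<mu>"
proof -
  obtain z where "z \<in> space MZ" using not_empty Z_space by blast
  then interpret density_kernel \<mu> f z by (rule density_kernel_at)
  interpret positive_functional "cexp \<mu> f z" "bounded_measurable \<mu>" by (rule cexp_positive_functional)
  show "g \<in> bounded_measurable \<mu> \<Longrightarrow> k \<in> bounded_measurable \<mu> \<Longrightarrow> (\<lambda>v. g v * k v) \<in> bounded_measurable \<mu>" by (rule D_mult)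
  show "g \<in> bounded_measurable \<mu> \<Longrightarrow> k \<in> bounded_measurable \<mu> \<Longrightarrow> (\<lambda>v. g v + k v) \<in> bounded_measurable \<mu>" by (rule D_add)
qed

text \<open>
  For nonnegative \<open>g\<close> this is the disintegration formula; adding a constant reduces bounded \<open>g\<close> to that
  case.
\<close>

lemma expectation_cexp:
  assumes g: "g \<in> bounded_measurable \<mu>"
    and \<theta>[measurable]: "\<theta> \<in> borel_measurable MZ" and \<theta>0: "\<And>z. z \<in> space MZ \<Longrightarrow> 0 \<le> \<theta> z"
    and int: "integrable M (\<lambda>\<omega>. \<theta> (Z \<omega>))"
  shows "integrable M (\<lambda>\<omega>. g (W \<omega>) * \<theta> (Z \<omega>))"
    and "integrable M (\<lambda>\<omega>. cexp \<mu> f (Z \<omega>) g * \<theta> (Z \<omega>))"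
    and "expectation (\<lambda>\<omega>. g (W \<omega>) * \<theta> (Z \<omega>)) = expectation (\<lambda>\<omega>. cexp \<mu> f (Z \<omega>) g * \<theta> (Z \<omega>))"
proof -
  have W_space: "W \<omega> \<in> space \<mu>" if "\<omega> \<in> space M" for \<omega>
    using measurable_space[OF X_meas that] measurable_space[OF Y_meas that] by (simp add: space_\<mu>)
  have gW[measurable]: "(\<lambda>\<omega>. k (W \<omega>)) \<in> borel_measurable M" if "k \<in> bounded_measurable \<mu>" for k
  proof -
    have [measurable]: "k \<in> borel_measurable (MX \<Otimes>\<^sub>M MY)" using that by (simp add: bounded_measurable_def measurable_\<mu>_iff)
    show ?thesis by measurable
  qed
  have cZ[measurable]: "(\<lambda>\<omega>. cexp \<mu> f (Z \<omega>) k) \<in> borel_measurable M" if "k \<in> bounded_measurable \<mu>" for k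
    using measurable_compose[OF Z_meas cexp_measurable[OF that]] .
  have i1: "integrable M (\<lambda>\<omega>. k (W \<omega>) * \<theta> (Z \<omega>))" and i2: "integrable M (\<lambda>\<omega>. cexp \<mu> f (Z \<omega>) k * \<theta> (Z \<omega>))"
    if k: "k \<in> bounded_measurable \<mu>" for k
  proof -
    note [measurable] = gW[OF k] cZ[OF k]
    obtain B where B: "\<And>v. v \<in> space \<mu> \<Longrightarrow> \<bar>k v\<bar> \<le> B" and km: "k \<in> borel_measurable \<mu>"
      using k by (auto simp: bounded_measurable_def)
    have ib: "integrable M (\<lambda>\<omega>. B * \<theta> (Z \<omega>))" using int by simp
    have ab: "\<bar>cexp \<mu> f (Z \<omega>) k\<bar> \<le> B" "\<bar>k (W \<omega>)\<bar> \<le> B" "0 \<le> \<theta> (Z \<omega>)" if "\<omega> \<in> space M" for \<omega>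
      using density_kernel.cexp_abs_le[OF density_kernel_at[OF Z_space[OF that]] km B] B[OF W_space[OF that]]
        \<theta>0[OF Z_space[OF that]] by auto
    have bd: "norm (x * \<theta> (Z \<omega>)) \<le> norm (B * \<theta> (Z \<omega>))" if "\<bar>x\<bar> \<le> B" "0 \<le> \<theta> (Z \<omega>)" for x \<omega>
      using that by (auto simp: abs_mult intro!: mult_right_mono)
    show "integrable M (\<lambda>\<omega>. k (W \<omega>) * \<theta> (Z \<omega>))"
    proof (rule Bochner_Integration.integrable_bound[OF ib])
      show "(\<lambda>\<omega>. k (W \<omega>) * \<theta> (Z \<omega>)) \<in> borel_measurable M"
        by (intro borel_measurable_times gW[OF k] measurable_compose[OF Z_meas \<theta>])
    qed (intro AE_I2 bd ab)
    show "integrable M (\<lambda>\<omega>. cexp \<mu> f (Z \<omega>) k * \<theta> (Z \<omega>))"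
    proof (rule Bochner_Integration.integrable_bound[OF ib])
      show "(\<lambda>\<omega>. cexp \<mu> f (Z \<omega>) k * \<theta> (Z \<omega>)) \<in> borel_measurable M"
        by (intro borel_measurable_times cZ[OF k] measurable_compose[OF Z_meas \<theta>])
    qed (intro AE_I2 bd ab)
  qed
  have nneg: "expectation (\<lambda>\<omega>. k (W \<omega>) * \<theta> (Z \<omega>)) = expectation (\<lambda>\<omega>. cexp \<mu> f (Z \<omega>) k * \<theta> (Z \<omega>))"
    if k: "k \<in> bounded_measurable \<mu>" and k0: "\<And>v. v \<in> space \<mu> \<Longrightarrow> 0 \<le> k v" for k
  proof -
    have [measurable]: "k \<in> borel_measurable (MX \<Otimes>\<^sub>M MY)" using k by (simp add: bounded_measurable_def measurable_\<mu>_iff)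
    note [measurable] = gW[OF k] cZ[OF k]
    have c0: "0 \<le> cexp \<mu> f z k" if "z \<in> space MZ" for z
      unfolding cexp_def using k0 f_nonneg that by (intro integral_nonneg_AE AE_I2) auto
    have "(\<integral>\<^sup>+\<omega>. ennreal (k (W \<omega>) * \<theta> (Z \<omega>)) \<partial>M) = (\<integral>\<^sup>+\<omega>. (\<integral>\<^sup>+v. ennreal (k v * \<theta> (Z \<omega>)) \<partial>K (Z \<omega>)) \<partial>M)"
      using disintegration[of "\<lambda>x. ennreal (k (fst x) * \<theta> (snd x))"] by simp
    also have "\<dots> = (\<integral>\<^sup>+\<omega>. ennreal (cexp \<mu> f (Z \<omega>) k * \<theta> (Z \<omega>)) \<partial>M)"
    proof (rule nn_integral_cong)
      fix \<omega> assume "\<omega> \<in> space M"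
      then have z: "Z \<omega> \<in> space MZ" by (rule Z_space)
      have "(\<integral>\<^sup>+v. ennreal (k v * \<theta> (Z \<omega>)) \<partial>K (Z \<omega>)) = (\<integral>\<^sup>+v. ennreal (k v) * ennreal (\<theta> (Z \<omega>)) \<partial>K (Z \<omega>))"
        using k0 \<theta>0[OF z] by (intro nn_integral_cong) (simp add: ennreal_mult)
      also have "\<dots> = ennreal (cexp \<mu> f (Z \<omega>) k) * ennreal (\<theta> (Z \<omega>))"
        using k by (subst nn_integral_multc) (auto simp: nn_integral_K[OF z k k0] bounded_measurable_def)
      finally show "(\<integral>\<^sup>+v. ennreal (k v * \<theta> (Z \<omega>)) \<partial>K (Z \<omega>)) = ennreal (cexp \<mu> f (Z \<omega>) k * \<theta> (Z \<omega>))"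
        using c0[OF z] \<theta>0[OF z] by (simp add: ennreal_mult)
    qed
    finally have nn: "(\<integral>\<^sup>+\<omega>. ennreal (k (W \<omega>) * \<theta> (Z \<omega>)) \<partial>M)
        = (\<integral>\<^sup>+\<omega>. ennreal (cexp \<mu> f (Z \<omega>) k * \<theta> (Z \<omega>)) \<partial>M)" .
    have "expectation (\<lambda>\<omega>. k (W \<omega>) * \<theta> (Z \<omega>)) = enn2real (\<integral>\<^sup>+\<omega>. ennreal (k (W \<omega>) * \<theta> (Z \<omega>)) \<partial>M)"
      by (rule integral_eq_nn_integral[OF borel_measurable_integrable[OF i1[OF k]]])
        (intro AE_I2 mult_nonneg_nonneg k0 \<theta>0 W_space Z_space)
    moreover have "expectation (\<lambda>\<omega>. cexp \<mu> f (Z \<omega>) k * \<theta> (Z \<omega>))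
        = enn2real (\<integral>\<^sup>+\<omega>. ennreal (cexp \<mu> f (Z \<omega>) k * \<theta> (Z \<omega>)) \<partial>M)"
      by (rule integral_eq_nn_integral[OF borel_measurable_integrable[OF i2[OF k]]])
        (intro AE_I2 mult_nonneg_nonneg c0 \<theta>0 Z_space)
    ultimately show ?thesis using nn by simp
  qed
  show "integrable M (\<lambda>\<omega>. g (W \<omega>) * \<theta> (Z \<omega>))" "integrable M (\<lambda>\<omega>. cexp \<mu> f (Z \<omega>) g * \<theta> (Z \<omega>))"
    by (rule i1[OF g] i2[OF g])+
  obtain B where B: "\<And>v. v \<in> space \<mu> \<Longrightarrow> \<bar>g v\<bar> \<le> B" using g by (auto simp: bounded_measurable_def)
  have cB: "(\<lambda>_. B) \<in> bounded_measurable \<mu>" by (auto simp: bounded_measurable_def)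
  have "expectation (\<lambda>\<omega>. (g (W \<omega>) + B) * \<theta> (Z \<omega>)) = expectation (\<lambda>\<omega>. cexp \<mu> f (Z \<omega>) (\<lambda>v. g v + B) * \<theta> (Z \<omega>))"
    using B by (intro nneg bounded_measurable_simps g cB) (force simp: abs_le_iff)
  also have "\<dots> = expectation (\<lambda>\<omega>. cexp \<mu> f (Z \<omega>) g * \<theta> (Z \<omega>) + B * \<theta> (Z \<omega>))"
  proof (rule Bochner_Integration.integral_cong[OF refl])
    fix \<omega> assume "\<omega> \<in> space M"
    then interpret dk: density_kernel \<mu> f "Z \<omega>" by (intro density_kernel_at Z_space)
    interpret positive_functional "cexp \<mu> f (Z \<omega>)" "bounded_measurable \<mu>" by (rule dk.cexp_positive_functional)
    show "cexp \<mu> f (Z \<omega>) (\<lambda>v. g v + B) * \<theta> (Z \<omega>) = cexp \<mu> f (Z \<omega>) g * \<theta> (Z \<omega>) + B * \<theta> (Z \<omega>)"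
      using g cB by (simp add: E_add E_const distrib_right)
  qed
  finally show "expectation (\<lambda>\<omega>. g (W \<omega>) * \<theta> (Z \<omega>)) = expectation (\<lambda>\<omega>. cexp \<mu> f (Z \<omega>) g * \<theta> (Z \<omega>))"
    using i1[OF g] i2[OF g] int by (simp add: distrib_right)
qed

lemma real_cond_exp_cexp:
  assumes g: "g \<in> bounded_measurable \<mu>"
  shows "AE \<omega> in M. real_cond_exp M (vimage_algebra (space M) Z MZ) (\<lambda>\<omega>. g (W \<omega>)) \<omega> = cexp \<mu> f (Z \<omega>) g"
proof -
  let ?G = "vimage_algebra (space M) Z MZ"
  have Zf: "Z \<in> space M \<rightarrow> space MZ" using Z_space by auto
  have "Z -` B \<inter> space M \<in> sets M" if "B \<in> sets MZ" for B
    by (rule measurable_sets[OF Z_meas that])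
  then have "subalgebra M ?G"
    unfolding subalgebra_def sets_vimage_algebra2[OF Zf] by auto
  then interpret finite_measure_subalgebra M ?G by unfold_locales
  have "integrable M (\<lambda>\<omega>. g (W \<omega>) * (\<lambda>_. 1) (Z \<omega>))" "integrable M (\<lambda>\<omega>. cexp \<mu> f (Z \<omega>) g * (\<lambda>_. 1) (Z \<omega>))"
    by (rule expectation_cexp(1)[OF g] expectation_cexp(2)[OF g]; simp)+
  then have i: "integrable M (\<lambda>\<omega>. g (W \<omega>))" "integrable M (\<lambda>\<omega>. cexp \<mu> f (Z \<omega>) g)"
    by simp_all
  show ?thesis
  proof (rule real_cond_exp_charact[OF _ i])
    fix A assume "A \<in> sets ?G"
    then obtain B where A: "A = Z -` B \<inter> space M" and [measurable]: "B \<in> sets MZ"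
      unfolding sets_vimage_algebra2[OF Zf] by blast
    have "integrable M (\<lambda>\<omega>. indicator B (Z \<omega>) :: real)"
      by (rule integrable_const_bound[where B=1]) simp_all
    then have ex: "expectation (\<lambda>\<omega>. g (W \<omega>) * indicator B (Z \<omega>)) = expectation (\<lambda>\<omega>. cexp \<mu> f (Z \<omega>) g * indicator B (Z \<omega>))"
      by (intro expectation_cexp(3)[OF g] borel_measurable_indicator) auto
    have st: "(\<integral>\<omega>\<in>A. k \<omega> \<partial>M) = expectation (\<lambda>\<omega>. k \<omega> * indicator B (Z \<omega>))" for k :: "'m \<Rightarrow> real"
      unfolding set_lebesgue_integral_def A by (intro Bochner_Integration.integral_cong) (simp_all add: indicator_def)
    show "(\<integral>\<omega>\<in>A. g (W \<omega>) \<partial>M) = (\<integral>\<omega>\<in>A. cexp \<mu> f (Z \<omega>) g \<partial>M)"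
      unfolding st by (rule ex)
  next
    show "(\<lambda>\<omega>. cexp \<mu> f (Z \<omega>) g) \<in> borel_measurable ?G"
      by (rule measurable_compose[OF measurable_vimage_algebra1[OF Zf] cexp_measurable[OF g]])
  qed
qed

end

section \<open>The maximal correlation under conditional dependence\<close>

text \<open>
  Replace \<open>f\<close> and \<open>g\<close> by the combinations \<open>F\<close> and \<open>G\<close> one after the other.  The covariance of \<open>F\<close> and
  \<open>G\<close> is at most \<open>max_corr\<close> times the product of their standard deviations, and the remainders \<open>r\<close>, \<open>s\<close>
  enter through their standard deviations.  The inequality \<open>2 x \<le> x\<^sup>2 / t + t\<close> then leaves squares only,
  so that the bound can be integrated over \<open>z\<close> with mean square information alone.
\<close>

lemma (in functional_families) cov_le_approximation:
  fixes a b :: "nat \<Rightarrow> real"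
  assumes f: "f \<in> D" "cov_of E f f \<le> 1" and g: "g \<in> D" "cov_of E g g \<le> 1" and t: "0 < t"
  defines "u2 \<equiv> E (\<lambda>w. (f w - lincomb p a U w)\<^sup>2)" and "v2 \<equiv> E (\<lambda>w. (g w - lincomb q b V w)\<^sup>2)"
  shows "\<bar>cov_of E f g\<bar> \<le> (max_corr E p U q V)\<^sup>2 / t + 3 * t + (1 / t + 1) * (u2 + v2)"
proof -
  define mc where "mc = max_corr E p U q V"
  define F G where "F = lincomb p a U" and "G = lincomb q b V"
  define r s where "r = (\<lambda>w. f w + - 1 * F w)" and "s = (\<lambda>w. g w + - 1 * G w)"
  have FD: "F \<in> D" and GD: "G \<in> D" unfolding F_def G_def by (intro D_lincomb U_D V_D; assumption)+
  have rD: "r \<in> D" and sD: "s \<in> D" unfolding r_def s_def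
    by (rule D_add[OF f(1) D_scale[OF FD]], rule D_add[OF g(1) D_scale[OF GD]])
  define u v where "u = sqrt u2" and "v = sqrt v2"
  have u2: "u2 = E (\<lambda>w. r w * r w)" and v2: "v2 = E (\<lambda>w. s w * s w)"
    unfolding u2_def v2_def r_def s_def F_def G_def power2_eq_square by simp_all
  have nn: "0 \<le> u2" "0 \<le> v2" unfolding u2 v2 using E_square rD sD by auto
  have sdr: "sqrt (cov_of E r r) \<le> u" and sds: "sqrt (cov_of E s s) \<le> v"
    unfolding u_def v_def u2 v2 using var_le_square rD sD by (auto intro: real_sqrt_le_mono)
  have sdf: "sqrt (cov_of E f f) \<le> 1" and sdg: "sqrt (cov_of E g g) \<le> 1" using f g by auto
  have uv: "0 \<le> u" "0 \<le> v" "u\<^sup>2 = u2" "v\<^sup>2 = v2" using nn by (auto simp: u_def v_def)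
  have neg: "sqrt (cov_of E (\<lambda>w. - 1 * k w) (\<lambda>w. - 1 * k w)) = sqrt (cov_of E k k)" if "k \<in> D" for k
    by (simp add: cov_of_def E_scale[OF that, of "- 1", simplified])
  have Feq: "F = (\<lambda>w. f w + - 1 * r w)" and Geq: "G = (\<lambda>w. g w + - 1 * s w)"
    by (simp_all add: r_def s_def)
  have sdF: "sqrt (cov_of E F F) \<le> 1 + u"
    using sd_triangle[OF f(1) D_scale[OF rD, of "- 1"]] neg[OF rD] sdf sdr unfolding Feq by linarith
  have sdG: "sqrt (cov_of E G G) \<le> 1 + v"
    using sd_triangle[OF g(1) D_scale[OF sD, of "- 1"]] neg[OF sD] sdg sds unfolding Geq by linarith
  have feq: "f = (\<lambda>w. F w + r w)" and geq: "g = (\<lambda>w. G w + s w)" by (simp_all add: r_def s_def)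
  have "cov_of E f g = cov_of E F g + cov_of E r g"
    by (subst feq) (rule cov_add_left[OF FD rD g(1)])
  also have "cov_of E F g = cov_of E G F + cov_of E s F"
    unfolding cov_commute[of F g] by (subst geq) (rule cov_add_left[OF GD sD FD])
  finally have split: "cov_of E f g = cov_of E F G + cov_of E F s + cov_of E r g"
    using cov_commute[of G F] cov_commute[of s F] by linarith
  have mc: "0 \<le> mc" "mc \<le> 1" unfolding mc_def by (rule max_corr_range)+
  have "\<bar>cov_of E F G\<bar> \<le> mc * (sqrt (cov_of E F F) * sqrt (cov_of E G G))"
    using abs_cov_le_max_corr[of a b] by (simp add: mc_def F_def G_def mult.assoc)
  also have "\<dots> \<le> mc * ((1 + u) * (1 + v))"
    using mc sdF sdG uv var_nonneg[OF FD] var_nonneg[OF GD] by (intro mult_left_mono mult_mono) auto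
  also have "\<dots> = mc + mc * (u + v + u * v)" by (simp add: algebra_simps)
  also have "\<dots> \<le> mc + 1 * (u + v + u * v)" using mc uv by (intro add_left_mono mult_right_mono) auto
  finally have 1: "\<bar>cov_of E F G\<bar> \<le> mc + u + v + u * v" by simp
  have "\<bar>cov_of E F s\<bar> \<le> sqrt (cov_of E F F) * sqrt (cov_of E s s)"
    by (rule cov_Cauchy_Schwarz(2)[OF FD sD])
  also have "\<dots> \<le> (1 + u) * v" using sdF sds uv var_nonneg[OF FD] var_nonneg[OF sD] by (intro mult_mono) auto
  finally have 2: "\<bar>cov_of E F s\<bar> \<le> v + u * v" by (simp add: algebra_simps)
  have "\<bar>cov_of E r g\<bar> \<le> sqrt (cov_of E r r) * sqrt (cov_of E g g)"
    by (rule cov_Cauchy_Schwarz(2)[OF rD g(1)])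
  also have "\<dots> \<le> u * 1" using sdr sdg uv var_nonneg[OF rD] var_nonneg[OF g(1)] by (intro mult_mono) auto
  finally have 3: "\<bar>cov_of E r g\<bar> \<le> u" by simp
  have amgm: "2 * x \<le> x\<^sup>2 / t + t" for x
  proof -
    have "0 \<le> (x - t)\<^sup>2 / t" using t by simp
    also have "\<dots> = x\<^sup>2 / t - 2 * x + t" using t by (simp add: power2_eq_square field_simps)
    finally show ?thesis by simp
  qed
  have "mc \<le> mc\<^sup>2 / t + t" using amgm[of mc] mc by linarith
  moreover have "2 * (u * v) \<le> u2 + v2" using sum_squares_bound[of u v] uv by (simp add: mult.assoc)
  moreover have "2 * u \<le> u2 / t + t" "2 * v \<le> v2 / t + t" using amgm[of u] amgm[of v] uv by auto
  moreover have "(1 / t + 1) * (u2 + v2) = u2 / t + v2 / t + u2 + v2" by (simp add: algebra_simps add_divide_distrib)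
  ultimately show ?thesis using 1 2 3 split unfolding mc_def[symmetric] by linarith
qed

text \<open>
  As \<open>L'\<close> is infinite, the limit along \<open>L \<times> L'\<close> provides a single large \<open>r\<close> that serves all large \<open>p\<close>.
\<close>

lemma tensor_complete_approx:
  assumes tc: "tensor_complete M MX X MZ Z L \<phi> L' \<theta>" and "infinite L'"
    and "\<alpha> \<in> borel_measurable (MX \<Otimes>\<^sub>M MZ)" "integrable M (\<lambda>\<omega>. (\<alpha> (X \<omega>, Z \<omega>))\<^sup>2)" and e: "0 < e"
  shows "\<exists>N. \<forall>p\<in>L. N \<le> p \<longrightarrow> (\<exists>r\<in>L'. \<exists>a :: nat \<Rightarrow> nat \<Rightarrow> real.
    (\<integral>\<^sup>+\<omega>. ennreal ((\<alpha> (X \<omega>, Z \<omega>) - (\<Sum>i<p. \<Sum>k<r. a i k * \<phi> p i (X \<omega>) * \<theta> r k (Z \<omega>)))\<^sup>2) \<partial>M) < e)"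
proof -
  let ?I = "\<lambda>p r. INF a :: nat \<Rightarrow> nat \<Rightarrow> real.
    \<integral>\<^sup>+\<omega>. ennreal ((\<alpha> (X \<omega>, Z \<omega>) - (\<Sum>i<p. \<Sum>k<r. a i k * \<phi> p i (X \<omega>) * \<theta> r k (Z \<omega>)))\<^sup>2) \<partial>M"
  have "((\<lambda>(p, r). ?I p r) \<longlongrightarrow> 0) (prod_filter (inf at_top (principal L)) (inf at_top (principal L')))"
    using tc assms(3,4) unfolding tensor_complete_def by blast
  then have "eventually (\<lambda>x. (case x of (p, r) \<Rightarrow> ?I p r) < e) (prod_filter (inf at_top (principal L)) (inf at_top (principal L')))"
    using e by (rule order_tendstoD(2))
  then obtain P Q where P: "eventually P (inf at_top (principal L))" and Q: "eventually Q (inf at_top (principal L'))"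
    and PQ: "\<And>p r. P p \<Longrightarrow> Q r \<Longrightarrow> ?I p r < e"
    unfolding eventually_prod_filter by auto
  obtain N where N: "\<And>p. N \<le> p \<Longrightarrow> p \<in> L \<Longrightarrow> P p"
    using P unfolding eventually_inf_principal eventually_at_top_linorder by blast
  obtain N' where N': "\<And>r. N' \<le> r \<Longrightarrow> r \<in> L' \<Longrightarrow> Q r"
    using Q unfolding eventually_inf_principal eventually_at_top_linorder by blast
  obtain r where r: "r \<in> L'" "N' \<le> r"
    using \<open>infinite L'\<close> unfolding infinite_nat_iff_unbounded_le by blast
  show ?thesis
  proof (intro exI[of _ N] ballI impI)
    fix p assume "p \<in> L" "N \<le> p"
    then have "?I p r < e" using N N' r by (intro PQ) auto
    then show "\<exists>r\<in>L'. \<exists>a :: nat \<Rightarrow> nat \<Rightarrow> real.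
      (\<integral>\<^sup>+\<omega>. ennreal ((\<alpha> (X \<omega>, Z \<omega>) - (\<Sum>i<p. \<Sum>k<r. a i k * \<phi> p i (X \<omega>) * \<theta> r k (Z \<omega>)))\<^sup>2) \<partial>M) < e"
      using r(1) unfolding INF_less_iff by blast
  qed
qed

context conditional_model
begin

lemma families_at:
  assumes "z \<in> space MZ" "\<And>i. i < p \<Longrightarrow> U i \<in> bounded_measurable \<mu>" "\<And>j. j < q \<Longrightarrow> V j \<in> bounded_measurable \<mu>"
  shows "functional_families (cexp \<mu> f z) (bounded_measurable \<mu>) p U q V"
  unfolding functional_families_def functional_families_axioms_def
  using assms density_kernel.cexp_positive_functional[OF density_kernel_at] by blast

lemma cov_measurable:
  assumes "g \<in> bounded_measurable \<mu>" "k \<in> bounded_measurable \<mu>"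
  shows "(\<lambda>z. cov_of (cexp \<mu> f z) g k) \<in> borel_measurable MZ"
  unfolding cov_of_def using assms
  by (intro borel_measurable_diff borel_measurable_times cexp_measurable bounded_measurable_simps)

lemma max_corr_cexp_measurable:
  assumes "\<And>i. i < p \<Longrightarrow> U i \<in> bounded_measurable \<mu>" "\<And>j. j < q \<Longrightarrow> V j \<in> bounded_measurable \<mu>"
  shows "(\<lambda>z. max_corr (cexp \<mu> f z) p U q V) \<in> borel_measurable MZ"
  by (rule max_corr_measurable[where good="\<lambda>_. True" and D="\<lambda>_. bounded_measurable \<mu>"])
    (use assms in \<open>auto intro!: cov_measurable families_at\<close>)

lemma fst_bounded_measurable:
  assumes "g \<in> borel_measurable MX" "\<And>x. x \<in> space MX \<Longrightarrow> \<bar>g x\<bar> \<le> B"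
  shows "(\<lambda>w. g (fst w)) \<in> bounded_measurable \<mu>"
  unfolding bounded_measurable_def measurable_\<mu>_iff space_\<mu> using assms
  by (auto intro!: measurable_compose[OF measurable_fst] exI[of _ B])

lemma snd_bounded_measurable:
  assumes "g \<in> borel_measurable MY" "\<And>y. y \<in> space MY \<Longrightarrow> \<bar>g y\<bar> \<le> B"
  shows "(\<lambda>w. g (snd w)) \<in> bounded_measurable \<mu>"
  unfolding bounded_measurable_def measurable_\<mu>_iff space_\<mu> using assms
  by (auto intro!: measurable_compose[OF measurable_snd] exI[of _ B])

lemma cond_cov_nonzero:
  assumes "\<not> cond_indep M MX X MY Y MZ Z"
  shows "\<exists>A\<in>sets MX. \<exists>B\<in>sets MY.
    \<not> (AE \<omega> in M. cov_of (cexp \<mu> f (Z \<omega>)) (\<lambda>w. indicator A (fst w)) (\<lambda>w. indicator B (snd w)) = 0)"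
proof (rule ccontr)
  assume contra: "\<not> ?thesis"
  have "cond_indep M MX X MY Y MZ Z"
    unfolding cond_indep_def Let_def
  proof (intro ballI)
    fix A B assume A: "A \<in> sets MX" and B: "B \<in> sets MY"
    let ?G = "vimage_algebra (space M) Z MZ"
    let ?g = "\<lambda>w::'x \<times> 'y. indicator A (fst w) :: real" and ?k = "\<lambda>w::'x \<times> 'y. indicator B (snd w) :: real"
    have g: "?g \<in> bounded_measurable \<mu>" using A by (intro fst_bounded_measurable[where B=1]) auto
    have k: "?k \<in> bounded_measurable \<mu>" using B by (intro snd_bounded_measurable[where B=1]) auto
    have "AE \<omega> in M. cov_of (cexp \<mu> f (Z \<omega>)) ?g ?k = 0" using contra A B by blast
    then show "AE \<omega> in M. real_cond_exp M ?G (\<lambda>\<omega>. indicator A (X \<omega>) * indicator B (Y \<omega>)) \<omega>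
          = real_cond_exp M ?G (\<lambda>\<omega>. indicator A (X \<omega>)) \<omega> * real_cond_exp M ?G (\<lambda>\<omega>. indicator B (Y \<omega>)) \<omega>"
      using real_cond_exp_cexp[OF bounded_measurable_simps(1)[OF g k]] real_cond_exp_cexp[OF g] real_cond_exp_cexp[OF k]
      by eventually_elim (simp add: cov_of_def)
  qed
  then show False using assms by simp
qed

text \<open>
  For fixed \<open>z\<close> the factors \<open>\<theta> r k z\<close> are constants and can be absorbed in the coefficients, which gives
  the combinations \<open>az z\<close> and \<open>bz z\<close> of the basis functions.  Integrating \<open>cov_le_approximation\<close> over the
  distribution of \<open>Z\<close> bounds the mean absolute conditional covariance \<open>I > 0\<close> of the indicators by
  \<open>E \<rho>\<^sup>2(Z) / t\<close> plus terms that the choice of \<open>t\<close> and \<open>e\<close> makes equal to \<open>I / 2\<close>.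
\<close>

lemma rho_bounded_below:
  fixes \<phi> :: "nat \<Rightarrow> nat \<Rightarrow> 'x \<Rightarrow> real" and \<psi> :: "nat \<Rightarrow> nat \<Rightarrow> 'y \<Rightarrow> real" and \<theta> :: "nat \<Rightarrow> nat \<Rightarrow> 'z \<Rightarrow> real"
  assumes \<phi>: "\<And>p i. p \<in> L1 \<Longrightarrow> i < p \<Longrightarrow> \<phi> p i \<in> borel_measurable MX"
      "\<And>p i x. p \<in> L1 \<Longrightarrow> i < p \<Longrightarrow> x \<in> space MX \<Longrightarrow> \<bar>\<phi> p i x\<bar> \<le> 1"
    and \<psi>: "\<And>q j. q \<in> L2 \<Longrightarrow> j < q \<Longrightarrow> \<psi> q j \<in> borel_measurable MY"
      "\<And>q j y. q \<in> L2 \<Longrightarrow> j < q \<Longrightarrow> y \<in> space MY \<Longrightarrow> \<bar>\<psi> q j y\<bar> \<le> 1"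
    and \<theta>: "\<And>r k. r \<in> L3 \<Longrightarrow> k < r \<Longrightarrow> \<theta> r k \<in> borel_measurable MZ"
    and "infinite L3"
    and tc: "tensor_complete M MX X MZ Z L1 \<phi> L3 \<theta>" "tensor_complete M MY Y MZ Z L2 \<psi> L3 \<theta>"
    and dep: "\<not> cond_indep M MX X MY Y MZ Z"
  shows "\<exists>c>0. \<exists>N. \<forall>p\<in>L1. \<forall>q\<in>L2. N \<le> p \<longrightarrow> N \<le> q \<longrightarrow>
    c \<le> expectation (\<lambda>\<omega>. (rho \<phi> \<psi> p q (cexp \<mu> f (Z \<omega>)))\<^sup>2)"
proof -
  obtain A B where [measurable]: "A \<in> sets MX" "B \<in> sets MY"
    and nz: "\<not> (AE \<omega> in M. cov_of (cexp \<mu> f (Z \<omega>)) (\<lambda>w. indicator A (fst w)) (\<lambda>w. indicator B (snd w)) = 0)"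
    using cond_cov_nonzero[OF dep] by blast
  define g k where "g = (\<lambda>w::'x \<times> 'y. indicator A (fst w) :: real)" and "k = (\<lambda>w::'x \<times> 'y. indicator B (snd w) :: real)"
  have g: "g \<in> bounded_measurable \<mu>" unfolding g_def by (intro fst_bounded_measurable[where B=1]) auto
  have k: "k \<in> bounded_measurable \<mu>" unfolding k_def by (intro snd_bounded_measurable[where B=1]) auto
  define c where "c z = cov_of (cexp \<mu> f z) g k" for z
  have c_meas: "c \<in> borel_measurable MZ" unfolding c_def by (rule cov_measurable[OF g k])
  have cZ[measurable]: "(\<lambda>\<omega>. c (Z \<omega>)) \<in> borel_measurable M" by (rule measurable_compose[OF Z_meas c_meas])
  have var1: "cov_of (cexp \<mu> f z) h h \<le> 1"
    if "z \<in> space MZ" "h \<in> bounded_measurable \<mu>" "\<And>w. \<bar>h w\<bar> \<le> 1" for z h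
  proof -
    interpret dk: density_kernel \<mu> f z by (rule density_kernel_at) fact
    interpret positive_functional "cexp \<mu> f z" "bounded_measurable \<mu>" by (rule dk.cexp_positive_functional)
    have "\<bar>h w * h w\<bar> \<le> 1" for w using mult_mono[OF that(3) that(3), of w w] by (simp add: abs_mult)
    then have "\<bar>cexp \<mu> f z (\<lambda>w. h w * h w)\<bar> \<le> 1"
      using D_mult[OF that(2,2)] by (intro dk.cexp_abs_le) (auto simp: bounded_measurable_def)
    then show ?thesis using var_le_square[OF that(2)] by simp
  qed
  have g1: "\<bar>g w\<bar> \<le> 1" and k1: "\<bar>k w\<bar> \<le> 1" for w by (simp_all add: g_def k_def)
  have cb: "\<bar>c z\<bar> \<le> 1" if z: "z \<in> space MZ" for z
  proof -
    interpret positive_functional "cexp \<mu> f z" "bounded_measurable \<mu>"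
      by (rule density_kernel.cexp_positive_functional[OF density_kernel_at[OF z]])
    have "\<bar>c z\<bar> \<le> sqrt (cov_of (cexp \<mu> f z) g g) * sqrt (cov_of (cexp \<mu> f z) k k)"
      unfolding c_def by (rule cov_Cauchy_Schwarz(2)[OF g k])
    also have "\<dots> \<le> 1 * 1" using var1[OF z g g1] var1[OF z k k1] var_nonneg[OF k] by (intro mult_mono) auto
    finally show ?thesis by simp
  qed
  have ic: "integrable M (\<lambda>\<omega>. \<bar>c (Z \<omega>)\<bar>)"
    by (rule integrable_const_bound[where B=1]) (use cb Z_space in auto)
  define I where "I = expectation (\<lambda>\<omega>. \<bar>c (Z \<omega>)\<bar>)"
  have "I \<noteq> 0" using nz integral_nonneg_eq_0_iff_AE[OF ic] by (simp add: I_def c_def g_def k_def)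
  moreover have "0 \<le> I" unfolding I_def by simp
  ultimately have I: "0 < I" by simp
  define t where "t = I / 12"
  have t: "0 < t" using I by (simp add: t_def)
  define e where "e = I / (8 * (1 / t + 1))"
  have t1: "0 < 1 / t + 1" using t by (simp add: add_pos_pos)
  have e: "0 < e" unfolding e_def using I t1 by simp
  have int1: "integrable M (\<lambda>\<omega>. (indicator A (X \<omega>))\<^sup>2 :: real)" "integrable M (\<lambda>\<omega>. (indicator B (Y \<omega>))\<^sup>2 :: real)"
    by (rule integrable_const_bound[where B=1]; simp add: power_le_one)+
  have e': "0 < ennreal e" using e by simp
  obtain N1 where N1: "\<And>p. p \<in> L1 \<Longrightarrow> N1 \<le> p \<Longrightarrow> \<exists>r\<in>L3. \<exists>a :: nat \<Rightarrow> nat \<Rightarrow> real.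
    (\<integral>\<^sup>+\<omega>. ennreal ((indicator A (X \<omega>) - (\<Sum>i<p. \<Sum>k<r. a i k * \<phi> p i (X \<omega>) * \<theta> r k (Z \<omega>)))\<^sup>2) \<partial>M) < ennreal e"
    using tensor_complete_approx[OF tc(1) \<open>infinite L3\<close>, of "\<lambda>x. indicator A (fst x)", OF _ _ e'] int1 by auto
  obtain N2 where N2: "\<And>q. q \<in> L2 \<Longrightarrow> N2 \<le> q \<Longrightarrow> \<exists>r\<in>L3. \<exists>b :: nat \<Rightarrow> nat \<Rightarrow> real.
    (\<integral>\<^sup>+\<omega>. ennreal ((indicator B (Y \<omega>) - (\<Sum>j<q. \<Sum>k<r. b j k * \<psi> q j (Y \<omega>) * \<theta> r k (Z \<omega>)))\<^sup>2) \<partial>M) < ennreal e"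
    using tensor_complete_approx[OF tc(2) \<open>infinite L3\<close>, of "\<lambda>x. indicator B (fst x)", OF _ _ e'] int1 by auto
  have "t * I / 2 \<le> expectation (\<lambda>\<omega>. (rho \<phi> \<psi> p q (cexp \<mu> f (Z \<omega>)))\<^sup>2)"
    if p: "p \<in> L1" "N1 \<le> p" and q: "q \<in> L2" "N2 \<le> q" for p q
  proof -
    define U V where "U = (\<lambda>i (w :: 'x \<times> 'y). \<phi> p i (fst w))" and "V = (\<lambda>j (w :: 'x \<times> 'y). \<psi> q j (snd w))"
    have U: "U i \<in> bounded_measurable \<mu>" if "i < p" for i
      unfolding U_def using \<phi>[OF p(1) that] by (intro fst_bounded_measurable) auto
    have V: "V j \<in> bounded_measurable \<mu>" if "j < q" for j
      unfolding V_def using \<psi>[OF q(1) that] by (intro snd_bounded_measurable) auto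
    define R where "R z = max_corr (cexp \<mu> f z) p U q V" for z
    have rhoR: "rho \<phi> \<psi> p q (cexp \<mu> f z) = R z" for z by (simp add: rho_def R_def U_def V_def)
    have R_meas: "R \<in> borel_measurable MZ" unfolding R_def by (rule max_corr_cexp_measurable[OF U V])
    have RZ[measurable]: "(\<lambda>\<omega>. R (Z \<omega>)) \<in> borel_measurable M" by (rule measurable_compose[OF Z_meas R_meas])
    have R01: "0 \<le> R z" "R z \<le> 1" if "z \<in> space MZ" for z
      unfolding R_def using functional_families.max_corr_range[OF families_at[OF that U V]] by auto
    have iR: "integrable M (\<lambda>\<omega>. (R (Z \<omega>))\<^sup>2)"
      by (rule integrable_const_bound[where B=1]) (use R01 Z_space in \<open>auto simp: power_le_one\<close>)
    obtain r a where r: "r \<in> L3" and ra: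
      "(\<integral>\<^sup>+\<omega>. ennreal ((indicator A (X \<omega>) - (\<Sum>i<p. \<Sum>k<r. a i k * \<phi> p i (X \<omega>) * \<theta> r k (Z \<omega>)))\<^sup>2) \<partial>M) < ennreal e"
      using N1[OF p] by blast
    obtain s b where s: "s \<in> L3" and sb:
      "(\<integral>\<^sup>+\<omega>. ennreal ((indicator B (Y \<omega>) - (\<Sum>j<q. \<Sum>k<s. b j k * \<psi> q j (Y \<omega>) * \<theta> s k (Z \<omega>)))\<^sup>2) \<partial>M) < ennreal e"
      using N2[OF q] by blast
    define az where "az z i = (\<Sum>k<r. a i k * \<theta> r k z)" for z i
    define bz where "bz z j = (\<Sum>k<s. b j k * \<theta> s k z)" for z j
    define F where "F x = ennreal ((g (fst x) - lincomb p (az (snd x)) U (fst x))\<^sup>2)" for x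
    define G where "G x = ennreal ((k (fst x) - lincomb q (bz (snd x)) V (fst x))\<^sup>2)" for x
    have m1: "(\<lambda>x. h (fst x)) \<in> borel_measurable ((MX \<Otimes>\<^sub>M MY) \<Otimes>\<^sub>M MZ)" if "h \<in> bounded_measurable \<mu>" for h :: "_ \<Rightarrow> real"
      using that by (intro measurable_compose[OF measurable_fst]) (simp add: bounded_measurable_def measurable_\<mu>_iff)
    have m2: "(\<lambda>x. \<theta> r k (snd x)) \<in> borel_measurable ((MX \<Otimes>\<^sub>M MY) \<Otimes>\<^sub>M MZ)" if "r \<in> L3" "k < r" for r k
      using \<theta>[OF that] by (intro measurable_compose[OF measurable_snd])
    have F_meas: "F \<in> borel_measurable ((MX \<Otimes>\<^sub>M MY) \<Otimes>\<^sub>M MZ)"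
      unfolding F_def lincomb_def az_def
      by (intro measurable_compose[OF _ measurable_ennreal] borel_measurable_power borel_measurable_diff
          borel_measurable_sum borel_measurable_times borel_measurable_const m1 m2 g U r) auto
    have G_meas: "G \<in> borel_measurable ((MX \<Otimes>\<^sub>M MY) \<Otimes>\<^sub>M MZ)"
      unfolding G_def lincomb_def bz_def
      by (intro measurable_compose[OF _ measurable_ennreal] borel_measurable_power borel_measurable_diff
          borel_measurable_sum borel_measurable_times borel_measurable_const m1 m2 k V s) auto
    define u where "u \<omega> = (\<integral>\<^sup>+v. F (v, Z \<omega>) \<partial>K (Z \<omega>))" for \<omega>
    define v where "v \<omega> = (\<integral>\<^sup>+v. G (v, Z \<omega>) \<partial>K (Z \<omega>))" for \<omega>
    have swap: "(\<lambda>(z, v). H (v, z)) \<in> borel_measurable (MZ \<Otimes>\<^sub>M (MX \<Otimes>\<^sub>M MY))"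
      if "H \<in> borel_measurable ((MX \<Otimes>\<^sub>M MY) \<Otimes>\<^sub>M MZ)" for H :: "_ \<Rightarrow> ennreal"
      using measurable_compose[OF measurable_pair_swap' that] by (simp add: case_prod_unfold)
    have uv_meas[measurable]: "u \<in> borel_measurable M" "v \<in> borel_measurable M"
      unfolding u_def v_def
      using measurable_compose[OF Z_meas nn_integral_measurable_subprob_algebra2[OF swap[OF F_meas] K_subprob]]
        measurable_compose[OF Z_meas nn_integral_measurable_subprob_algebra2[OF swap[OF G_meas] K_subprob]] by auto
    have ue: "(\<integral>\<^sup>+\<omega>. u \<omega> \<partial>M) \<le> ennreal e"
    proof -
      have "(\<integral>\<^sup>+\<omega>. u \<omega> \<partial>M) = (\<integral>\<^sup>+\<omega>. F (W \<omega>, Z \<omega>) \<partial>M)" unfolding u_def by (rule disintegration[OF F_meas, symmetric])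
      also have "\<dots> = (\<integral>\<^sup>+\<omega>. ennreal ((indicator A (X \<omega>) - (\<Sum>i<p. \<Sum>k<r. a i k * \<phi> p i (X \<omega>) * \<theta> r k (Z \<omega>)))\<^sup>2) \<partial>M)"
        by (simp add: F_def g_def lincomb_def az_def U_def sum_distrib_left sum_distrib_right mult_ac)
      finally show ?thesis using ra by simp
    qed
    have ve: "(\<integral>\<^sup>+\<omega>. v \<omega> \<partial>M) \<le> ennreal e"
    proof -
      have "(\<integral>\<^sup>+\<omega>. v \<omega> \<partial>M) = (\<integral>\<^sup>+\<omega>. G (W \<omega>, Z \<omega>) \<partial>M)" unfolding v_def by (rule disintegration[OF G_meas, symmetric])
      also have "\<dots> = (\<integral>\<^sup>+\<omega>. ennreal ((indicator B (Y \<omega>) - (\<Sum>j<q. \<Sum>k<s. b j k * \<psi> q j (Y \<omega>) * \<theta> s k (Z \<omega>)))\<^sup>2) \<partial>M)"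
        by (simp add: G_def k_def lincomb_def bz_def V_def sum_distrib_left sum_distrib_right mult_ac)
      finally show ?thesis using sb by simp
    qed
    have pw: "ennreal \<bar>c (Z \<omega>)\<bar> \<le> ennreal ((R (Z \<omega>))\<^sup>2 / t + 3 * t) + ennreal (1 / t + 1) * (u \<omega> + v \<omega>)"
      if "\<omega> \<in> space M" for \<omega>
    proof -
      have z: "Z \<omega> \<in> space MZ" using that by (rule Z_space)
      interpret functional_families "cexp \<mu> f (Z \<omega>)" "bounded_measurable \<mu>" p U q V
        by (rule families_at[OF z U V])
      let ?d = "\<lambda>w. g w - lincomb p (az (Z \<omega>)) U w" and ?d' = "\<lambda>w. k w - lincomb q (bz (Z \<omega>)) V w"
      have sq: "(\<lambda>w. (h w - l w)\<^sup>2) \<in> bounded_measurable \<mu>" if "h \<in> bounded_measurable \<mu>" "l \<in> bounded_measurable \<mu>" for h l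
      proof -
        have "(\<lambda>w. h w + (- 1) * l w) \<in> bounded_measurable \<mu>" by (intro D_add D_scale that)
        from D_mult[OF this this] show ?thesis by (simp add: power2_eq_square)
      qed
      have uu: "u \<omega> = ennreal (cexp \<mu> f (Z \<omega>) (\<lambda>w. (?d w)\<^sup>2))"
        unfolding u_def F_def fst_conv snd_conv by (intro nn_integral_K z sq g D_lincomb U) auto
      have vv: "v \<omega> = ennreal (cexp \<mu> f (Z \<omega>) (\<lambda>w. (?d' w)\<^sup>2))"
        unfolding v_def G_def fst_conv snd_conv by (intro nn_integral_K z sq k D_lincomb V) auto
      have nn: "0 \<le> cexp \<mu> f (Z \<omega>) (\<lambda>w. (?d w)\<^sup>2)" "0 \<le> cexp \<mu> f (Z \<omega>) (\<lambda>w. (?d' w)\<^sup>2)"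
        unfolding cexp_def using f_nonneg z by (auto intro!: integral_nonneg_AE AE_I2)
      have "\<bar>c (Z \<omega>)\<bar> \<le> (R (Z \<omega>))\<^sup>2 / t + 3 * t + (1 / t + 1) *
          (cexp \<mu> f (Z \<omega>) (\<lambda>w. (?d w)\<^sup>2) + cexp \<mu> f (Z \<omega>) (\<lambda>w. (?d' w)\<^sup>2))"
        unfolding c_def R_def by (rule cov_le_approximation[OF g var1[OF z g g1] k var1[OF z k k1] t])
      then have "ennreal \<bar>c (Z \<omega>)\<bar> \<le> ennreal ((R (Z \<omega>))\<^sup>2 / t + 3 * t + (1 / t + 1) *
          (cexp \<mu> f (Z \<omega>) (\<lambda>w. (?d w)\<^sup>2) + cexp \<mu> f (Z \<omega>) (\<lambda>w. (?d' w)\<^sup>2)))"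
        by (rule ennreal_leI)
      also have "\<dots> = ennreal ((R (Z \<omega>))\<^sup>2 / t + 3 * t) + ennreal (1 / t + 1) * (u \<omega> + v \<omega>)"
        using nn t t1 unfolding uu vv
        by (subst ennreal_plus) (auto simp: ennreal_mult simp del: ennreal_plus simp add: ennreal_plus[symmetric])
      finally show ?thesis .
    qed
    have int2: "integrable M (\<lambda>\<omega>. (R (Z \<omega>))\<^sup>2 / t + 3 * t)" using iR by simp
    have "ennreal I = (\<integral>\<^sup>+\<omega>. ennreal \<bar>c (Z \<omega>)\<bar> \<partial>M)"
      unfolding I_def by (rule nn_integral_eq_integral[symmetric, OF ic]) simp
    also have "\<dots> \<le> (\<integral>\<^sup>+\<omega>. ennreal ((R (Z \<omega>))\<^sup>2 / t + 3 * t) + ennreal (1 / t + 1) * (u \<omega> + v \<omega>) \<partial>M)"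
      by (rule nn_integral_mono) (rule pw)
    also have "\<dots> = (\<integral>\<^sup>+\<omega>. ennreal ((R (Z \<omega>))\<^sup>2 / t + 3 * t) \<partial>M)
        + ennreal (1 / t + 1) * ((\<integral>\<^sup>+\<omega>. u \<omega> \<partial>M) + (\<integral>\<^sup>+\<omega>. v \<omega> \<partial>M))"
      by (simp add: nn_integral_add nn_integral_cmult)
    also have "\<dots> \<le> (\<integral>\<^sup>+\<omega>. ennreal ((R (Z \<omega>))\<^sup>2 / t + 3 * t) \<partial>M) + ennreal (1 / t + 1) * (ennreal e + ennreal e)"
      by (intro add_left_mono mult_left_mono add_mono ue ve) auto
    also have "(\<integral>\<^sup>+\<omega>. ennreal ((R (Z \<omega>))\<^sup>2 / t + 3 * t) \<partial>M) = ennreal (expectation (\<lambda>\<omega>. (R (Z \<omega>))\<^sup>2 / t + 3 * t))"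
      using t by (intro nn_integral_eq_integral[OF int2]) (auto intro!: AE_I2 add_nonneg_nonneg)
    also have "expectation (\<lambda>\<omega>. (R (Z \<omega>))\<^sup>2 / t + 3 * t) = expectation (\<lambda>\<omega>. (R (Z \<omega>))\<^sup>2) / t + 3 * t"
      using iR by (simp add: prob_space)
    finally have "ennreal I \<le> ennreal (expectation (\<lambda>\<omega>. (R (Z \<omega>))\<^sup>2) / t + 3 * t + (1 / t + 1) * (e + e))"
      using t t1 e by (simp add: ennreal_mult[symmetric] ennreal_plus[symmetric] del: ennreal_plus)
    then have "I \<le> expectation (\<lambda>\<omega>. (R (Z \<omega>))\<^sup>2) / t + 3 * t + (1 / t + 1) * (e + e)"
      using t t1 e by (subst (asm) ennreal_le_iff) auto
    also have "(1 / t + 1) * (e + e) = I / 4"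
    proof -
      have "x * (I / (8 * x) + I / (8 * x)) = I / 4" if "0 < x" for x :: real
        using that by (simp add: field_simps)
      from this[OF t1] show ?thesis unfolding e_def .
    qed
    also have "3 * t = I / 4" by (simp add: t_def)
    finally have "I / 2 \<le> expectation (\<lambda>\<omega>. (R (Z \<omega>))\<^sup>2) / t" by linarith
    then show ?thesis unfolding rhoR using t by (simp add: pos_le_divide_eq mult.commute)
  qed
  then show ?thesis using t I by (intro exI[of _ "t * I / 2"] conjI exI[of _ "max N1 N2"]) auto
qed

end

section \<open>Kernel smoothing and averages of independent variables\<close>

lemma integral_lborel_reflect_scale:
  fixes F :: "'z::euclidean_space \<Rightarrow> real"
  assumes F[measurable]: "F \<in> borel_measurable borel" and h: "0 < h"
  shows "(\<integral>w. F w \<partial>lborel) = h ^ DIM('z) * (\<integral>u. F (z - h *\<^sub>R u) \<partial>lborel)"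
proof -
  have "lborel = density (distr lborel borel (\<lambda>u. z + (- h) *\<^sub>R u)) (\<lambda>_. ennreal (h ^ DIM('z)))"
    using lborel_affine[of "- h" z] h by simp
  then have "(\<integral>w. F w \<partial>lborel)
      = (\<integral>w. F w \<partial>density (distr lborel borel (\<lambda>u. z + (- h) *\<^sub>R u)) (\<lambda>_. ennreal (h ^ DIM('z))))"
    by simp
  also have "\<dots> = (\<integral>w. h ^ DIM('z) *\<^sub>R F w \<partial>distr lborel borel (\<lambda>u. z + (- h) *\<^sub>R u))"
    using h by (intro integral_density) auto
  also have "\<dots> = (\<integral>u. h ^ DIM('z) *\<^sub>R F (z + (- h) *\<^sub>R u) \<partial>lborel)"
    by (rule integral_distr) measurable
  finally show ?thesis by simp
qed

text \<open>
  The substitution \<open>w = z - h u\<close> turns the modulus of continuity of \<open>G\<close> at \<open>z\<close> into moments of the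
  kernel; the first moment is bounded through \<open>\<parallel>u\<parallel> \<le> 1 + \<parallel>u\<parallel>\<^sup>2\<close>.
\<close>

lemma kernel_smoothing_bias:
  fixes k0 G :: "'z::euclidean_space \<Rightarrow> real"
  assumes k0[measurable]: "k0 \<in> borel_measurable borel" and k0nn: "\<And>u. 0 \<le> k0 u"
    and k01: "has_bochner_integral lborel k0 1" and k02: "integrable lborel (\<lambda>u. (norm u)\<^sup>2 * k0 u)"
    and G[measurable]: "G \<in> borel_measurable borel"
    and Lip: "\<And>w. \<bar>G w - G z\<bar> \<le> L * norm (w - z) + C * (norm (w - z))\<^sup>2"
    and L: "0 \<le> L" and C: "0 \<le> C" and h: "0 < h"
  defines "A \<equiv> \<integral>u. (norm u)\<^sup>2 * k0 u \<partial>lborel"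
  shows "\<bar>(\<integral>w. k0 ((1 / h) *\<^sub>R (z - w)) * G w \<partial>lborel) / h ^ DIM('z) - G z\<bar> \<le> L * h * (1 + A) + C * h\<^sup>2 * A"
proof -
  have i0: "integrable lborel k0" "(\<integral>u. k0 u \<partial>lborel) = 1" using k01 by (auto simp: has_bochner_integral_iff)
  let ?D = "\<lambda>u. (L * h) * k0 u + (L * h + C * h\<^sup>2) * ((norm u)\<^sup>2 * k0 u)"
  have iD: "integrable lborel ?D" using i0 k02 by simp
  have D: "\<bar>k0 u * (G (z - h *\<^sub>R u) - G z)\<bar> \<le> ?D u" for u
  proof -
    have "\<bar>G (z - h *\<^sub>R u) - G z\<bar> \<le> L * (h * norm u) + C * (h * norm u)\<^sup>2"
      using Lip[of "z - h *\<^sub>R u"] h by simp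
    also have "\<dots> = (L * h) * norm u + C * h\<^sup>2 * (norm u)\<^sup>2" by (simp add: power_mult_distrib mult_ac)
    also have "norm u \<le> 1 + (norm u)\<^sup>2"
      using sum_squares_bound[of 1 "norm u"] by simp (smt (verit) norm_ge_zero)
    then have "(L * h) * norm u + C * h\<^sup>2 * (norm u)\<^sup>2 \<le> (L * h) * (1 + (norm u)\<^sup>2) + C * h\<^sup>2 * (norm u)\<^sup>2"
      using L h by (intro add_right_mono mult_left_mono) auto
    finally have "\<bar>G (z - h *\<^sub>R u) - G z\<bar> \<le> (L * h) + (L * h + C * h\<^sup>2) * (norm u)\<^sup>2" by (simp add: algebra_simps)
    from mult_left_mono[OF this k0nn[of u]]
    have "k0 u * \<bar>G (z - h *\<^sub>R u) - G z\<bar> \<le> ?D u" by (simp add: algebra_simps)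
    then show ?thesis unfolding abs_mult abs_of_nonneg[OF k0nn] .
  qed
  have iE: "integrable lborel (\<lambda>u. k0 u * (G (z - h *\<^sub>R u) - G z))"
    by (rule Bochner_Integration.integrable_bound[OF iD]) (measurable, use D in \<open>auto intro!: AE_I2 order_trans[OF D abs_ge_self]\<close>)
  have "(\<integral>w. k0 ((1 / h) *\<^sub>R (z - w)) * G w \<partial>lborel) = h ^ DIM('z) * (\<integral>u. k0 u * G (z - h *\<^sub>R u) \<partial>lborel)"
    using h by (subst integral_lborel_reflect_scale[OF _ h, where z=z]) simp_all
  then have "(\<integral>w. k0 ((1 / h) *\<^sub>R (z - w)) * G w \<partial>lborel) / h ^ DIM('z) = (\<integral>u. k0 u * G (z - h *\<^sub>R u) \<partial>lborel)"
    using h by simp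
  also have "(\<integral>u. k0 u * G (z - h *\<^sub>R u) \<partial>lborel) = (\<integral>u. k0 u * (G (z - h *\<^sub>R u) - G z) + k0 u * G z \<partial>lborel)"
    by (simp add: algebra_simps)
  also have "\<dots> = (\<integral>u. k0 u * (G (z - h *\<^sub>R u) - G z) \<partial>lborel) + G z"
    using iE i0 by (subst Bochner_Integration.integral_add) auto
  finally have "\<bar>(\<integral>w. k0 ((1 / h) *\<^sub>R (z - w)) * G w \<partial>lborel) / h ^ DIM('z) - G z\<bar>
      = \<bar>\<integral>u. k0 u * (G (z - h *\<^sub>R u) - G z) \<partial>lborel\<bar>" by simp
  also have "\<dots> \<le> (\<integral>u. \<bar>k0 u * (G (z - h *\<^sub>R u) - G z)\<bar> \<partial>lborel)" by (rule integral_abs_bound)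
  also have "\<dots> \<le> (\<integral>u. ?D u \<partial>lborel)" by (rule integral_mono[OF integrable_abs[OF iE] iD D])
  also have "\<dots> = L * h * 1 + (L * h + C * h\<^sup>2) * A"
    using i0 k02 by (simp add: A_def)
  also have "\<dots> = L * h * (1 + A) + C * h\<^sup>2 * A" by (simp add: algebra_simps)
  finally show ?thesis .
qed

lemma kernel_smoothing_bounded:
  fixes k0 G :: "'z::euclidean_space \<Rightarrow> real"
  assumes k0[measurable]: "k0 \<in> borel_measurable borel" and k0nn: "\<And>u. 0 \<le> k0 u"
    and k01: "has_bochner_integral lborel k0 1"
    and G[measurable]: "G \<in> borel_measurable borel" and b: "\<And>w. 0 \<le> G w" "\<And>w. G w \<le> B" and h: "0 < h"
  shows "(\<integral>w. k0 ((1 / h) *\<^sub>R (z - w)) * G w \<partial>lborel) \<le> h ^ DIM('z) * B"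
proof -
  have i0: "integrable lborel k0" "(\<integral>u. k0 u \<partial>lborel) = 1" using k01 by (auto simp: has_bochner_integral_iff)
  have le: "k0 u * G (z - h *\<^sub>R u) \<le> k0 u * B" for u by (intro mult_left_mono b k0nn)
  have "integrable lborel (\<lambda>u. k0 u * G (z - h *\<^sub>R u))"
    by (rule Bochner_Integration.integrable_bound[OF integrable_mult_left[OF i0(1), of B]])
      (measurable, use le b k0nn in \<open>auto intro!: AE_I2 order_trans[OF le abs_ge_self] simp: abs_of_nonneg\<close>)
  then have "(\<integral>u. k0 u * G (z - h *\<^sub>R u) \<partial>lborel) \<le> (\<integral>u. k0 u * B \<partial>lborel)"
    using i0 by (intro integral_mono le) auto
  also have "\<dots> = B" using i0 by simp
  finally have "h ^ DIM('z) * (\<integral>u. k0 u * G (z - h *\<^sub>R u) \<partial>lborel) \<le> h ^ DIM('z) * B"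
    using h by (intro mult_left_mono) auto
  moreover have "(\<integral>w. k0 ((1 / h) *\<^sub>R (z - w)) * G w \<partial>lborel) = h ^ DIM('z) * (\<integral>u. k0 u * G (z - h *\<^sub>R u) \<partial>lborel)"
    using h by (subst integral_lborel_reflect_scale[OF _ h, where z=z]) simp_all
  ultimately show ?thesis by simp
qed

text \<open>
  Chebyshev's inequality; by independence the cross terms in the second moment of the centred sum
  vanish.
\<close>

lemma (in prob_space) iid_mean_deviation:
  fixes \<zeta> :: "nat \<Rightarrow> 'a \<Rightarrow> 'b" and F :: "'b \<Rightarrow> real"
  assumes ind: "indep_vars (\<lambda>_. N) \<zeta> UNIV"
    and id: "\<And>i. distr M N (\<zeta> i) = distr M N \<zeta>0" and \<zeta>0[measurable]: "\<zeta>0 \<in> measurable M N"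
    and F[measurable]: "F \<in> borel_measurable N" and bd: "\<And>x. x \<in> space N \<Longrightarrow> \<bar>F x\<bar> \<le> b"
    and s: "expectation (\<lambda>\<omega>. (F (\<zeta>0 \<omega>))\<^sup>2) \<le> s" and t: "0 < t" and n: "0 < n"
  shows "prob {\<omega> \<in> space M. t \<le> \<bar>(\<Sum>i<n. F (\<zeta> i \<omega>)) / real n - expectation (\<lambda>\<omega>. F (\<zeta>0 \<omega>))\<bar>} \<le> s / (real n * t\<^sup>2)"
proof -
  define m where "m = expectation (\<lambda>\<omega>. F (\<zeta>0 \<omega>))"
  have \<zeta>[measurable]: "\<zeta> i \<in> measurable M N" for i using ind by (auto simp: indep_vars_def)
  define \<eta> where "\<eta> i \<omega> = F (\<zeta> i \<omega>) - m" for i \<omega>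
  have \<eta>m[measurable]: "\<eta> i \<in> borel_measurable M" for i unfolding \<eta>_def by measurable
  have Fb: "\<bar>F (\<zeta>' \<omega>)\<bar> \<le> b" if "\<zeta>' \<in> measurable M N" "\<omega> \<in> space M" for \<zeta>' \<omega>
    by (rule bd[OF measurable_space[OF that]])
  have iF: "integrable M (\<lambda>\<omega>. F (\<zeta>' \<omega>))" if [measurable]: "\<zeta>' \<in> measurable M N" for \<zeta>'
    by (rule integrable_const_bound[where B=b]) (use Fb[OF that] in auto)
  have iF2: "integrable M (\<lambda>\<omega>. (F (\<zeta>0 \<omega>))\<^sup>2)"
    by (rule integrable_const_bound[where B="b\<^sup>2"]) (use Fb[OF \<zeta>0] in \<open>auto simp: abs_le_square_iff[symmetric] intro!: AE_I2 order_trans[OF _ abs_ge_self]\<close>)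
  have tr: "expectation (\<lambda>\<omega>. H (\<zeta> i \<omega>)) = expectation (\<lambda>\<omega>. H (\<zeta>0 \<omega>))" if [measurable]: "H \<in> borel_measurable N" for H :: "'b \<Rightarrow> real" and i
    using integral_distr[of "\<zeta> i" M N H] integral_distr[of \<zeta>0 M N H] id[of i] by simp
  have E0: "expectation (\<eta> i) = 0" for i
    unfolding \<eta>_def[abs_def] using tr[of F i] iF[of "\<zeta> i"] by (simp add: m_def prob_space)
  have E2: "expectation (\<lambda>\<omega>. \<eta> i \<omega> * \<eta> i \<omega>) \<le> s" for i
  proof -
    have "expectation (\<lambda>\<omega>. \<eta> i \<omega> * \<eta> i \<omega>) = expectation (\<lambda>\<omega>. (F (\<zeta>0 \<omega>) - m)\<^sup>2)"
      using tr[of "\<lambda>x. (F x - m)\<^sup>2" i] by (simp add: \<eta>_def power2_eq_square)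
    also have "\<dots> = expectation (\<lambda>\<omega>. (F (\<zeta>0 \<omega>))\<^sup>2) - m\<^sup>2"
      unfolding m_def by (rule variance_eq[OF iF[OF \<zeta>0] iF2])
    finally show ?thesis using s zero_le_power2[of m] by linarith
  qed
  have \<eta>b: "\<bar>\<eta> i \<omega>\<bar> \<le> b + \<bar>m\<bar>" if "\<omega> \<in> space M" for i \<omega>
    using Fb[OF \<zeta> that, of i] unfolding \<eta>_def by linarith
  have i\<eta>: "integrable M (\<eta> i)" for i
    by (rule integrable_const_bound[where B="b + \<bar>m\<bar>"]) (use \<eta>b in auto)
  have ip: "integrable M (\<lambda>\<omega>. \<eta> i \<omega> * \<eta> j \<omega>)" for i j
    by (rule integrable_const_bound[where B="(b + \<bar>m\<bar>) * (b + \<bar>m\<bar>)"])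
      (use \<eta>b in \<open>auto simp: abs_mult intro!: AE_I2 mult_mono order_trans[OF abs_ge_zero]\<close>)
  have ind\<eta>: "indep_vars (\<lambda>_. borel) \<eta> UNIV"
    unfolding \<eta>_def by (rule indep_vars_compose2[OF ind]) measurable
  have E1: "expectation (\<lambda>\<omega>. \<eta> i \<omega> * \<eta> j \<omega>) = 0" if "i \<noteq> j" for i j
  proof -
    have "expectation (\<lambda>\<omega>. \<Prod>l\<in>{i, j}. \<eta> l \<omega>) = (\<Prod>l\<in>{i, j}. expectation (\<eta> l))"
      by (rule indep_vars_lebesgue_integral[OF _ indep_vars_subset[OF ind\<eta>]]) (auto intro: i\<eta>)
    then show ?thesis using that E0 by simp
  qed
  define S where "S \<omega> = (\<Sum>i<n. \<eta> i \<omega>)" for \<omega>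
  have S2: "(S \<omega>)\<^sup>2 = (\<Sum>i<n. \<Sum>j<n. \<eta> i \<omega> * \<eta> j \<omega>)" for \<omega>
    by (simp add: S_def power2_eq_square sum_product)
  have "expectation (\<lambda>\<omega>. (S \<omega>)\<^sup>2) = (\<Sum>i<n. \<Sum>j<n. expectation (\<lambda>\<omega>. \<eta> i \<omega> * \<eta> j \<omega>))"
    unfolding S2 by (simp add: Bochner_Integration.integral_sum ip)
  also have "\<dots> = (\<Sum>i<n. \<Sum>j<n. if j = i then expectation (\<lambda>\<omega>. \<eta> i \<omega> * \<eta> i \<omega>) else 0)"
    by (intro sum.cong refl) (auto simp: E1)
  also have "\<dots> \<le> (\<Sum>i<n. s)" by (intro sum_mono) (simp add: E2)
  finally have ES: "expectation (\<lambda>\<omega>. (S \<omega>)\<^sup>2) \<le> real n * s" by simp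
  have [measurable]: "S \<in> borel_measurable M" unfolding S_def by measurable
  have "prob {\<omega> \<in> space M. real n * t \<le> \<bar>S \<omega>\<bar>} \<le> expectation (\<lambda>\<omega>. (S \<omega>)\<^sup>2) / (real n * t)\<^sup>2"
    by (rule second_moment_method) (use n t in \<open>auto simp: S2 ip\<close>)
  also have "\<dots> \<le> (real n * s) / (real n * t)\<^sup>2" by (intro divide_right_mono ES) auto
  also have "\<dots> = s / (real n * t\<^sup>2)" using n by (simp add: power2_eq_square)
  also have "{\<omega> \<in> space M. real n * t \<le> \<bar>S \<omega>\<bar>} = {\<omega> \<in> space M. t \<le> \<bar>(\<Sum>i<n. F (\<zeta> i \<omega>)) / real n - m\<bar>}"
  proof -
    have "S \<omega> = real n * ((\<Sum>i<n. F (\<zeta> i \<omega>)) / real n - m)" for \<omega>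
      using n by (simp add: S_def \<eta>_def sum_subtractf right_diff_distrib)
    then have "real n * t \<le> \<bar>S \<omega>\<bar> \<longleftrightarrow> t \<le> \<bar>(\<Sum>i<n. F (\<zeta> i \<omega>)) / real n - m\<bar>" for \<omega>
      using n by (simp add: abs_mult)
    then show ?thesis by simp
  qed
  finally show ?thesis by (simp add: m_def)
qed

section \<open>Uniform deviation of the kernel averages\<close>

lemma twice_diff_bounded_Lipschitz:
  fixes z :: "'z::euclidean_space"
  assumes td: "twice_diff_bounded S \<phi> B" and sub: "ball z e \<subseteq> S" and w: "w \<in> ball z e"
  shows "\<bar>\<phi> w - \<phi> z\<bar> \<le> real DIM('z) * B * norm (w - z)"
proof -
  obtain G :: "'z \<Rightarrow> 'z" where der: "\<And>x. x \<in> S \<Longrightarrow> (\<phi> has_derivative (\<lambda>v. inner (G x) v)) (at x within S)"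
    and Gb: "\<And>x i. x \<in> S \<Longrightarrow> i \<in> Basis \<Longrightarrow> \<bar>inner (G x) i\<bar> \<le> B"
    using td unfolding twice_diff_bounded_def by blast
  have "0 < e" using w by (metis ball_eq_empty empty_iff not_le)
  then have z: "z \<in> ball z e" by simp
  have "norm (\<phi> w - \<phi> z) \<le> (real DIM('z) * B) * norm (w - z)"
  proof (rule differentiable_bound[OF convex_ball _ _ w z])
    fix x assume x: "x \<in> ball z e"
    then have xS: "x \<in> S" using sub by blast
    show "(\<phi> has_derivative (\<lambda>v. inner (G x) v)) (at x within ball z e)"
      by (rule has_derivative_subset[OF der[OF xS] sub])
    have "norm (G x) \<le> (\<Sum>i\<in>Basis. \<bar>inner (G x) i\<bar>)" by (rule norm_le_l1)
    also have "\<dots> \<le> (\<Sum>i\<in>(Basis::'z set). B)" by (intro sum_mono Gb xS)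
    finally have nG: "norm (G x) \<le> real DIM('z) * B" by simp
    show "onorm (\<lambda>v. inner (G x) v) \<le> real DIM('z) * B"
    proof (rule onorm_le)
      fix v
      have "norm (inner (G x) v) \<le> norm (G x) * norm v" using Cauchy_Schwarz_ineq2 by simp
      also have "\<dots> \<le> (real DIM('z) * B) * norm v" by (intro mult_right_mono nG) simp
      finally show "norm (inner (G x) v) \<le> (real DIM('z) * B) * norm v" .
    qed
  qed
  then show ?thesis by simp
qed

lemma twice_diff_bounded_abs: "twice_diff_bounded S \<phi> B \<Longrightarrow> w \<in> S \<Longrightarrow> \<bar>\<phi> w\<bar> \<le> B"
  unfolding twice_diff_bounded_def by blast

locale kernel_setting = conditional_model M "borel_on RX" X "borel_on RY" Y "borel_on RZ" Z \<mu> f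
  for M :: "'m measure" and RX :: "'x::topological_space set" and X and RY :: "'y::topological_space set" and Y
    and RZ :: "'z::euclidean_space set" and Z and \<mu> and f +
  fixes fZ :: "'z \<Rightarrow> real" and hbar :: "'x \<times> 'y \<Rightarrow> real" and c0 c1 :: real and k0 :: "'z \<Rightarrow> real"
    and Xs :: "nat \<Rightarrow> 'm \<Rightarrow> 'x" and Ys :: "nat \<Rightarrow> 'm \<Rightarrow> 'y" and Zs :: "nat \<Rightarrow> 'm \<Rightarrow> 'z"
  assumes RZ_sets: "RZ \<in> sets borel"
    and sample_indep: "indep_vars (\<lambda>_. borel_on RX \<Otimes>\<^sub>M (borel_on RY \<Otimes>\<^sub>M borel_on RZ))
           (\<lambda>i \<omega>. (Xs i \<omega>, Ys i \<omega>, Zs i \<omega>)) UNIV"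
    and sample_distr: "\<And>i. distr M (borel_on RX \<Otimes>\<^sub>M (borel_on RY \<Otimes>\<^sub>M borel_on RZ)) (\<lambda>\<omega>. (Xs i \<omega>, Ys i \<omega>, Zs i \<omega>))
              = distr M (borel_on RX \<Otimes>\<^sub>M (borel_on RY \<Otimes>\<^sub>M borel_on RZ)) (\<lambda>\<omega>. (X \<omega>, Y \<omega>, Z \<omega>))"
    and fZ_distr: "distributed M lborel Z (\<lambda>w. ennreal (fZ w))"
    and hbar_int: "integrable \<mu> hbar"
    and f_smooth: "\<And>v. v \<in> RX \<times> RY \<Longrightarrow> twice_diff_bounded RZ (f v) (hbar v)"
    and fZ_smooth: "twice_diff_bounded RZ fZ c0"
    and fZ_pos: "\<And>w. w \<in> RZ \<Longrightarrow> 0 < fZ w \<and> 1 / fZ w \<le> c1"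
    and k0_meas[measurable]: "k0 \<in> borel_measurable borel" and k0_nonneg: "\<And>u. 0 \<le> k0 u"
    and k0_bdd: "bdd_above (range k0)"
    and k0_one: "has_bochner_integral lborel k0 1"
    and k0_second: "integrable lborel (\<lambda>u. (norm u)\<^sup>2 * k0 u)"
begin

text \<open>
  \<open>Lip\<close> is a Lipschitz constant of \<open>z \<mapsto> E(g | Z = z) f\<^sub>Z(z)\<close> near interior points that serves all \<open>g\<close>
  bounded by \<open>1\<close>; \<open>bias h e\<close> bounds the bias of the kernel averages at points with distance at least \<open>e\<close>
  from the complement of the range.
\<close>

definition kmax where "kmax = Sup (range k0)"
definition A2 where "A2 = (\<integral>u. (norm u)\<^sup>2 * k0 u \<partial>lborel)"
definition Lip where "Lip = real DIM('z) * c0 + c0 * (real DIM('z) * (\<integral>v. hbar v \<partial>\<mu>))"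
definition bias where "bias h e = Lip * h * (1 + A2) + (2 * c0 / e\<^sup>2) * h\<^sup>2 * A2"

definition ksum :: "nat \<Rightarrow> real \<Rightarrow> 'z \<Rightarrow> ('x \<times> 'y \<Rightarrow> real) \<Rightarrow> 'm \<Rightarrow> real" where
  "ksum n h z g \<omega> = (\<Sum>i<n. g (Xs i \<omega>, Ys i \<omega>) * k0 ((1 / h) *\<^sub>R (z - Zs i \<omega>))) / (real n * h ^ DIM('z))"

definition unit_functions :: "('x \<times> 'y \<Rightarrow> real) set" where
  "unit_functions = {g \<in> borel_measurable \<mu>. \<forall>v\<in>space \<mu>. \<bar>g v\<bar> \<le> 1}"

lemma unit_bounded: "g \<in> unit_functions \<Longrightarrow> g \<in> bounded_measurable \<mu>"
  unfolding unit_functions_def bounded_measurable_def by blast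

lemma space_\<mu>': "space \<mu> = RX \<times> RY" by (simp add: space_\<mu> space_restrict_space)

lemma space_RZ: "space (borel_on RZ) = RZ" by (simp add: space_restrict_space)

lemma k0_le: "k0 u \<le> kmax" unfolding kmax_def by (intro cSup_upper k0_bdd) auto

lemma kmax_nonneg: "0 \<le> kmax" using k0_nonneg k0_le order_trans by blast

lemma A2_nonneg: "0 \<le> A2" unfolding A2_def by (intro integral_nonneg_AE AE_I2) (simp add: k0_nonneg)

lemma RZ_nonempty: "\<exists>z. z \<in> RZ" using not_empty Z_space space_RZ by blast

lemma c0_nonneg: "0 \<le> c0"
  using RZ_nonempty twice_diff_bounded_abs[OF fZ_smooth] by (meson abs_ge_zero order_trans)

lemma fZ_le: "w \<in> RZ \<Longrightarrow> fZ w \<le> c0" using twice_diff_bounded_abs[OF fZ_smooth, of w] by simp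

lemma c1_pos: "0 < c1"
proof -
  obtain z where "z \<in> RZ" using RZ_nonempty by blast
  from fZ_pos[OF this] show ?thesis by (smt (verit) zero_less_divide_1_iff)
qed

lemma fZ_ge: "w \<in> RZ \<Longrightarrow> 1 / c1 \<le> fZ w"
  using fZ_pos[of w] c1_pos by (auto simp: pos_divide_le_eq mult.commute)

lemma hbar_nonneg: "v \<in> space \<mu> \<Longrightarrow> 0 \<le> hbar v"
  using RZ_nonempty twice_diff_bounded_abs[OF f_smooth] space_\<mu>' by (metis abs_ge_zero order_trans)

lemma Lip_nonneg: "0 \<le> Lip"
proof -
  have "0 \<le> (\<integral>v. hbar v \<partial>\<mu>)" by (intro integral_nonneg_AE AE_I2 hbar_nonneg)
  then show ?thesis unfolding Lip_def using c0_nonneg by (intro add_nonneg_nonneg mult_nonneg_nonneg) auto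
qed

lemma cexp_unit_le: "z \<in> RZ \<Longrightarrow> g \<in> unit_functions \<Longrightarrow> \<bar>cexp \<mu> f z g\<bar> \<le> 1"
  by (rule density_kernel.cexp_abs_le[OF density_kernel_at]) (auto simp: unit_functions_def space_RZ)

lemma cexp_Lipschitz:
  assumes g: "g \<in> unit_functions" and sub: "ball z e \<subseteq> RZ" and w: "w \<in> ball z e"
  shows "\<bar>cexp \<mu> f w g - cexp \<mu> f z g\<bar> \<le> real DIM('z) * (\<integral>v. hbar v \<partial>\<mu>) * norm (w - z)"
proof -
  have "0 < e" using w by (metis ball_eq_empty empty_iff not_le)
  then have zw: "z \<in> RZ" "w \<in> RZ" using sub w by auto
  have i: "integrable \<mu> (\<lambda>v. g v * f v x)" if "x \<in> RZ" for x
    using density_kernel.bounded_integrable[OF density_kernel_at unit_bounded[OF g]] that by (simp add: space_RZ)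
  let ?c = "real DIM('z) * norm (w - z)"
  have "\<bar>cexp \<mu> f w g - cexp \<mu> f z g\<bar> = \<bar>\<integral>v. g v * f v w - g v * f v z \<partial>\<mu>\<bar>"
    unfolding cexp_def using i zw by simp
  also have "\<dots> \<le> (\<integral>v. \<bar>g v * f v w - g v * f v z\<bar> \<partial>\<mu>)" by (rule integral_abs_bound)
  also have "\<dots> \<le> (\<integral>v. ?c * hbar v \<partial>\<mu>)"
  proof (rule integral_mono)
    fix v assume v: "v \<in> space \<mu>"
    then have "\<bar>g v\<bar> \<le> 1" using g by (simp add: unit_functions_def)
    have "\<bar>g v * f v w - g v * f v z\<bar> = \<bar>g v\<bar> * \<bar>f v w - f v z\<bar>" by (simp add: abs_mult[symmetric] right_diff_distrib)
    also have "\<dots> \<le> 1 * (real DIM('z) * hbar v * norm (w - z))"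
      using v space_\<mu>' \<open>\<bar>g v\<bar> \<le> 1\<close> by (intro mult_mono twice_diff_bounded_Lipschitz[OF f_smooth sub w]) auto
    finally show "\<bar>g v * f v w - g v * f v z\<bar> \<le> ?c * hbar v" by (simp add: mult_ac)
  qed (use i zw hbar_int in auto)
  also have "\<dots> = real DIM('z) * (\<integral>v. hbar v \<partial>\<mu>) * norm (w - z)" by simp
  finally show ?thesis .
qed

text \<open>
  The function \<open>z \<mapsto> E(g | Z = z) f\<^sub>Z(z)\<close>, extended by \<open>0\<close> to the whole space, which the kernel averages
  estimate.  Outside the range \<open>fZ\<close> may be negative or not measurable, while its positive part is a
  measurable version of the density.
\<close>

definition joint where "joint g w = indicator RZ w * cexp \<mu> f w g * enn2real (ennreal (fZ w))"

lemma joint_eq: "w \<in> RZ \<Longrightarrow> joint g w = cexp \<mu> f w g * fZ w"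
  using fZ_pos[of w] by (simp add: joint_def)

lemma fZ_meas: "(\<lambda>w. enn2real (ennreal (fZ w))) \<in> borel_measurable borel"
  using distributed_borel_measurable[OF fZ_distr] by simp

lemma cexp_indicator_meas:
  assumes "g \<in> bounded_measurable \<mu>" shows "(\<lambda>w. indicator RZ w * cexp \<mu> f w g) \<in> borel_measurable borel"
  using cexp_measurable[OF assms] RZ_sets by (simp add: borel_measurable_restrict_space_iff)

lemma joint_meas: "g \<in> bounded_measurable \<mu> \<Longrightarrow> joint g \<in> borel_measurable borel"
  unfolding joint_def by (intro borel_measurable_times cexp_indicator_meas fZ_meas)

text \<open>
  Inside the ball this is the mean value theorem.  Outside, where nothing is known about the smoothness
  at the boundary of the range, the trivial bound \<open>2 c0\<close> is at most \<open>2 c0 \<parallel>w - z\<parallel>\<^sup>2 / e\<^sup>2\<close>.  The quadratic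
  term thus accounts for the kernel mass beyond distance \<open>e\<close>.
\<close>

lemma joint_Lipschitz:
  assumes g: "g \<in> unit_functions" and sub: "ball z e \<subseteq> RZ" and e: "0 < e"
  shows "\<bar>joint g w - joint g z\<bar> \<le> Lip * norm (w - z) + (2 * c0 / e\<^sup>2) * (norm (w - z))\<^sup>2"
proof (cases "w \<in> ball z e")
  case True
  then have zw: "z \<in> RZ" "w \<in> RZ" using sub e by auto
  have "joint g w - joint g z = cexp \<mu> f w g * (fZ w - fZ z) + fZ z * (cexp \<mu> f w g - cexp \<mu> f z g)"
    using zw by (simp add: joint_eq algebra_simps)
  then have "\<bar>joint g w - joint g z\<bar> \<le> \<bar>cexp \<mu> f w g\<bar> * \<bar>fZ w - fZ z\<bar> + \<bar>fZ z\<bar> * \<bar>cexp \<mu> f w g - cexp \<mu> f z g\<bar>"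
    by (metis abs_mult abs_triangle_ineq)
  also have "\<dots> \<le> 1 * (real DIM('z) * c0 * norm (w - z)) + c0 * (real DIM('z) * (\<integral>v. hbar v \<partial>\<mu>) * norm (w - z))"
    using zw c0_nonneg True
    by (intro add_mono mult_mono cexp_unit_le g twice_diff_bounded_Lipschitz[OF fZ_smooth sub]
        twice_diff_bounded_abs[OF fZ_smooth] cexp_Lipschitz[OF g sub]) auto
  also have "\<dots> = Lip * norm (w - z)" by (simp add: Lip_def algebra_simps)
  also have "\<dots> \<le> Lip * norm (w - z) + (2 * c0 / e\<^sup>2) * (norm (w - z))\<^sup>2" using c0_nonneg by simp
  finally show ?thesis .
next
  case False
  have le: "\<bar>joint g x\<bar> \<le> c0" for x
  proof (cases "x \<in> RZ")
    case True
    have "\<bar>joint g x\<bar> = \<bar>cexp \<mu> f x g\<bar> * \<bar>fZ x\<bar>" using True by (simp add: joint_eq abs_mult)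
    also have "\<dots> \<le> 1 * c0" using True by (intro mult_mono cexp_unit_le g twice_diff_bounded_abs[OF fZ_smooth]) auto
    finally show ?thesis by simp
  qed (simp add: joint_def c0_nonneg)
  have "e \<le> norm (w - z)" using False by (simp add: dist_norm norm_minus_commute)
  then have "e\<^sup>2 \<le> (norm (w - z))\<^sup>2" using e by (intro power_mono) auto
  then have "(2 * c0 / e\<^sup>2) * e\<^sup>2 \<le> (2 * c0 / e\<^sup>2) * (norm (w - z))\<^sup>2" using c0_nonneg by (intro mult_left_mono) auto
  then have "2 * c0 \<le> (2 * c0 / e\<^sup>2) * (norm (w - z))\<^sup>2" using e by simp
  moreover have "\<bar>joint g w - joint g z\<bar> \<le> 2 * c0" using le[of w] le[of z] by linarith
  moreover have "0 \<le> Lip * norm (w - z)" using Lip_nonneg by simp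
  ultimately show ?thesis by linarith
qed

lemma expectation_kernel:
  assumes g: "g \<in> bounded_measurable \<mu>"
  shows "expectation (\<lambda>\<omega>. g (X \<omega>, Y \<omega>) * k0 ((1 / h) *\<^sub>R (z - Z \<omega>)))
    = (\<integral>w. k0 ((1 / h) *\<^sub>R (z - w)) * joint g w \<partial>lborel)"
proof -
  let ?\<theta> = "\<lambda>w. k0 ((1 / h) *\<^sub>R (z - w))"
  have \<theta>b: "?\<theta> \<in> borel_measurable borel" by measurable
  then have \<theta>: "?\<theta> \<in> borel_measurable (borel_on RZ)" by (rule measurable_restrict_space1)
  have i: "integrable M (\<lambda>\<omega>. ?\<theta> (Z \<omega>))"
    by (rule integrable_const_bound[where B=kmax])
      (use k0_le k0_nonneg measurable_compose[OF Z_meas \<theta>] in auto)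
  have "expectation (\<lambda>\<omega>. g (X \<omega>, Y \<omega>) * ?\<theta> (Z \<omega>)) = expectation (\<lambda>\<omega>. cexp \<mu> f (Z \<omega>) g * ?\<theta> (Z \<omega>))"
    by (rule expectation_cexp(3)[OF g \<theta> k0_nonneg i])
  also have "\<dots> = expectation (\<lambda>\<omega>. (indicator RZ (Z \<omega>) * cexp \<mu> f (Z \<omega>) g) * ?\<theta> (Z \<omega>))"
    using Z_space space_RZ by (intro Bochner_Integration.integral_cong) auto
  also have "\<dots> = (\<integral>w. enn2real (ennreal (fZ w)) * ((indicator RZ w * cexp \<mu> f w g) * ?\<theta> w) \<partial>lborel)"
  proof (rule distributed_integral[symmetric])
    have "ennreal (enn2real (ennreal (fZ w))) = ennreal (fZ w)" for w by simp
    then show "distributed M lborel Z (\<lambda>w. ennreal (enn2real (ennreal (fZ w))))" using fZ_distr by simp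
    show "(\<lambda>w. indicator RZ w * cexp \<mu> f w g * ?\<theta> w) \<in> borel_measurable lborel"
      using cexp_indicator_meas[OF g] \<theta>b by simp
  qed simp
  also have "\<dots> = (\<integral>w. ?\<theta> w * joint g w \<partial>lborel)" by (simp add: joint_def mult_ac)
  finally show ?thesis .
qed

lemma one_unit: "(\<lambda>_. 1) \<in> unit_functions" by (simp add: unit_functions_def)

lemma sample_meas: "(\<lambda>\<omega>. (Xs i \<omega>, Ys i \<omega>, Zs i \<omega>)) \<in> measurable M (borel_on RX \<Otimes>\<^sub>M (borel_on RY \<Otimes>\<^sub>M borel_on RZ))"
  using sample_indep unfolding indep_vars_def by blast

lemma sample_space:
  assumes "\<omega> \<in> space M" shows "(Xs i \<omega>, Ys i \<omega>) \<in> space \<mu>"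
  using measurable_space[OF sample_meas assms, of i] by (simp add: space_pair_measure space_\<mu>)

lemma kernel_term_meas:
  assumes "g \<in> borel_measurable \<mu>"
  shows "(\<lambda>x. g (fst x, fst (snd x)) * k0 ((1 / h) *\<^sub>R (z - snd (snd x))))
    \<in> borel_measurable (borel_on RX \<Otimes>\<^sub>M (borel_on RY \<Otimes>\<^sub>M borel_on RZ))"
proof -
  have [measurable]: "g \<in> borel_measurable (borel_on RX \<Otimes>\<^sub>M borel_on RY)" using assms by (simp add: measurable_\<mu>_iff)
  have "(\<lambda>w. k0 ((1 / h) *\<^sub>R (z - w))) \<in> borel_measurable borel" by measurable
  then have [measurable]: "(\<lambda>w. k0 ((1 / h) *\<^sub>R (z - w))) \<in> borel_measurable (borel_on RZ)"
    by (rule measurable_restrict_space1)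
  show ?thesis by measurable
qed

lemma kernel_sum_term_meas:
  assumes "g \<in> borel_measurable \<mu>"
  shows "(\<lambda>\<omega>. g (Xs i \<omega>, Ys i \<omega>) * k0 ((1 / h) *\<^sub>R (z - Zs i \<omega>))) \<in> borel_measurable M"
  using measurable_compose[OF sample_meas kernel_term_meas[OF assms]] by simp

lemma ksum_meas: "g \<in> borel_measurable \<mu> \<Longrightarrow> ksum n h z g \<in> borel_measurable M"
  unfolding ksum_def by (intro borel_measurable_divide borel_measurable_sum borel_measurable_const kernel_sum_term_meas)

text \<open>
  The summands, divided by \<open>h\<^sup>d\<close>, have second moment at most \<open>kmax c0 / h\<^sup>d\<close>: one factor of the kernel is
  bounded by \<open>kmax\<close>, and the other integrates to at most \<open>c0 h\<^sup>d\<close>.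
\<close>

lemma ksum_deviation:
  assumes g: "g \<in> unit_functions" and sub: "ball z e \<subseteq> RZ" and pos: "0 < e" "0 < h" "0 < t" "0 < n"
  shows "prob {\<omega> \<in> space M. t + bias h e \<le> \<bar>ksum n h z g \<omega> - fZ z * cexp \<mu> f z g\<bar>}
    \<le> kmax * c0 / (real n * h ^ DIM('z) * t\<^sup>2)"
proof -
  let ?d = "h ^ DIM('z)"
  let ?N = "borel_on RX \<Otimes>\<^sub>M (borel_on RY \<Otimes>\<^sub>M borel_on RZ)"
  let ?k = "\<lambda>w. k0 ((1 / h) *\<^sub>R (z - w))"
  define F where "F x = g (fst x, fst (snd x)) * ?k (snd (snd x)) / ?d" for x :: "'x \<times> 'y \<times> 'z"
  have d: "0 < ?d" using pos by simp
  have gm: "g \<in> borel_measurable \<mu>" and g1: "\<And>v. v \<in> space \<mu> \<Longrightarrow> \<bar>g v\<bar> \<le> 1" using g by (auto simp: unit_functions_def)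
  have gb: "g \<in> bounded_measurable \<mu>" by (rule unit_bounded[OF g])
  have ob: "(\<lambda>_. 1) \<in> bounded_measurable \<mu>" by (rule unit_bounded[OF one_unit])
  have z: "z \<in> RZ" using sub pos by auto
  have Fm: "F \<in> borel_measurable ?N"
    unfolding F_def by (intro borel_measurable_divide kernel_term_meas gm borel_measurable_const)
  have Fb: "\<bar>F x\<bar> \<le> kmax / ?d" if "x \<in> space ?N" for x
  proof -
    have "(fst x, fst (snd x)) \<in> space \<mu>" using that by (auto simp: space_pair_measure space_\<mu>)
    then have "\<bar>g (fst x, fst (snd x))\<bar> * \<bar>?k (snd (snd x))\<bar> \<le> 1 * kmax"
      using g1 k0_le k0_nonneg by (intro mult_mono) (auto simp: abs_of_nonneg)
    then show ?thesis using d by (simp add: F_def abs_mult divide_right_mono)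
  qed
  have XYZ: "(\<lambda>\<omega>. (X \<omega>, Y \<omega>, Z \<omega>)) \<in> measurable M ?N" by measurable
  have EF: "expectation (\<lambda>\<omega>. F (X \<omega>, Y \<omega>, Z \<omega>)) = (\<integral>w. ?k w * joint g w \<partial>lborel) / ?d"
    unfolding F_def using expectation_kernel[OF gb, of h z] by simp
  have km: "(\<lambda>\<omega>. ?k (Z \<omega>)) \<in> borel_measurable M"
    using measurable_compose[OF XYZ kernel_term_meas[of "\<lambda>_. 1" h z]] by simp
  have ik: "integrable M (\<lambda>\<omega>. ?k (Z \<omega>))"
    by (rule integrable_const_bound[where B=kmax]) (use k0_le k0_nonneg km in auto)
  have "expectation (\<lambda>\<omega>. ?k (Z \<omega>)) = (\<integral>w. ?k w * joint (\<lambda>_. 1) w \<partial>lborel)"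
    using expectation_kernel[OF ob, of h z] by simp
  also have "\<dots> \<le> ?d * c0"
  proof (rule kernel_smoothing_bounded[OF k0_meas k0_nonneg k0_one joint_meas[OF ob] _ _ pos(2)])
    fix w
    have one: "cexp \<mu> f w (\<lambda>_. 1) = 1" if "w \<in> RZ"
      using density_kernel.f_integral(2)[OF density_kernel_at] that by (simp add: cexp_def space_RZ)
    show "0 \<le> joint (\<lambda>_. 1) w" "joint (\<lambda>_. 1) w \<le> c0"
      using one fZ_pos[of w] fZ_le[of w] c0_nonneg joint_eq[of w "\<lambda>_. 1"] by (cases "w \<in> RZ"; simp add: joint_def)+
  qed
  finally have Ek: "expectation (\<lambda>\<omega>. ?k (Z \<omega>)) \<le> ?d * c0" .
  have F2: "(F (X \<omega>, Y \<omega>, Z \<omega>))\<^sup>2 \<le> (kmax / ?d\<^sup>2) * ?k (Z \<omega>)" if "\<omega> \<in> space M" for \<omega>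
  proof -
    have "(X \<omega>, Y \<omega>) \<in> space \<mu>"
      using measurable_space[OF X_meas that] measurable_space[OF Y_meas that] by (simp add: space_\<mu>)
    then have "(g (X \<omega>, Y \<omega>))\<^sup>2 \<le> 1" using g1 abs_square_le_1 by blast
    then have "(g (X \<omega>, Y \<omega>))\<^sup>2 * (?k (Z \<omega>) * ?k (Z \<omega>)) \<le> 1 * (kmax * ?k (Z \<omega>))"
      using k0_le k0_nonneg kmax_nonneg by (intro mult_mono) auto
    then have "(g (X \<omega>, Y \<omega>))\<^sup>2 * (?k (Z \<omega>) * ?k (Z \<omega>)) / ?d\<^sup>2 \<le> 1 * (kmax * ?k (Z \<omega>)) / ?d\<^sup>2"
      by (rule divide_right_mono) simp
    then show ?thesis by (simp add: F_def power_divide power_mult_distrib power2_eq_square mult_ac)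
  qed
  have "expectation (\<lambda>\<omega>. (F (X \<omega>, Y \<omega>, Z \<omega>))\<^sup>2) \<le> expectation (\<lambda>\<omega>. (kmax / ?d\<^sup>2) * ?k (Z \<omega>))"
  proof (rule integral_mono)
    have m: "(\<lambda>\<omega>. (F (X \<omega>, Y \<omega>, Z \<omega>))\<^sup>2) \<in> borel_measurable M"
      using measurable_compose[OF XYZ Fm] by simp
    show "integrable M (\<lambda>\<omega>. (F (X \<omega>, Y \<omega>, Z \<omega>))\<^sup>2)"
    proof (rule Bochner_Integration.integrable_bound[OF integrable_mult_right[OF ik, of "kmax / ?d\<^sup>2"] m], rule AE_I2)
      fix \<omega> assume \<omega>: "\<omega> \<in> space M"
      have "norm ((F (X \<omega>, Y \<omega>, Z \<omega>))\<^sup>2) = (F (X \<omega>, Y \<omega>, Z \<omega>))\<^sup>2" by simp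
      also have "\<dots> \<le> (kmax / ?d\<^sup>2) * ?k (Z \<omega>)" by (rule F2[OF \<omega>])
      also have "\<dots> \<le> norm ((kmax / ?d\<^sup>2) * ?k (Z \<omega>))" unfolding real_norm_def by (rule abs_ge_self)
      finally show "norm ((F (X \<omega>, Y \<omega>, Z \<omega>))\<^sup>2) \<le> norm ((kmax / ?d\<^sup>2) * ?k (Z \<omega>))" .
    qed
  qed (use ik F2 in auto)
  also have "\<dots> = (kmax / ?d\<^sup>2) * expectation (\<lambda>\<omega>. ?k (Z \<omega>))" by simp
  also have "\<dots> \<le> (kmax / ?d\<^sup>2) * (?d * c0)" using kmax_nonneg by (intro mult_left_mono Ek) auto
  also have "\<dots> = kmax * c0 / ?d" using d by (simp add: power2_eq_square)
  finally have s: "expectation (\<lambda>\<omega>. (F (X \<omega>, Y \<omega>, Z \<omega>))\<^sup>2) \<le> kmax * c0 / ?d" .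
  have ks: "ksum n h z g \<omega> = (\<Sum>i<n. F (Xs i \<omega>, Ys i \<omega>, Zs i \<omega>)) / real n" for \<omega>
    using d pos by (simp add: ksum_def F_def sum_divide_distrib[symmetric] mult.commute)
  have dev: "prob {\<omega> \<in> space M. t \<le> \<bar>ksum n h z g \<omega> - expectation (\<lambda>\<omega>. F (X \<omega>, Y \<omega>, Z \<omega>))\<bar>}
      \<le> (kmax * c0 / ?d) / (real n * t\<^sup>2)"
    unfolding ks by (rule iid_mean_deviation[OF sample_indep sample_distr XYZ Fm Fb s pos(3,4)])
  have bias: "\<bar>expectation (\<lambda>\<omega>. F (X \<omega>, Y \<omega>, Z \<omega>)) - fZ z * cexp \<mu> f z g\<bar> \<le> bias h e"
  proof -
    have "\<bar>(\<integral>w. ?k w * joint g w \<partial>lborel) / ?d - joint g z\<bar> \<le> bias h e"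
      unfolding bias_def A2_def
      using Lip_nonneg c0_nonneg joint_Lipschitz[OF g sub pos(1)]
      by (intro kernel_smoothing_bias k0_meas k0_nonneg k0_one k0_second joint_meas gb pos) auto
    then show ?thesis unfolding EF joint_eq[OF z] by (simp add: mult.commute)
  qed
  have "prob {\<omega> \<in> space M. t + bias h e \<le> \<bar>ksum n h z g \<omega> - fZ z * cexp \<mu> f z g\<bar>}
      \<le> prob {\<omega> \<in> space M. t \<le> \<bar>ksum n h z g \<omega> - expectation (\<lambda>\<omega>. F (X \<omega>, Y \<omega>, Z \<omega>))\<bar>}"
  proof (rule finite_measure_mono)
    note [measurable] = ksum_meas[OF gm]
    show "{\<omega> \<in> space M. t \<le> \<bar>ksum n h z g \<omega> - expectation (\<lambda>\<omega>. F (X \<omega>, Y \<omega>, Z \<omega>))\<bar>} \<in> events" by measurable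
  qed (use bias in auto)
  with dev show ?thesis by (simp add: mult_ac)
qed

lemma uniform_deviation:
  assumes G: "finite G" "G \<subseteq> unit_functions" and z: "\<And>k. k < N \<Longrightarrow> z k \<in> inner_region RZ e"
    and pos: "0 < e" "0 < h" "0 < t" "0 < n"
  shows "prob {\<omega> \<in> space M. \<forall>k<N. \<forall>g\<in>G. \<bar>ksum n h (z k) g \<omega> - fZ (z k) * cexp \<mu> f (z k) g\<bar> < t + bias h e}
    \<ge> 1 - real (N * card G) * (kmax * c0 / (real n * h ^ DIM('z) * t\<^sup>2))"
proof -
  let ?b = "kmax * c0 / (real n * h ^ DIM('z) * t\<^sup>2)"
  let ?B = "\<lambda>(k, g). {\<omega> \<in> space M. t + bias h e \<le> \<bar>ksum n h (z k) g \<omega> - fZ (z k) * cexp \<mu> f (z k) g\<bar>}"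
  let ?I = "{..<N} \<times> G"
  have fin: "finite ?I" using G by simp
  have ev: "?B kg \<in> events" if "kg \<in> ?I" for kg
  proof -
    obtain k g where kg: "kg = (k, g)" "g \<in> G" using \<open>kg \<in> ?I\<close> by auto
    then have [measurable]: "ksum n h (z k) g \<in> borel_measurable M"
      using G by (intro ksum_meas) (auto simp: unit_functions_def)
    show ?thesis unfolding kg by simp
  qed
  have "prob (\<Union>kg\<in>?I. ?B kg) \<le> (\<Sum>kg\<in>?I. prob (?B kg))"
    using ev fin by (intro finite_measure_subadditive_finite) auto
  also have "\<dots> \<le> (\<Sum>kg\<in>?I. ?b)"
  proof (rule sum_mono)
    fix kg assume "kg \<in> ?I"
    then obtain k g where kg: "kg = (k, g)" "g \<in> G" "k < N" by auto
    then show "prob (?B kg) \<le> ?b"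
      using ksum_deviation[of g "z k" e h t n] z[of k] G pos by (auto simp: inner_region_def)
  qed
  also have "\<dots> = real (N * card G) * ?b" by (simp add: card_cartesian_product)
  finally have "1 - real (N * card G) * ?b \<le> 1 - prob (\<Union>kg\<in>?I. ?B kg)" by simp
  also have "\<dots> = prob (space M - (\<Union>kg\<in>?I. ?B kg))"
    using ev fin by (intro prob_compl[symmetric] sets.finite_UN) auto
  also have "space M - (\<Union>kg\<in>?I. ?B kg)
      = {\<omega> \<in> space M. \<forall>k<N. \<forall>g\<in>G. \<bar>ksum n h (z k) g \<omega> - fZ (z k) * cexp \<mu> f (z k) g\<bar> < t + bias h e}"
    unfolding not_less[symmetric] by blast
  finally show ?thesis .
qed

end

section \<open>The estimated maximal correlation\<close>

lemma (in positive_functional) E_lincomb_square: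
  assumes "\<And>i. i < p \<Longrightarrow> U i \<in> D"
  shows "E (\<lambda>w. lincomb p a U w * lincomb p a U w) = (\<Sum>i<p. \<Sum>j<p. a i * E (\<lambda>w. U i w * U j w) * a j)"
proof -
  have "E (\<lambda>w. lincomb p a U w * lincomb p a U w) = E (\<lambda>w. \<Sum>i<p. \<Sum>j<p. (a i * a j) * (U i w * U j w))"
    by (simp add: lincomb_def sum_product mult_ac)
  also have "\<dots> = (\<Sum>i<p. \<Sum>j<p. (a i * a j) * E (\<lambda>w. U i w * U j w))"
    using assms by (simp add: E_sum D_sum D_scale D_mult E_scale)
  finally show ?thesis by (simp add: mult_ac)
qed

lemma (in positive_functional) moment_mat_lower_bound:
  assumes U: "\<And>i. i < p \<Longrightarrow> U i \<in> D" and "0 < p" and min: "\<delta> \<le> min_eigenvalue (moment_mat E p U)"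
  shows "\<delta> * (\<Sum>i<p. (a i)\<^sup>2) \<le> E (\<lambda>w. lincomb p a U w * lincomb p a U w)"
proof -
  have "min_eigenvalue (moment_mat E p U) * (\<Sum>i<p. (a i)\<^sup>2)
      \<le> (\<Sum>i<p. \<Sum>j<p. a i * moment_mat E p U $$ (i, j) * a j)"
    by (rule min_eigenvalue_rayleigh) (use \<open>0 < p\<close> in \<open>auto simp: moment_mat_def mult.commute\<close>)
  also have "\<dots> = (\<Sum>i<p. \<Sum>j<p. a i * E (\<lambda>w. U i w * U j w) * a j)"
    by (intro sum.cong refl) (simp add: moment_mat_def)
  also have "\<dots> = E (\<lambda>w. lincomb p a U w * lincomb p a U w)"
    using U by (simp add: E_lincomb_square)
  finally have "min_eigenvalue (moment_mat E p U) * (\<Sum>i<p. (a i)\<^sup>2) \<le> E (\<lambda>w. lincomb p a U w * lincomb p a U w)" .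
  moreover have "\<delta> * (\<Sum>i<p. (a i)\<^sup>2) \<le> min_eigenvalue (moment_mat E p U) * (\<Sum>i<p. (a i)\<^sup>2)"
    by (rule mult_right_mono[OF min]) (simp add: sum_nonneg)
  ultimately show ?thesis by simp
qed

lemma ratio_perturb:
  fixes F m r r1 \<tau> c :: real
  assumes c: "0 < c" "1 / c \<le> F" "\<tau> \<le> 1 / (2 * c)" and m: "\<bar>m\<bar> \<le> 1" and r: "\<bar>r\<bar> < \<tau>" "\<bar>r1\<bar> < \<tau>"
  shows "\<bar>(F * m + r) / (F + r1) - m\<bar> \<le> 4 * c * \<tau>"
proof -
  have half: "1 / c = 1 / (2 * c) + 1 / (2 * c)" using c by (simp add: field_simps)
  have pos: "1 / (2 * c) \<le> F + r1" using c r half by linarith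
  have pc: "0 < 1 / (2 * c)" using c by simp
  have pos2: "0 < F + r1" using pos pc by linarith
  then have "(F * m + r) / (F + r1) - m = (r - m * r1) / (F + r1)" by (simp add: field_simps)
  then have "\<bar>(F * m + r) / (F + r1) - m\<bar> = \<bar>r - m * r1\<bar> / (F + r1)" using pos2 by simp
  also have "\<dots> \<le> (2 * \<tau>) / (1 / (2 * c))"
  proof (rule frac_le)
    have "\<bar>m * r1\<bar> \<le> 1 * \<bar>r1\<bar>" unfolding abs_mult by (intro mult_right_mono m) simp
    then show "\<bar>r - m * r1\<bar> \<le> 2 * \<tau>" using r by linarith
  qed (use pos pc r in auto)
  also have "\<dots> = 4 * c * \<tau>" using c by simp
  finally show ?thesis .
qed

context kernel_setting
begin

abbreviation est where
  "est n h z \<omega> \<equiv> kernel_cexp k0 h n (\<lambda>i. (Xs i \<omega>, Ys i \<omega>)) (\<lambda>i. Zs i \<omega>) z"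

text \<open>
  Products, because covariances involve second moments; the factor \<open>1\<close> contributes the basis functions
  themselves and the density estimator.
\<close>

definition test_functions :: "nat \<Rightarrow> (nat \<Rightarrow> 'x \<times> 'y \<Rightarrow> real) \<Rightarrow> nat \<Rightarrow> (nat \<Rightarrow> 'x \<times> 'y \<Rightarrow> real) \<Rightarrow> ('x \<times> 'y \<Rightarrow> real) set" where
  "test_functions p U q V = (\<lambda>(g, k) w. g w * k w) `
     (insert (\<lambda>_. 1) (U ` {..<p} \<union> V ` {..<q}) \<times> insert (\<lambda>_. 1) (U ` {..<p} \<union> V ` {..<q}))"

lemma test_functions_unit:
  assumes "\<And>i. i < p \<Longrightarrow> U i \<in> unit_functions" "\<And>j. j < q \<Longrightarrow> V j \<in> unit_functions"
  shows "test_functions p U q V \<subseteq> unit_functions"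
proof -
  have "(\<lambda>w. g w * k w) \<in> unit_functions" if "g \<in> unit_functions" "k \<in> unit_functions" for g k
  proof -
    have "\<bar>g v * k v\<bar> \<le> 1" if "v \<in> space \<mu>" for v
      using that \<open>g \<in> unit_functions\<close> \<open>k \<in> unit_functions\<close> mult_mono[of "\<bar>g v\<bar>" 1 "\<bar>k v\<bar>" 1]
      by (simp add: unit_functions_def abs_mult)
    then show ?thesis using that by (simp add: unit_functions_def borel_measurable_times)
  qed
  then show ?thesis using assms one_unit unfolding test_functions_def by auto
qed

lemma test_functions_finite: "finite (test_functions p U q V)"
  unfolding test_functions_def by simp

lemma test_functions_card: "card (test_functions p U q V) \<le> (p + q + 1)\<^sup>2"
proof -
  let ?B = "insert (\<lambda>_. 1) (U ` {..<p} \<union> V ` {..<q})"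
  have "card ?B \<le> Suc (card (U ` {..<p} \<union> V ` {..<q}))" by (rule card_insert_le_m1[OF zero_less_Suc]) simp
  also have "card (U ` {..<p} \<union> V ` {..<q}) \<le> card (U ` {..<p}) + card (V ` {..<q})" by (rule card_Un_le)
  also have "\<dots> \<le> p + q" using card_image_le[of "{..<p}" U] card_image_le[of "{..<q}" V] by simp
  finally have B: "card ?B \<le> p + q + 1" by simp
  have "card (test_functions p U q V) \<le> card (?B \<times> ?B)" unfolding test_functions_def by (rule card_image_le) simp
  also have "\<dots> \<le> (p + q + 1) * (p + q + 1)" unfolding card_cartesian_product by (rule mult_le_mono[OF B B])
  finally show ?thesis by (simp add: power2_eq_square)
qed

text \<open>
  On the event that all kernel averages at \<open>z\<close> are \<open>\<tau>\<close>-close to their limits, the ratios that define the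
  estimator are \<open>4 c1 \<tau>\<close>-close since the density is at least \<open>1 / c1\<close>, and the estimated covariances are
  \<open>12 c1 \<tau>\<close>-close.  The rest is \<open>max_corr_perturb\<close>.
\<close>

lemma point_bound:
  assumes z: "z \<in> RZ" and \<omega>: "\<omega> \<in> space M" and pos: "0 < n" "0 < h"
    and U: "\<And>i. i < p \<Longrightarrow> U i \<in> unit_functions" and V: "\<And>j. j < q \<Longrightarrow> V j \<in> unit_functions"
    and pq: "0 < p" "0 < q"
    and a0: "\<And>v. v \<in> space \<mu> \<Longrightarrow> lincomb p a0 U v = 1" and b0: "\<And>v. v \<in> space \<mu> \<Longrightarrow> lincomb q b0 V v = 1"
    and \<delta>: "0 < \<delta>" "\<delta> \<le> min_eigenvalue (moment_mat (cexp \<mu> f z) p U)" "\<delta> \<le> min_eigenvalue (moment_mat (cexp \<mu> f z) q V)"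
    and close: "\<And>g. g \<in> test_functions p U q V \<Longrightarrow> \<bar>ksum n h z g \<omega> - fZ z * cexp \<mu> f z g\<bar> < \<tau>"
    and \<tau>: "0 \<le> \<tau>" "\<tau> \<le> 1 / (2 * c1)"
  shows "fZ z * (max_corr (cexp \<mu> f z) p U q V)\<^sup>2 - (96 * c0 * c1 * (\<tau> * (real (p + q) / \<delta>)) + \<tau>)
    \<le> kernel_density k0 h n (\<lambda>i. Zs i \<omega>) z * (max_corr (est n h z \<omega>) p U q V)\<^sup>2"
proof -
  have dens: "kernel_density k0 h n (\<lambda>i. Zs i \<omega>) z = ksum n h z (\<lambda>_. 1) \<omega>"
    by (simp add: kernel_density_def ksum_def)
  have est: "est n h z \<omega> g = ksum n h z g \<omega> / ksum n h z (\<lambda>_. 1) \<omega>" for g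
    using pos by (simp add: kernel_cexp_def ksum_def)
  interpret dk: density_kernel \<mu> f z by (rule density_kernel_at) (simp add: z space_RZ)
  interpret A: functional_families "cexp \<mu> f z" "bounded_measurable \<mu>" p U q V
    by (rule families_at) (use z U V unit_bounded in \<open>auto simp: space_RZ\<close>)
  let ?B = "insert (\<lambda>_. 1) (U ` {..<p} \<union> V ` {..<q})"
  have prod_in: "(\<lambda>w. g w * k w) \<in> test_functions p U q V" if "g \<in> ?B" "k \<in> ?B" for g k
    unfolding test_functions_def using that by (intro image_eqI[of _ _ "(g, k)"]) auto
  have one_in: "g \<in> test_functions p U q V" if "g \<in> ?B" for g
    using prod_in[OF that, of "\<lambda>_. 1"] by simp
  have tu: "test_functions p U q V \<subseteq> unit_functions" by (rule test_functions_unit[OF U V])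
  have c1: "0 < c1" by (rule c1_pos)
  have cone: "cexp \<mu> f z (\<lambda>_. 1) = 1" by (rule A.E_one)
  have fclose: "\<bar>ksum n h z (\<lambda>_. 1) \<omega> - fZ z\<bar> < \<tau>" using close[OF one_in, of "\<lambda>_. 1"] cone by simp
  have half: "1 / c1 = 1 / (2 * c1) + 1 / (2 * c1)" using c1 by (simp add: field_simps)
  have kpos: "0 < ksum n h z (\<lambda>_. 1) \<omega>"
  proof -
    have "0 < 1 / (2 * c1)" using c1 by simp
    then show ?thesis using fclose fZ_ge[OF z] \<tau>(2) half by linarith
  qed
  have wpos: "0 < (\<Sum>i<n. k0 ((1 / h) *\<^sub>R (z - Zs i \<omega>)))"
  proof -
    have "0 < real n * h ^ DIM('z)" using pos by simp
    from mult_pos_pos[OF kpos this] show ?thesis using pos by (simp add: ksum_def)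
  qed
  interpret B: functional_families "est n h z \<omega>" UNIV p U q V
    unfolding functional_families_def functional_families_axioms_def
    using kernel_cexp_positive_functional[OF k0_nonneg wpos] by simp
  have eclose: "\<bar>est n h z \<omega> g - cexp \<mu> f z g\<bar> \<le> 4 * c1 * \<tau>" if "g \<in> test_functions p U q V" for g
  proof -
    have "\<bar>(fZ z * cexp \<mu> f z g + (ksum n h z g \<omega> - fZ z * cexp \<mu> f z g)) / (fZ z + (ksum n h z (\<lambda>_. 1) \<omega> - fZ z)) - cexp \<mu> f z g\<bar>
        \<le> 4 * c1 * \<tau>"
      using c1 fZ_ge[OF z] \<tau>(2) cexp_unit_le[OF z] tu that close[OF that] fclose by (intro ratio_perturb) auto
    then show ?thesis by (simp add: est)
  qed
  have e1: "\<bar>est n h z \<omega> g\<bar> \<le> 1" if "g \<in> unit_functions" for g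
  proof -
    have "\<bar>\<Sum>i<n. g (Xs i \<omega>, Ys i \<omega>) * k0 ((1 / h) *\<^sub>R (z - Zs i \<omega>))\<bar>
      \<le> (\<Sum>i<n. 1 * k0 ((1 / h) *\<^sub>R (z - Zs i \<omega>)))"
    proof (rule order_trans[OF sum_abs sum_mono])
      fix i
      have "\<bar>g (Xs i \<omega>, Ys i \<omega>)\<bar> \<le> 1" using that sample_space[OF \<omega>] by (simp add: unit_functions_def)
      then show "\<bar>g (Xs i \<omega>, Ys i \<omega>) * k0 ((1 / h) *\<^sub>R (z - Zs i \<omega>))\<bar> \<le> 1 * k0 ((1 / h) *\<^sub>R (z - Zs i \<omega>))"
        unfolding abs_mult abs_of_nonneg[OF k0_nonneg] by (rule mult_right_mono[OF _ k0_nonneg])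
    qed
    then show ?thesis using wpos by (simp add: kernel_cexp_def abs_divide divide_le_eq)
  qed
  have cov: "\<bar>cov_of (cexp \<mu> f z) g k - cov_of (est n h z \<omega>) g k\<bar> \<le> 12 * c1 * \<tau>" if gk: "g \<in> ?B" "k \<in> ?B" for g k
  proof -
    let ?E = "cexp \<mu> f z" and ?E' = "est n h z \<omega>"
    have u: "\<bar>?E g\<bar> \<le> 1" "\<bar>?E' k\<bar> \<le> 1"
      by (rule cexp_unit_le[OF z subsetD[OF tu one_in[OF gk(1)]]], rule e1[OF subsetD[OF tu one_in[OF gk(2)]]])
    note ec = eclose[OF prod_in[OF gk]] eclose[OF one_in[OF gk(1)]] eclose[OF one_in[OF gk(2)]]
    have eq: "cov_of ?E g k - cov_of ?E' g k = - (?E' (\<lambda>w. g w * k w) - ?E (\<lambda>w. g w * k w))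
        + ?E g * (?E' k - ?E k) + (?E' g - ?E g) * ?E' k"
      by (simp add: cov_of_def algebra_simps)
    have "\<bar>?E g * (?E' k - ?E k)\<bar> \<le> 1 * (4 * c1 * \<tau>)" unfolding abs_mult
      by (rule mult_mono[OF u(1) ec(3)]) auto
    moreover have "\<bar>(?E' g - ?E g) * ?E' k\<bar> \<le> (4 * c1 * \<tau>) * 1" unfolding abs_mult
      using c1 \<tau> by (intro mult_mono[OF ec(2) u(2)]) auto
    ultimately show ?thesis using ec(1) unfolding eq by linarith
  qed
  have oneU: "cexp \<mu> f z (lincomb p a0 U) = 1" "cexp \<mu> f z (\<lambda>w. lincomb p a0 U w * lincomb p a0 U w) = 1"
    using a0 dk.cexp_cong[of "lincomb p a0 U" "\<lambda>_. 1"]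
      dk.cexp_cong[of "\<lambda>w. lincomb p a0 U w * lincomb p a0 U w" "\<lambda>_. 1"] cone by simp_all
  have oneV: "cexp \<mu> f z (lincomb q b0 V) = 1" "cexp \<mu> f z (\<lambda>w. lincomb q b0 V w * lincomb q b0 V w) = 1"
    using b0 dk.cexp_cong[of "lincomb q b0 V" "\<lambda>_. 1"]
      dk.cexp_cong[of "\<lambda>w. lincomb q b0 V w * lincomb q b0 V w" "\<lambda>_. 1"] cone by simp_all
  let ?x = "(max_corr (cexp \<mu> f z) p U q V)\<^sup>2" and ?y = "(max_corr (est n h z \<omega>) p U q V)\<^sup>2"
  define \<kappa> where "\<kappa> = 8 * ((12 * c1 * \<tau>) * (real (p + q) / \<delta>))"
  have xy: "?x - \<kappa> \<le> ?y"
    unfolding \<kappa>_def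
  proof (rule max_corr_perturb[OF A.functional_families_axioms B.functional_families_axioms \<delta>(1) _ oneU oneV])
    show "0 \<le> 12 * c1 * \<tau>" using c1 \<tau> by simp
    show "\<delta> * (\<Sum>i<p. (a i)\<^sup>2) \<le> cexp \<mu> f z (\<lambda>w. lincomb p a U w * lincomb p a U w)" for a
      by (rule A.moment_mat_lower_bound[OF A.U_D pq(1) \<delta>(2)])
    show "\<delta> * (\<Sum>i<q. (b i)\<^sup>2) \<le> cexp \<mu> f z (\<lambda>w. lincomb q b V w * lincomb q b V w)" for b
      by (rule A.moment_mat_lower_bound[OF A.V_D pq(2) \<delta>(3)])
  qed (auto intro!: cov)
  have x1: "0 \<le> ?x" "?x \<le> 1" using A.max_corr_range by (auto simp: power_le_one)
  have y0: "0 \<le> ?y" by simp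
  have \<kappa>0: "0 \<le> \<kappa>" using c1 \<tau> \<delta> by (simp add: \<kappa>_def)
  have Fm: "0 \<le> fZ z - \<tau>"
  proof -
    have "0 < 1 / (2 * c1)" using c1 by simp
    then show ?thesis using fZ_ge[OF z] \<tau>(2) half by linarith
  qed
  have "fZ z * ?x - (c0 * \<kappa> + \<tau>) \<le> (fZ z - \<tau>) * (?x - \<kappa>)"
  proof -
    have "fZ z * \<kappa> \<le> c0 * \<kappa>" using fZ_le[OF z] \<kappa>0 by (rule mult_right_mono)
    moreover have "\<tau> * ?x \<le> \<tau> * 1" using \<tau>(1) x1(2) by (intro mult_left_mono)
    moreover have "0 \<le> \<tau> * \<kappa>" using \<tau> \<kappa>0 by simp
    moreover have "(fZ z - \<tau>) * (?x - \<kappa>) = fZ z * ?x - fZ z * \<kappa> - \<tau> * ?x + \<tau> * \<kappa>" by (simp add: algebra_simps)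
    ultimately show ?thesis by linarith
  qed
  also have "\<dots> \<le> (fZ z - \<tau>) * ?y" using xy Fm by (rule mult_left_mono)
  also have "\<dots> \<le> ksum n h z (\<lambda>_. 1) \<omega> * ?y" using fclose y0 by (intro mult_right_mono) auto
  finally show ?thesis unfolding dens by (simp add: \<kappa>_def mult_ac)
qed

lemma kernel_weight_meas: "(\<lambda>\<omega>. k0 ((1 / h) *\<^sub>R (z - Zs i \<omega>))) \<in> borel_measurable M"
  using kernel_sum_term_meas[where g="\<lambda>_. 1"] by simp

lemma est_measurable: "g \<in> borel_measurable \<mu> \<Longrightarrow> (\<lambda>\<omega>. est n h z \<omega> g) \<in> borel_measurable M"
  unfolding kernel_cexp_def
  by (intro borel_measurable_divide borel_measurable_sum kernel_sum_term_meas kernel_weight_meas)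

text \<open>
  If all kernel weights vanish, the estimator is the zero functional, which is not positive with total
  mass \<open>1\<close>; its maximal correlation is \<open>0\<close> by convention.
\<close>

lemma max_corr_est_measurable:
  assumes U: "\<And>i. i < p \<Longrightarrow> U i \<in> unit_functions" and V: "\<And>j. j < q \<Longrightarrow> V j \<in> unit_functions"
  shows "(\<lambda>\<omega>. max_corr (est n h z \<omega>) p U q V) \<in> borel_measurable M"
proof (rule max_corr_measurable[where good="\<lambda>\<omega>. 0 < (\<Sum>i<n. k0 ((1 / h) *\<^sub>R (z - Zs i \<omega>)))" and D="\<lambda>_. UNIV"])
  have [measurable]: "(\<lambda>\<omega>. \<Sum>i<n. k0 ((1 / h) *\<^sub>R (z - Zs i \<omega>))) \<in> borel_measurable M"
    by (intro borel_measurable_sum kernel_weight_meas)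
  show "{\<omega> \<in> space M. 0 < (\<Sum>i<n. k0 ((1 / h) *\<^sub>R (z - Zs i \<omega>)))} \<in> events" by measurable
  fix \<omega>
  show "functional_families (est n h z \<omega>) UNIV p U q V" if "0 < (\<Sum>i<n. k0 ((1 / h) *\<^sub>R (z - Zs i \<omega>)))"
    unfolding functional_families_def functional_families_axioms_def
    using kernel_cexp_positive_functional[OF k0_nonneg that] by simp
  show "max_corr (est n h z \<omega>) p U q V = 0" if "\<not> 0 < (\<Sum>i<n. k0 ((1 / h) *\<^sub>R (z - Zs i \<omega>)))"
  proof -
    have "0 \<le> (\<Sum>i<n. k0 ((1 / h) *\<^sub>R (z - Zs i \<omega>)))" by (intro sum_nonneg k0_nonneg)
    then have "(\<Sum>i<n. k0 ((1 / h) *\<^sub>R (z - Zs i \<omega>))) = 0" using that by simp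
    then have "est n h z \<omega> g = 0" for g by (simp add: kernel_cexp_def)
    then have "cov_mat (est n h z \<omega>) p U p U = 0\<^sub>m p p" by (intro eq_matI) (auto simp: cov_mat_def)
    then show ?thesis by (simp add: max_corr_def Let_def)
  qed
next
  have c: "(\<lambda>\<omega>. cov_of (est n h z \<omega>) g k) \<in> borel_measurable M"
    if "g \<in> unit_functions" "k \<in> unit_functions" for g k
    unfolding cov_of_def using that
    by (intro borel_measurable_diff borel_measurable_times est_measurable) (auto simp: unit_functions_def)
  show "(\<lambda>\<omega>. cov_of (est n h z \<omega>) (U i) (U j)) \<in> borel_measurable M" if "i < p" "j < p" for i j
    using that U by (intro c) auto
  show "(\<lambda>\<omega>. cov_of (est n h z \<omega>) (V i) (V j)) \<in> borel_measurable M" if "i < q" "j < q" for i j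
    using that V by (intro c) auto
  show "(\<lambda>\<omega>. cov_of (est n h z \<omega>) (U i) (V j)) \<in> borel_measurable M" if "i < p" "j < q" for i j
    using that U V by (intro c) auto
qed

lemma test_stat_measurable:
  assumes "\<And>i. i < p \<Longrightarrow> (\<lambda>w. \<phi> p i (fst w)) \<in> unit_functions" "\<And>j. j < q \<Longrightarrow> (\<lambda>w. \<psi> q j (snd w)) \<in> unit_functions"
  shows "(\<lambda>\<omega>. test_stat \<phi> \<psi> k0 h p q N z n (\<lambda>i. (Xs i \<omega>, Ys i \<omega>)) (\<lambda>i. Zs i \<omega>)) \<in> borel_measurable M"
proof -
  have "(\<lambda>\<omega>. kernel_density k0 h n (\<lambda>i. Zs i \<omega>) z) \<in> borel_measurable M" for z
    unfolding kernel_density_def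
    by (intro borel_measurable_divide borel_measurable_sum kernel_weight_meas borel_measurable_const)
  then show ?thesis
    unfolding test_stat_def rho_def
    by (intro borel_measurable_divide borel_measurable_diff borel_measurable_times borel_measurable_const
        borel_measurable_sum borel_measurable_power max_corr_est_measurable assms)
qed

end

section \<open>Power of the test and consistency\<close>

context kernel_setting
begin

lemma kernel_const_pos: "0 < kernel_const k0"
proof -
  have i0: "integrable lborel k0" "(\<integral>u. k0 u \<partial>lborel) = 1" using k0_one by (auto simp: has_bochner_integral_iff)
  have le: "(k0 u)\<^sup>2 \<le> kmax * k0 u" for u
    unfolding power2_eq_square by (intro mult_right_mono k0_le k0_nonneg)
  have i2: "integrable lborel (\<lambda>u. (k0 u)\<^sup>2)"
    by (rule Bochner_Integration.integrable_bound[OF integrable_mult_right[OF i0(1), of kmax]])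
      (measurable, simp add: abs_mult le kmax_nonneg k0_nonneg)
  have "(\<integral>u. (k0 u)\<^sup>2 \<partial>lborel) \<noteq> 0"
  proof
    assume "(\<integral>u. (k0 u)\<^sup>2 \<partial>lborel) = 0"
    then have "AE u in lborel. (k0 u)\<^sup>2 = 0" using integral_nonneg_eq_0_iff_AE[OF i2] by simp
    then have "AE u in lborel. k0 u = 0" by simp
    then have "(\<integral>u. k0 u \<partial>lborel) = 0" using integral_cong_AE[of k0 lborel "\<lambda>_. 0"] by simp
    then show False using i0 by simp
  qed
  moreover have "0 \<le> (\<integral>u. (k0 u)\<^sup>2 \<partial>lborel)" by simp
  ultimately have "0 < (\<integral>u. (k0 u)\<^sup>2 \<partial>lborel)" by linarith
  then show ?thesis by (simp add: kernel_const_def)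
qed

text \<open>
  On the event of uniform closeness, whose probability is bounded below by \<open>uniform_deviation\<close>, at least
  half of the signal \<open>N b\<close> survives estimation.  The mean of the Wishart eigenvalue costs at most
  \<open>(p + q)\<^sup>2\<close> per evaluation point, and its standard deviation is at most \<open>2 (p + q)\<^sup>2\<close>.
\<close>

lemma test_power_bound:
  fixes \<phi> :: "nat \<Rightarrow> nat \<Rightarrow> 'x \<Rightarrow> real" and \<psi> :: "nat \<Rightarrow> nat \<Rightarrow> 'y \<Rightarrow> real" and z :: "nat \<Rightarrow> 'z"
  assumes pq: "2 \<le> p" "2 \<le> q" and N: "1 \<le> N" and pos: "0 < n" "0 < h" "0 < e" "0 < t" "0 < \<delta>" "0 < b"
    and U: "\<And>i. i < p \<Longrightarrow> (\<lambda>w. \<phi> p i (fst w)) \<in> unit_functions"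
    and V: "\<And>j. j < q \<Longrightarrow> (\<lambda>w. \<psi> q j (snd w)) \<in> unit_functions"
    and a0: "\<And>x. x \<in> RX \<Longrightarrow> (\<Sum>i<p. a0 i * \<phi> p i x) = 1" and b0: "\<And>y. y \<in> RY \<Longrightarrow> (\<Sum>j<q. b0 j * \<psi> q j y) = 1"
    and z: "\<And>k. k < N \<Longrightarrow> z k \<in> inner_region RZ e"
    and \<delta>U: "\<And>k. k < N \<Longrightarrow> \<delta> \<le> min_eigenvalue (moment_mat (cexp \<mu> f (z k)) p (\<lambda>i v. \<phi> p i (fst v)))"
    and \<delta>V: "\<And>k. k < N \<Longrightarrow> \<delta> \<le> min_eigenvalue (moment_mat (cexp \<mu> f (z k)) q (\<lambda>j v. \<psi> q j (snd v)))"
    and \<tau>: "t + bias h e \<le> \<tau>" "\<tau> \<le> 1 / (2 * c1)" "96 * c0 * c1 * (\<tau> * (real (p + q) / \<delta>)) + \<tau> \<le> b / 2"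
    and rho: "real N * b \<le> (\<Sum>k<N. fZ (z k) * (rho \<phi> \<psi> p q (cexp \<mu> f (z k)))\<^sup>2)"
    and big: "(real (p + q))\<^sup>2 \<le> real n * h ^ DIM('z) * kernel_const k0 * (b / 2)"
      "x \<le> (real n * h ^ DIM('z) * kernel_const k0 * (b / 2) - (real (p + q))\<^sup>2) / (2 * (real (p + q))\<^sup>2)"
  shows "1 - real (N * (p + q + 1)\<^sup>2) * (kmax * c0 / (real n * h ^ DIM('z) * t\<^sup>2))
    \<le> prob {\<omega> \<in> space M. x \<le> test_stat \<phi> \<psi> k0 h p q N z n (\<lambda>i. (Xs i \<omega>, Ys i \<omega>)) (\<lambda>i. Zs i \<omega>)}"
proof -
  define U' V' where "U' = (\<lambda>i (w :: 'x \<times> 'y). \<phi> p i (fst w))" and "V' = (\<lambda>j (w :: 'x \<times> 'y). \<psi> q j (snd w))"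
  let ?G = "test_functions p U' q V'"
  let ?A = "{\<omega> \<in> space M. \<forall>k<N. \<forall>g\<in>?G. \<bar>ksum n h (z k) g \<omega> - fZ (z k) * cexp \<mu> f (z k) g\<bar> < t + bias h e}"
  let ?T = "\<lambda>\<omega>. test_stat \<phi> \<psi> k0 h p q N z n (\<lambda>i. (Xs i \<omega>, Ys i \<omega>)) (\<lambda>i. Zs i \<omega>)"
  let ?s = "real (p + q)"
  have U': "U' i \<in> unit_functions" if "i < p" for i using U[OF that] by (simp add: U'_def)
  have V': "V' j \<in> unit_functions" if "j < q" for j using V[OF that] by (simp add: V'_def)
  have bias0: "0 \<le> bias h e" unfolding bias_def using Lip_nonneg A2_nonneg c0_nonneg pos by simp
  have \<tau>0: "0 \<le> \<tau>" using \<tau>(1) bias0 pos by linarith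
  have s: "0 < ?s" using pq by simp
  define R where "R = real n * h ^ DIM('z) * kernel_const k0"
  have R: "0 < R" unfolding R_def using pos kernel_const_pos by simp
  have sub: "?A \<subseteq> {\<omega> \<in> space M. x \<le> ?T \<omega>}"
  proof safe
    fix \<omega> assume \<omega>: "\<omega> \<in> space M"
      and close: "\<forall>k<N. \<forall>g\<in>?G. \<bar>ksum n h (z k) g \<omega> - fZ (z k) * cexp \<mu> f (z k) g\<bar> < t + bias h e"
    let ?S = "\<Sum>k<N. kernel_density k0 h n (\<lambda>i. Zs i \<omega>) (z k) * (rho \<phi> \<psi> p q (est n h (z k) \<omega>))\<^sup>2"
    have pt: "fZ (z k) * (rho \<phi> \<psi> p q (cexp \<mu> f (z k)))\<^sup>2 - b / 2
        \<le> kernel_density k0 h n (\<lambda>i. Zs i \<omega>) (z k) * (rho \<phi> \<psi> p q (est n h (z k) \<omega>))\<^sup>2" if k: "k < N" for k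
    proof -
      have zk: "z k \<in> RZ" using z[OF k] by (simp add: inner_region_def)
      have "fZ (z k) * (max_corr (cexp \<mu> f (z k)) p U' q V')\<^sup>2 - (96 * c0 * c1 * (\<tau> * (?s / \<delta>)) + \<tau>)
        \<le> kernel_density k0 h n (\<lambda>i. Zs i \<omega>) (z k) * (max_corr (est n h (z k) \<omega>) p U' q V')\<^sup>2"
      proof (rule point_bound[OF zk \<omega> pos(1,2) U' V'])
        show "lincomb p a0 U' v = 1" if "v \<in> space \<mu>" for v
          using a0[of "fst v"] that by (auto simp: lincomb_def U'_def space_\<mu>')
        show "lincomb q b0 V' v = 1" if "v \<in> space \<mu>" for v
          using b0[of "snd v"] that by (auto simp: lincomb_def V'_def space_\<mu>')
        show "\<bar>ksum n h (z k) g \<omega> - fZ (z k) * cexp \<mu> f (z k) g\<bar> < \<tau>" if "g \<in> ?G" for g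
          using close k that \<tau>(1) by (meson less_le_trans)
        show "\<delta> \<le> min_eigenvalue (moment_mat (cexp \<mu> f (z k)) p U')" using \<delta>U[OF k] by (simp add: U'_def)
        show "\<delta> \<le> min_eigenvalue (moment_mat (cexp \<mu> f (z k)) q V')" using \<delta>V[OF k] by (simp add: V'_def)
      qed (use pq pos \<tau>0 \<tau> in auto)
      then show ?thesis using \<tau>(3) unfolding rho_def U'_def V'_def by linarith
    qed
    have "real N * b - real N * (b / 2) \<le> (\<Sum>k<N. fZ (z k) * (rho \<phi> \<psi> p q (cexp \<mu> f (z k)))\<^sup>2 - b / 2)"
      using rho by (simp add: sum_subtractf mult.commute)
    also have "\<dots> \<le> ?S" by (intro sum_mono pt) simp
    finally have S: "real N * (b / 2) \<le> ?S" by (simp add: mult.commute)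
    have pqs: "real (p * q) \<le> ?s\<^sup>2"
      by (simp add: power2_eq_square algebra_simps)
    have W: "wishart_mean p q \<le> real (p * q)" "0 < wishart_var p q" "wishart_var p q \<le> 3 * (real (p * q))\<^sup>2"
      using wishart_bounds[OF pq] by auto
    have N1: "1 \<le> real N" using N by simp
    have "real N * (R * (b / 2) - ?s\<^sup>2) \<le> R * ?S - real N * wishart_mean p q"
    proof -
      have "R * (real N * (b / 2)) \<le> R * ?S" using R by (intro mult_left_mono[OF S]) simp
      moreover have "real N * wishart_mean p q \<le> real N * ?s\<^sup>2" using W(1) pqs by (intro mult_left_mono) auto
      ultimately show ?thesis by (simp add: right_diff_distrib mult_ac)
    qed
    moreover have "sqrt (real N * wishart_var p q) \<le> real N * (2 * ?s\<^sup>2)"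
    proof (rule real_le_lsqrt)
      have "(real (p * q))\<^sup>2 \<le> (?s\<^sup>2)\<^sup>2" using pqs by (intro power_mono) auto
      then have "wishart_var p q \<le> 4 * (?s\<^sup>2)\<^sup>2" using W(3) zero_le_power2[of "?s\<^sup>2"] by linarith
      then have "real N * wishart_var p q \<le> (real N * real N) * (4 * (?s\<^sup>2)\<^sup>2)"
        using N1 W(2) by (intro mult_mono) auto
      then show "real N * wishart_var p q \<le> (real N * (2 * ?s\<^sup>2))\<^sup>2" by (simp add: power2_eq_square mult_ac)
    qed simp
    moreover have "0 < sqrt (real N * wishart_var p q)" using N1 W(2) by simp
    moreover have "0 \<le> real N * (R * (b / 2) - ?s\<^sup>2)" using big(1) N1 unfolding R_def by (intro mult_nonneg_nonneg) auto
    ultimately have "real N * (R * (b / 2) - ?s\<^sup>2) / (real N * (2 * ?s\<^sup>2))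
        \<le> (R * ?S - real N * wishart_mean p q) / sqrt (real N * wishart_var p q)"
      by (intro frac_le) linarith+
    moreover have "real N * (R * (b / 2) - ?s\<^sup>2) / (real N * (2 * ?s\<^sup>2)) = (R * (b / 2) - ?s\<^sup>2) / (2 * ?s\<^sup>2)"
      using N1 by simp
    ultimately show "x \<le> ?T \<omega>" using big(2) unfolding test_stat_def R_def by linarith
  qed
  have "1 - real (N * (p + q + 1)\<^sup>2) * (kmax * c0 / (real n * h ^ DIM('z) * t\<^sup>2))
      \<le> 1 - real (N * card ?G) * (kmax * c0 / (real n * h ^ DIM('z) * t\<^sup>2))"
    using test_functions_card[of p U' q V'] kmax_nonneg c0_nonneg pos
    by (intro diff_left_mono mult_right_mono of_nat_mono mult_le_mono2) auto
  also have "\<dots> \<le> prob ?A"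
    by (rule uniform_deviation[OF test_functions_finite test_functions_unit[OF U' V'] z pos(3,2,4,1)])
  also have "\<dots> \<le> prob {\<omega> \<in> space M. x \<le> ?T \<omega>}"
  proof (rule finite_measure_mono[OF sub])
    have [measurable]: "?T \<in> borel_measurable M" by (rule test_stat_measurable[where \<phi>=\<phi> and \<psi>=\<psi> and p=p and q=q, OF U V])
    show "{\<omega> \<in> space M. x \<le> ?T \<omega>} \<in> events" by measurable
  qed
  finally show ?thesis .
qed

end

theorem mainTheorem3:
  fixes M :: "'m measure"
    and X :: "'m \<Rightarrow> 'x::euclidean_space" and Y :: "'m \<Rightarrow> 'y::euclidean_space"
    and Z :: "'m \<Rightarrow> 'z::euclidean_space"
    and Xs :: "nat \<Rightarrow> 'm \<Rightarrow> 'x" and Ys :: "nat \<Rightarrow> 'm \<Rightarrow> 'y" and Zs :: "nat \<Rightarrow> 'm \<Rightarrow> 'z"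
    and RX :: "'x set" and RY :: "'y set" and RZ :: "'z set"
    and L1 L2 L3 :: "nat set"
    and \<phi> :: "nat \<Rightarrow> nat \<Rightarrow> 'x \<Rightarrow> real" and \<psi> :: "nat \<Rightarrow> nat \<Rightarrow> 'y \<Rightarrow> real"
    and \<theta> :: "nat \<Rightarrow> nat \<Rightarrow> 'z \<Rightarrow> real"
    and \<mu> :: "('x \<times> 'y) measure" and f :: "'x \<times> 'y \<Rightarrow> 'z \<Rightarrow> real" and fZ :: "'z \<Rightarrow> real"
    and hbar :: "'x \<times> 'y \<Rightarrow> real" and c0 c1 :: real
    and k0 :: "'z \<Rightarrow> real" and \<gamma>2 \<gamma>3 :: real
    and h \<epsilon> \<delta> \<eta> :: "nat \<Rightarrow> real" and c31 c32 \<alpha> \<beta> c3 a :: real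
    and p q nZ :: "nat \<Rightarrow> nat" and z :: "nat \<Rightarrow> nat \<Rightarrow> 'z"
  \<comment> \<open>random vectors, their ranges, and the sample\<close>
  assumes "prob_space M"
    and "RZ \<in> sets borel"
    and "X \<in> measurable M (borel_on RX)" and "Y \<in> measurable M (borel_on RY)"
    and "Z \<in> measurable M (borel_on RZ)"
    and "prob_space.indep_vars M (\<lambda>_. borel_on RX \<Otimes>\<^sub>M (borel_on RY \<Otimes>\<^sub>M borel_on RZ))
           (\<lambda>i \<omega>. (Xs i \<omega>, Ys i \<omega>, Zs i \<omega>)) UNIV"
    and "\<And>i. distr M (borel_on RX \<Otimes>\<^sub>M (borel_on RY \<Otimes>\<^sub>M borel_on RZ)) (\<lambda>\<omega>. (Xs i \<omega>, Ys i \<omega>, Zs i \<omega>))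
              = distr M (borel_on RX \<Otimes>\<^sub>M (borel_on RY \<Otimes>\<^sub>M borel_on RZ)) (\<lambda>\<omega>. (X \<omega>, Y \<omega>, Z \<omega>))"
  \<comment> \<open>basis functions\<close>
    and "infinite L1" and "infinite L2" and "infinite L3"
    and "0 \<notin> L1" and "0 \<notin> L2" and "0 \<notin> L3"
    and "\<And>p i. p \<in> L1 \<Longrightarrow> i < p \<Longrightarrow> \<phi> p i \<in> borel_measurable (borel_on RX)"
    and "\<And>q j. q \<in> L2 \<Longrightarrow> j < q \<Longrightarrow> \<psi> q j \<in> borel_measurable (borel_on RY)"
    and "\<And>r k. r \<in> L3 \<Longrightarrow> k < r \<Longrightarrow> \<theta> r k \<in> borel_measurable (borel_on RZ)"
    and "tensor_complete M (borel_on RX) X (borel_on RZ) Z L1 \<phi> L3 \<theta>"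
    and "tensor_complete M (borel_on RY) Y (borel_on RZ) Z L2 \<psi> L3 \<theta>"
    and "\<And>p. p \<in> L1 \<Longrightarrow> \<exists>a0 :: nat \<Rightarrow> real. \<forall>x\<in>RX. (\<Sum>i<p. a0 i * \<phi> p i x) = 1"
    and "\<And>q. q \<in> L2 \<Longrightarrow> \<exists>b0 :: nat \<Rightarrow> real. \<forall>y\<in>RY. (\<Sum>j<q. b0 j * \<psi> q j y) = 1"
    and "\<And>p i x. p \<in> L1 \<Longrightarrow> i < p \<Longrightarrow> x \<in> RX \<Longrightarrow> \<bar>\<phi> p i x\<bar> \<le> 1"
    and "\<And>q j y. q \<in> L2 \<Longrightarrow> j < q \<Longrightarrow> y \<in> RY \<Longrightarrow> \<bar>\<psi> q j y\<bar> \<le> 1"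
  \<comment> \<open>distribution\<close>
    and "sigma_finite_measure \<mu>" and "sets \<mu> = sets (borel_on RX \<Otimes>\<^sub>M borel_on RY)"
    and "\<And>w. w \<in> RZ \<Longrightarrow> (\<lambda>v. f v w) \<in> borel_measurable \<mu>"
    and "\<And>v w. v \<in> RX \<times> RY \<Longrightarrow> w \<in> RZ \<Longrightarrow> 0 \<le> f v w"
    and "regular_cond_distr M (borel_on RX \<Otimes>\<^sub>M borel_on RY) (\<lambda>\<omega>. (X \<omega>, Y \<omega>)) (borel_on RZ) Z
           (\<lambda>w. density \<mu> (\<lambda>v. ennreal (f v w)))"
    and "distributed M lborel Z (\<lambda>w. ennreal (fZ w))"
    and "integrable \<mu> hbar"
    and "\<And>v. v \<in> RX \<times> RY \<Longrightarrow> twice_diff_bounded RZ (f v) (hbar v)"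
    and "twice_diff_bounded RZ fZ c0"
    and "\<And>w. w \<in> RZ \<Longrightarrow> 0 < fZ w \<and> 1 / fZ w \<le> c1"
  \<comment> \<open>kernel\<close>
    and "k0 \<in> borel_measurable borel" and "\<And>u. 0 \<le> k0 u" and "bdd_above (range k0)"
    and "has_bochner_integral lborel k0 1"
    and "has_bochner_integral lborel (\<lambda>u. k0 u *\<^sub>R u) 0"
    and "integrable lborel (\<lambda>u. (norm u)\<^sup>2 * k0 u)"
    and "\<gamma>2 > 0" and "\<gamma>3 > 0"
    and "\<And>u. k0 u \<le> \<gamma>2 ^ DIM('z) * exp (- \<gamma>3 * (norm u)\<^sup>2)"
  \<comment> \<open>bandwidth and evaluation points\<close>
    and "\<And>n. n \<ge> 1 \<Longrightarrow> h n > 0" and "\<And>n. n \<ge> 1 \<Longrightarrow> \<epsilon> n > 0"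
    and "c31 > 0" and "c32 > 0"
    and "1 / (real DIM('z) + 4) < \<alpha>" and "\<alpha> < 1 / real DIM('z)"
    and "\<And>n. n \<ge> 1 \<Longrightarrow> c31 * real n powr (- \<alpha>) \<le> h n \<and> h n \<le> c32 * real n powr (- \<alpha>)"
    and "\<beta> > 0" and "(\<lambda>n. h n / \<epsilon> n) \<in> O(\<lambda>n. real n powr (- \<beta>))"
    and "\<And>n. n \<ge> 1 \<Longrightarrow> nZ n \<ge> 1"
    and "\<And>n k. n \<ge> 1 \<Longrightarrow> k < nZ n \<Longrightarrow> z n k \<in> inner_region RZ (\<epsilon> n)"
    and "\<forall>\<^sub>F n in sequentially. \<forall>k<nZ n. \<forall>l<nZ n. k \<noteq> l \<longrightarrow> norm (z n k - z n l) \<ge> h n"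
  \<comment> \<open>eigenvalues and rates\<close>
    and "\<And>n. n \<ge> 1 \<Longrightarrow> p n \<in> L1" and "\<And>n. n \<ge> 1 \<Longrightarrow> q n \<in> L2"
    and "filterlim p at_top sequentially" and "filterlim q at_top sequentially"
    and "\<And>n. n \<ge> 1 \<Longrightarrow> \<delta> n > 0"
    and "\<And>n k. n \<ge> 1 \<Longrightarrow> k < nZ n \<Longrightarrow>
           min_eigenvalue (moment_mat (cexp \<mu> f (z n k)) (p n) (\<lambda>i v. \<phi> (p n) i (fst v))) \<ge> \<delta> n"
    and "\<And>n k. n \<ge> 1 \<Longrightarrow> k < nZ n \<Longrightarrow>
           min_eigenvalue (moment_mat (cexp \<mu> f (z n k)) (q n) (\<lambda>j v. \<psi> (q n) j (snd v))) \<ge> \<delta> n"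
    and "(\<lambda>n. real (nZ n) * (real (p n + q n))\<^sup>2 * max 1 (real (p n + q n) / \<delta> n))
           \<in> O(\<lambda>n. ln (real n) powr (1 / 16))"
  \<comment> \<open>discrepancy between the average over the evaluation points and the expectation\<close>
    and "c3 > 0" and "\<And>n. n \<ge> 1 \<Longrightarrow> \<eta> n > 0" and "\<eta> \<longlonglongrightarrow> 0"
    and "oP M
           (\<lambda>n _. (\<Sum>k<nZ n. fZ (z n k) * (rho \<phi> \<psi> (p n) (q n) (cexp \<mu> f (z n k)))\<^sup>2) / real (nZ n)
                   - c3 * (\<integral>\<omega>. (rho \<phi> \<psi> (p n) (q n) (cexp \<mu> f (Z \<omega>)))\<^sup>2 \<partial>M))
           \<eta>"
  \<comment> \<open>level, and the alternative\<close>
    and "0 < a" and "a < 1"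
    and "\<not> cond_indep M (borel_on RX) X (borel_on RY) Y (borel_on RZ) Z"
  shows "(\<lambda>n. measure M {\<omega> \<in> space M.
            test_stat \<phi> \<psi> k0 (h n) (p n) (q n) (nZ n) (z n) n
              (\<lambda>i. (Xs i \<omega>, Ys i \<omega>)) (\<lambda>i. Zs i \<omega>) \<ge> std_normal_quantile (1 - a)}) \<longlonglongrightarrow> 1"
proof -
  interpret K: kernel_setting M RX X RY Y RZ Z \<mu> f fZ hbar c0 c1 k0 Xs Ys Zs
  proof -
    interpret prob_space M by (rule assms(1))
    have sp: "space \<mu> = RX \<times> RY"
      using sets_eq_imp_space_eq[OF assms(24)] by (simp add: space_pair_measure space_restrict_space)
    show "kernel_setting M RX X RY Y RZ Z \<mu> f fZ hbar c0 c1 k0 Xs Ys Zs"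
    proof unfold_locales
      show "(\<lambda>v. f v z) \<in> borel_measurable \<mu>" if "z \<in> space (borel_on RZ)" for z
        using that assms(25) by (simp add: space_restrict_space)
      show "0 \<le> f v z" if "v \<in> space \<mu>" "z \<in> space (borel_on RZ)" for v z
        using that assms(26) sp by (simp add: space_restrict_space)
    qed (rule assms(2,3,4,5,6,7,24,27,28,29,30,31,32,33,34,35,36,38); assumption?)+
  qed
  define s where "s n = real (p n + q n)" for n
  define \<omega> where "\<omega> = 1 - \<alpha> * real DIM('z)"
  have \<omega>: "0 < \<omega>" using assms(47) by (simp add: \<omega>_def pos_less_divide_eq)
  have \<alpha>: "0 < \<alpha>" using assms(46) by (rule less_trans[rotated]) simp
  have n1: "\<forall>\<^sub>F n in sequentially. 1 \<le> n" by (rule eventually_ge_at_top)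
  have p1: "1 \<le> p n" if "1 \<le> n" for n using assms(54)[OF that] assms(11) by (cases "p n") auto
  have q1: "1 \<le> q n" if "1 \<le> n" for n using assms(55)[OF that] assms(12) by (cases "q n") auto
  obtain C where C: "0 < C" "\<forall>\<^sub>F n in sequentially. norm (real (nZ n) * (s n)\<^sup>2 * max 1 (s n / \<delta> n)) \<le> C * norm (ln (real n) powr (1 / 16))"
    using landau_o.bigE[OF assms(61)] unfolding s_def by blast
  define B where "B n = C * ln (real n) powr (1 / 16)" for n :: nat
  have rates: "\<forall>\<^sub>F n in sequentially. real (nZ n) * (s n)\<^sup>2 \<le> B n \<and> (s n)\<^sup>2 \<le> B n \<and> s n / \<delta> n \<le> B n"
    using C(2) n1
  proof eventually_elim
    case (elim n)
    let ?m = "max 1 (s n / \<delta> n)"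
    have nZ: "1 \<le> real (nZ n)" using assms(51)[OF elim(2)] by simp
    have s1: "1 \<le> (s n)\<^sup>2" using p1[OF elim(2)] by (simp add: s_def)
    have le: "real (nZ n) * (s n)\<^sup>2 * ?m \<le> B n" using elim(1) by (simp add: B_def)
    have ns: "1 \<le> real (nZ n) * (s n)\<^sup>2" using mult_mono[OF nZ s1] by simp
    have "real (nZ n) * (s n)\<^sup>2 * 1 \<le> real (nZ n) * (s n)\<^sup>2 * ?m" using ns by (intro mult_left_mono) auto
    moreover have "1 * (s n)\<^sup>2 \<le> real (nZ n) * (s n)\<^sup>2" using nZ by (intro mult_right_mono) auto
    moreover have "1 * ?m \<le> real (nZ n) * (s n)\<^sup>2 * ?m" using ns by (intro mult_right_mono) auto
    ultimately show ?case using le by auto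
  qed
  have B0: "0 \<le> B n" for n using C(1) by (simp add: B_def)
  have small: "(\<lambda>n. B n * real n powr (- x)) \<longlonglongrightarrow> 0" if "0 < x" for x
  proof -
    have "(\<lambda>n. C * ln (real n) powr (1 / 16) * real n powr (- x)) \<longlonglongrightarrow> 0" using that by real_asymp
    then show ?thesis by (simp add: B_def)
  qed
  have powr_small: "(\<lambda>n. real n powr (- x)) \<longlonglongrightarrow> 0" if "0 < x" for x using that by real_asymp
  have pw: "(real n powr u) ^ k = real n powr (u * real k)" if "1 \<le> n" for n k u
    using that by (simp add: powr_realpow[symmetric] powr_powr)
  define r where "r n = real n * h n ^ DIM('z)" for n
  have r_ge: "c31 ^ DIM('z) * real n powr \<omega> \<le> r n" if n: "1 \<le> n" for n
  proof -
    have "(c31 * real n powr (- \<alpha>)) ^ DIM('z) \<le> h n ^ DIM('z)"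
      using assms(48)[OF n] assms(44) by (intro power_mono) auto
    then have "real n * (c31 * real n powr (- \<alpha>)) ^ DIM('z) \<le> r n"
      unfolding r_def by (intro mult_left_mono) auto
    moreover have "real n * (c31 * real n powr (- \<alpha>)) ^ DIM('z) = c31 ^ DIM('z) * (real n * real n powr (- \<alpha> * real DIM('z)))"
      unfolding power_mult_distrib pw[OF n] by simp
    moreover have "real n * real n powr (- \<alpha> * real DIM('z)) = real n powr \<omega>"
      using n by (simp add: powr_mult_base \<omega>_def)
    ultimately show ?thesis by simp
  qed
  have r_pos: "0 < r n" if "1 \<le> n" for n using assms(42)[OF that] that by (simp add: r_def)
  obtain C' where C': "0 < C'" "\<forall>\<^sub>F n in sequentially. norm (h n / \<epsilon> n) \<le> C' * norm (real n powr (- \<beta>))"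
    using landau_o.bigE[OF assms(50)] by blast
  \<comment> \<open>The exponent leaves \<open>n h\<^sup>d t\<^sup>2\<close> at order at least \<open>n\<close> to the power \<open>\<omega> / 2\<close>, as the union bound requires.\<close>
  define t where "t n = real n powr (- (\<omega> / 4))" for n :: nat
  define ca cb where "ca = K.Lip * (1 + K.A2) * c32" and "cb = 2 * c0 * K.A2 * C'\<^sup>2"
  define \<tau> where "\<tau> n = t n + ca * real n powr (- \<alpha>) + cb * real n powr (- (2 * \<beta>))" for n :: nat
  have \<tau>_ge: "\<forall>\<^sub>F n in sequentially. t n + K.bias (h n) (\<epsilon> n) \<le> \<tau> n"
    using C'(2) n1
  proof eventually_elim
    case (elim n)
    have "K.Lip * h n * (1 + K.A2) \<le> K.Lip * (c32 * real n powr (- \<alpha>)) * (1 + K.A2)"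
      using assms(48)[OF elim(2)] K.Lip_nonneg K.A2_nonneg by (intro mult_right_mono mult_left_mono) auto
    moreover have "(2 * c0 / (\<epsilon> n)\<^sup>2) * (h n)\<^sup>2 * K.A2 \<le> cb * real n powr (- (2 * \<beta>))"
    proof -
      have "\<bar>h n / \<epsilon> n\<bar> \<le> C' * real n powr (- \<beta>)" using elim(1) by simp
      then have "(h n / \<epsilon> n)\<^sup>2 \<le> (C' * real n powr (- \<beta>))\<^sup>2" by (metis abs_ge_zero power2_abs power_mono)
      also have "\<dots> = C'\<^sup>2 * real n powr (- (2 * \<beta>))"
        unfolding power_mult_distrib pw[OF elim(2)] by (simp add: mult.commute)
      finally have "2 * c0 * K.A2 * (h n / \<epsilon> n)\<^sup>2 \<le> 2 * c0 * K.A2 * (C'\<^sup>2 * real n powr (- (2 * \<beta>)))"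
        using K.c0_nonneg K.A2_nonneg by (intro mult_left_mono) auto
      then show ?thesis by (simp add: cb_def power_divide mult_ac)
    qed
    ultimately show ?case unfolding K.bias_def \<tau>_def ca_def by (simp add: mult_ac)
  qed
  have "(\<lambda>n. t n + ca * real n powr (- \<alpha>) + cb * real n powr (- (2 * \<beta>))) \<longlonglongrightarrow> 0 + ca * 0 + cb * 0"
    unfolding t_def using \<omega> \<alpha> assms(49) by (intro tendsto_add tendsto_mult tendsto_const powr_small) auto
  then have \<tau>_lim: "\<tau> \<longlonglongrightarrow> 0" by (simp add: \<tau>_def[abs_def])
  have "(\<lambda>n. B n * real n powr (- (\<omega> / 4)) + ca * (B n * real n powr (- \<alpha>)) + cb * (B n * real n powr (- (2 * \<beta>)))) \<longlonglongrightarrow> 0 + ca * 0 + cb * 0"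
    using \<omega> \<alpha> assms(49) by (intro tendsto_intros small) auto
  then have \<tau>B_lim: "(\<lambda>n. \<tau> n * B n) \<longlonglongrightarrow> 0"
    by (simp add: \<tau>_def t_def algebra_simps)
  have "\<exists>c>0. \<exists>N. \<forall>p\<in>L1. \<forall>q\<in>L2. N \<le> p \<longrightarrow> N \<le> q \<longrightarrow>
      c \<le> (\<integral>\<omega>. (rho \<phi> \<psi> p q (cexp \<mu> f (Z \<omega>)))\<^sup>2 \<partial>M)"
    by (rule K.rho_bounded_below[OF assms(14) _ assms(15) _ assms(16) assms(10) assms(17) assms(18) assms(68)])
      (use assms(21,22) in \<open>simp_all add: space_restrict_space\<close>)
  then obtain c N0 where c: "0 < c" and lower: "\<And>p q. p \<in> L1 \<Longrightarrow> q \<in> L2 \<Longrightarrow> N0 \<le> p \<Longrightarrow> N0 \<le> q \<Longrightarrow>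
      c \<le> (\<integral>\<omega>. (rho \<phi> \<psi> p q (cexp \<mu> f (Z \<omega>)))\<^sup>2 \<partial>M)"
    by blast
  define b where "b = c3 * c / 2"
  have b: "0 < b" using c assms(62) by (simp add: b_def)
  have large: "\<forall>\<^sub>F n in sequentially. max 2 N0 \<le> p n \<and> max 2 N0 \<le> q n"
    using assms(56,57) unfolding filterlim_at_top by (intro eventually_conj) blast+
  have signal: "\<forall>\<^sub>F n in sequentially. real (nZ n) * b \<le> (\<Sum>k<nZ n. fZ (z n k) * (rho \<phi> \<psi> (p n) (q n) (cexp \<mu> f (z n k)))\<^sup>2)"
  proof -
    let ?S = "\<lambda>n. \<Sum>k<nZ n. fZ (z n k) * (rho \<phi> \<psi> (p n) (q n) (cexp \<mu> f (z n k)))\<^sup>2"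
    let ?E = "\<lambda>n. \<integral>\<omega>. (rho \<phi> \<psi> (p n) (q n) (cexp \<mu> f (Z \<omega>)))\<^sup>2 \<partial>M"
    \<comment> \<open>The discrepancy is not random, so that each of these events is empty or the whole space.\<close>
    have "(\<lambda>n. measure M {\<omega> \<in> space M. \<bar>?S n / real (nZ n) - c3 * ?E n\<bar> > 1 * \<eta> n}) \<longlonglongrightarrow> 0"
      using assms(65) unfolding oP_def by (elim allE[of _ 1]) simp
    then have "\<forall>\<^sub>F n in sequentially. measure M {\<omega> \<in> space M. \<bar>?S n / real (nZ n) - c3 * ?E n\<bar> > 1 * \<eta> n} < 1"
      by (rule order_tendstoD(2)) simp
    moreover have "\<forall>\<^sub>F n in sequentially. \<eta> n < b" using order_tendstoD(2)[OF assms(64) b] .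
    ultimately show ?thesis using large n1
    proof eventually_elim
      case (elim n)
      have "\<bar>?S n / real (nZ n) - c3 * ?E n\<bar> \<le> \<eta> n"
      proof (rule ccontr)
        assume "\<not> ?thesis"
        then have "{\<omega> \<in> space M. \<bar>?S n / real (nZ n) - c3 * ?E n\<bar> > 1 * \<eta> n} = space M" by auto
        then show False using elim(1) K.prob_space by simp
      qed
      moreover have "c3 * c \<le> c3 * ?E n"
        using lower[OF assms(54,55)[OF elim(4)]] elim(3) assms(62) by (intro mult_left_mono) auto
      ultimately have "b \<le> ?S n / real (nZ n)" using elim(2) unfolding b_def by linarith
      then show ?case using assms(51)[OF elim(4)] by (simp add: pos_le_divide_eq mult.commute)
    qed
  qed
  define x where "x = std_normal_quantile (1 - a)"
  \<comment> \<open>If \<open>n h\<^sup>d cK b / 2\<close> is at least \<open>m (p + q)\<^sup>2\<close>, the lower bound for the statistic is at least \<open>(m - 1) / 2 \<ge> x\<close>.\<close>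
  define m where "m = max 1 (2 * x + 1)"
  define cK where "cK = kernel_const k0"
  have cK: "0 < cK" unfolding cK_def by (rule K.kernel_const_pos)
  have m: "1 \<le> m" "2 * x + 1 \<le> m" by (auto simp: m_def)
  have cd: "0 < c31 ^ DIM('z)" using assms(44) by simp
  have divergence: "\<forall>\<^sub>F n in sequentially. m * (s n)\<^sup>2 \<le> r n * cK * (b / 2)"
  proof -
    have "0 < c31 ^ DIM('z) * cK * (b / 2) / m" using cd cK b m by simp
    then have "\<forall>\<^sub>F n in sequentially. B n * real n powr (- \<omega>) < c31 ^ DIM('z) * cK * (b / 2) / m"
      by (rule order_tendstoD(2)[OF small[OF \<omega>]])
    then show ?thesis using rates n1
    proof eventually_elim
      case (elim n)
      have pn: "0 < real n powr \<omega>" using elim(3) by simp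
      have "B n < c31 ^ DIM('z) * cK * (b / 2) / m * real n powr \<omega>"
        using elim(1) pn by (simp add: powr_minus divide_inverse[symmetric] pos_divide_less_eq)
      then have "m * B n \<le> (c31 ^ DIM('z) * real n powr \<omega>) * cK * (b / 2)"
        using m by (simp add: field_simps)
      also have "\<dots> \<le> r n * cK * (b / 2)" using r_ge[OF elim(3)] cK b by (intro mult_right_mono) auto
      finally show ?case using elim(2) m mult_left_mono[of "(s n)\<^sup>2" "B n" m] by linarith
    qed
  qed
  have \<tau>_small: "\<forall>\<^sub>F n in sequentially. \<tau> n < 1 / (2 * c1)"
    using K.c1_pos by (intro order_tendstoD(2)[OF \<tau>_lim]) simp
  have "(\<lambda>n. 96 * c0 * c1 * (\<tau> n * B n) + \<tau> n) \<longlonglongrightarrow> 96 * c0 * c1 * 0 + 0"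
    by (intro tendsto_intros \<tau>B_lim \<tau>_lim)
  then have loss: "\<forall>\<^sub>F n in sequentially. 96 * c0 * c1 * (\<tau> n * B n) + \<tau> n < b / 2"
    using b by (intro order_tendstoD(2)[where y = "96 * c0 * c1 * 0 + 0"]) auto
  define D where "D = 4 * (K.kmax * c0) / c31 ^ DIM('z)"
  let ?P = "\<lambda>n. measure M {\<omega> \<in> space M. x \<le> test_stat \<phi> \<psi> k0 (h n) (p n) (q n) (nZ n) (z n) n
              (\<lambda>i. (Xs i \<omega>, Ys i \<omega>)) (\<lambda>i. Zs i \<omega>)}"
  have bound: "\<forall>\<^sub>F n in sequentially. 1 - D * (B n * real n powr (- (\<omega> / 2))) \<le> ?P n"
    using n1 large rates \<tau>_ge \<tau>_small loss signal divergence
  proof eventually_elim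
    case (elim n)
    note n = \<open>1 \<le> n\<close>
    have sp: "0 < s n" using p1[OF n] by (simp add: s_def)
    have pn: "0 < real n" using n by simp
    have tn: "0 < t n" using n by (simp add: t_def)
    obtain a0 where a0: "\<And>x. x \<in> RX \<Longrightarrow> (\<Sum>i<p n. a0 i * \<phi> (p n) i x) = 1" using assms(19)[OF assms(54)[OF n]] by blast
    obtain b0 where b0: "\<And>y. y \<in> RY \<Longrightarrow> (\<Sum>j<q n. b0 j * \<psi> (q n) j y) = 1" using assms(20)[OF assms(55)[OF n]] by blast
    have U: "(\<lambda>w. \<phi> (p n) i (fst w)) \<in> K.unit_functions" if "i < p n" for i
      unfolding K.unit_functions_def K.measurable_\<mu>_iff K.space_\<mu>'
      using assms(14)[OF assms(54)[OF n] that] assms(21)[OF assms(54)[OF n] that] by auto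
    have V: "(\<lambda>w. \<psi> (q n) j (snd w)) \<in> K.unit_functions" if "j < q n" for j
      unfolding K.unit_functions_def K.measurable_\<mu>_iff K.space_\<mu>'
      using assms(15)[OF assms(55)[OF n] that] assms(22)[OF assms(55)[OF n] that] by auto
    have \<tau>0: "0 \<le> \<tau> n" unfolding \<tau>_def t_def ca_def cb_def
      using K.Lip_nonneg K.A2_nonneg K.c0_nonneg assms(45) by simp
    have loss': "96 * c0 * c1 * (\<tau> n * (real (p n + q n) / \<delta> n)) + \<tau> n \<le> b / 2"
    proof -
      have "\<tau> n * (s n / \<delta> n) \<le> \<tau> n * B n" using \<tau>0 elim(3) by (intro mult_left_mono) auto
      then have "96 * c0 * c1 * (\<tau> n * (s n / \<delta> n)) \<le> 96 * c0 * c1 * (\<tau> n * B n)"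
        by (rule mult_left_mono) (use K.c0_nonneg K.c1_pos in simp)
      then show ?thesis using elim(6) unfolding s_def by linarith
    qed
    have div: "m * (s n)\<^sup>2 \<le> r n * cK * (b / 2)" using elim(8) .
    have s2: "0 < (s n)\<^sup>2" using sp by simp
    have big1: "(real (p n + q n))\<^sup>2 \<le> real n * h n ^ DIM('z) * kernel_const k0 * (b / 2)"
      using div mult_right_mono[OF m(1), of "(s n)\<^sup>2"] unfolding r_def cK_def s_def by simp
    have big2: "x \<le> (real n * h n ^ DIM('z) * kernel_const k0 * (b / 2) - (real (p n + q n))\<^sup>2) / (2 * (real (p n + q n))\<^sup>2)"
    proof -
      have "(2 * x + 1) * (s n)\<^sup>2 \<le> r n * cK * (b / 2)"
        using div mult_right_mono[OF m(2), of "(s n)\<^sup>2"] s2 by linarith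
      then have "x * (2 * (s n)\<^sup>2) \<le> r n * cK * (b / 2) - (s n)\<^sup>2" by (simp add: algebra_simps)
      then show ?thesis using s2 unfolding r_def cK_def s_def by (simp add: pos_le_divide_eq)
    qed
    have "1 - real (nZ n * (p n + q n + 1)\<^sup>2) * (K.kmax * c0 / (real n * h n ^ DIM('z) * (t n)\<^sup>2)) \<le> ?P n"
      by (rule K.test_power_bound[where \<delta>="\<delta> n" and e="\<epsilon> n" and b=b and \<tau>="\<tau> n" and ?a0.0=a0 and ?b0.0=b0])
        (use elim n assms(42,43,58)[OF n] assms(51)[OF n] assms(52,59,60)[OF n] tn b U V a0 b0 loss' big1 big2 in auto)
    moreover have "real (nZ n * (p n + q n + 1)\<^sup>2) * (K.kmax * c0 / (real n * h n ^ DIM('z) * (t n)\<^sup>2))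
        \<le> D * (B n * real n powr (- (\<omega> / 2)))"
    proof -
      have "real (p n + q n + 1) \<le> 2 * s n" using p1[OF n] by (simp add: s_def)
      then have "(real (p n + q n + 1))\<^sup>2 \<le> (2 * s n)\<^sup>2" by (intro power_mono) auto
      then have "real (nZ n) * (real (p n + q n + 1))\<^sup>2 \<le> real (nZ n) * (2 * s n)\<^sup>2" by (intro mult_left_mono) auto
      also have "\<dots> \<le> 4 * B n" using elim(3) by (simp add: power_mult_distrib)
      finally have 1: "real (nZ n * (p n + q n + 1)\<^sup>2) \<le> 4 * B n" by simp
      have t2: "(t n)\<^sup>2 = real n powr (- (\<omega> / 2))" unfolding t_def pw[OF n] by simp
      have "c31 ^ DIM('z) * real n powr (\<omega> / 2) = (c31 ^ DIM('z) * real n powr \<omega>) * (t n)\<^sup>2"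
        unfolding t2 by (simp add: powr_add[symmetric])
      also have "\<dots> \<le> r n * (t n)\<^sup>2" by (intro mult_right_mono r_ge n) simp
      finally have rt: "c31 ^ DIM('z) * real n powr (\<omega> / 2) \<le> r n * (t n)\<^sup>2" .
      have 2: "K.kmax * c0 / (r n * (t n)\<^sup>2) \<le> K.kmax * c0 / (c31 ^ DIM('z) * real n powr (\<omega> / 2))"
        using K.kmax_nonneg K.c0_nonneg cd pn by (intro divide_left_mono rt mult_nonneg_nonneg mult_pos_pos r_pos n) (auto simp: t_def)
      have "real (nZ n * (p n + q n + 1)\<^sup>2) * (K.kmax * c0 / (r n * (t n)\<^sup>2))
          \<le> (4 * B n) * (K.kmax * c0 / (c31 ^ DIM('z) * real n powr (\<omega> / 2)))"
        using B0[of n] K.kmax_nonneg K.c0_nonneg r_pos[OF n] by (intro mult_mono 1 2) auto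
      also have "\<dots> = D * (B n * real n powr (- (\<omega> / 2)))" using pn by (simp add: D_def powr_minus field_simps)
      finally show ?thesis by (simp add: r_def)
    qed
    ultimately show ?case by linarith
  qed
  have "(\<lambda>n. 1 - D * (B n * real n powr (- (\<omega> / 2)))) \<longlonglongrightarrow> 1 - D * 0"
    using \<omega> by (intro tendsto_intros small) simp
  then have "(\<lambda>n. 1 - D * (B n * real n powr (- (\<omega> / 2)))) \<longlonglongrightarrow> 1" by simp
  from tendsto_sandwich[OF bound _ this tendsto_const] have "?P \<longlonglongrightarrow> 1"
    by (simp add: K.prob_le_1)
  then show ?thesis unfolding x_def .
qed

end
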